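(* Let $\alpha,\beta>0$ and suppose $L_n,R_n\to\infty$ with $\lim_{n\to\infty}R_n/L_n=\gamma\in(0,\infty)$. Let $(B_t)_{t\ge 0}$ be the bipartite random (simple) graph process with parameters $\alpha,\beta$ on parts $\mathcal L,\mathcal R$ with $|\mathcal L|=L_n$, $|\mathcal R|=R_n$. Define $$t_c:=\frac{\sqrt{\gamma}}{(\gamma+1)\sqrt{(1+1/\alpha)(1+1/\beta)}} .$$ For any $t\ge 0$, let $\mathcal C_1(t)$ and $\mathcal C_2(t)$ denote respectively the largest and the second largest connected components of the graph $B_t$. (Supercritical regime.) If $t=t_\epsilon^+=t_c(1+\epsilon)(L_n+R_n)$ for some constant $\epsilon>0$, then $$\frac{|\mathcal C_1(t_\epsilon^+)|}{L_n+R_n}\to\frac{\xi_L(\epsilon)+\gamma\,\xi_R(\epsilon)}{1+\gamma}>0\quad\text{in probability as } n\to\infty.$$ To describe the limit, put $$p_L(\epsilon)=\frac{\sqrt{\gamma^{-1}(1+\frac1\alpha)(1+\frac1\beta)}}{\sqrt{\gamma^{-1}(1+\frac1\alpha)(1+\frac1\beta)}+\frac{\alpha}{1+\epsilon}},\qquad p_R(\epsilon)=\frac{\sqrt{\gamma(1+\frac1\alpha)(1+\frac1\beta)}}{\sqrt{\gamma(1+\frac1\alpha)(1+\frac1\beta)}+\frac{\beta}{1+\epsilon}},$$ and let $\eta_L=\eta_L(\epsilon)$ be the smallest solution to the equation $$p_R(\epsilon)\left(\frac{1-p_L(\epsilon)}{1-\eta_L p_L(\epsilon)}\right)^{\alpha+1}=1-(1-p_R(\epsilon))(1-\eta_L)^{-(\beta+1)^{-1}}.$$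 Then, writing simply $\xi_L$ and $\xi_R$ for respectively $\xi_L(\epsilon)$ and $\xi_R(\epsilon)$, $$\xi_L=1-\left(\frac{1-p_L(\epsilon)}{1-\eta_L p_L(\epsilon)}\right)^{\alpha},\qquad \xi_R=1-\left(\frac{1-p_R(\epsilon)}{1-\eta_R p_R(\epsilon)}\right)^{\beta}\quad\text{with}\quad \eta_R=\left(\frac{1-p_L(\epsilon)}{1-p_L(\epsilon)\eta_L}\right)^{\alpha+1}.$$ Furthermore, the second largest component satisfies $\frac{|\mathcal C_2(t_\epsilon^+)|}{L_n+R_n}\to 0$ in probability. (Subcritical regime.) If $t=t_\epsilon^-=t_c(1-\epsilon)(L_n+R_n)$ for some $\epsilon>0$, then $\frac{|\mathcal C_1(t_\epsilon^-)|}{L_n+R_n}\to 0$ in probability.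
   Context: The vertex set is $V=\mathcal L\cup\mathcal R$, a disjoint union, with $|\mathcal L|=L_n$, $|\mathcal R|=R_n$. The process $(B_t)_{t\ge0}$ starts from the empty graph $B_0$ on $V$ (only isolated vertices). Given $B_t$, one samples a pair $\{u,v\}$ of currently non-adjacent vertices with $u\in\mathcal L$, $v\in\mathcal R$, with probability proportional (among all such non-adjacent pairs) to $(d_u(t)+\alpha)(d_v(t)+\beta)$, where $d_w(t)$ is the degree of $w$ in $B_t$, and adds the edge $\{u,v\}$ to $B_t$ to obtain $B_{t+1}$. The constants $\alpha,\beta$ may be unequal. $|\mathcal C|$ denotes the size (number of vertices) of a component $\mathcal C$.
   Formalization: The printed limit is false (α=β=γ=1, ε=1/2 gives 0.46, but |C_1|≤t+1 forces ≤0.375). Proved with the square roots in p_L and p_R replaced by their reciprocals, and with η_L^{-1/(β+1)} in place of (1-η_L)^{-1/(β+1)} in the equation for η_L. *)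

theory Defs
  imports "HOL-Probability.Probability" "HOL-Library.More_List"
begin

section \<open>Bipartite simple graphs and their components\<close>

text \<open>
  Vertices are of type \<open>nat + nat\<close>: \<open>Inl\<close> tags the part of size \<open>l\<close>, \<open>Inr\<close> the part of size \<open>r\<close>,
  so the two parts are disjoint by construction. Since the vertex set never changes, a graph is
  represented by its set of edges, an edge being the unordered pair of its end points.
\<close>

type_synonym vertex = "nat + nat"
type_synonym graph = "vertex set set"

definition left_part :: "nat \<Rightarrow> vertex set" where
  "left_part l = Inl ` {..<l}"

definition right_part :: "nat \<Rightarrow> vertex set" where
  "right_part r = Inr ` {..<r}"

definition vertices :: "nat \<Rightarrow> nat \<Rightarrow> vertex set" where
  "vertices l r = left_part l \<union> right_part r"

definition degree :: "graph \<Rightarrow> vertex \<Rightarrow> nat" where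
  "degree E w = card {e \<in> E. w \<in> e}"

definition adjacency :: "graph \<Rightarrow> vertex rel" where
  "adjacency E = {(x, y). {x, y} \<in> E}"

definition components :: "nat \<Rightarrow> nat \<Rightarrow> graph \<Rightarrow> vertex set set" where
  "components l r E = vertices l r // (adjacency E)\<^sup>*"

text \<open>
  The list of all component sizes in descending order, with multiplicity. Hence if two components
  tie for the largest size, the largest and the second largest component have the same size.
\<close>

definition component_sizes :: "nat \<Rightarrow> nat \<Rightarrow> graph \<Rightarrow> nat list" where
  "component_sizes l r E =
     rev (sorted_list_of_multiset (image_mset card (mset_set (components l r E))))"

text \<open>The size is \<open>0\<close> if there is no such component.\<close>

definition size_C1 :: "nat \<Rightarrow> nat \<Rightarrow> graph \<Rightarrow> nat" where
  "size_C1 l r E = nth_default 0 (component_sizes l r E) 0"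

definition size_C2 :: "nat \<Rightarrow> nat \<Rightarrow> graph \<Rightarrow> nat" where
  "size_C2 l r E = nth_default 0 (component_sizes l r E) 1"


section \<open>The random graph process\<close>

text \<open>
  The probability distribution on \<open>A\<close> proportional to \<open>w\<close>; meaningful under the assumptions of
  the lemma below.
\<close>

definition proportional_pmf :: "('a \<Rightarrow> real) \<Rightarrow> 'a set \<Rightarrow> 'a pmf" where
  "proportional_pmf w A = embed_pmf (\<lambda>x. if x \<in> A then w x / (\<Sum>y\<in>A. w y) else 0)"

lemma pmf_proportional_pmf:
  assumes "finite A" "A \<noteq> {}" "\<And>x. x \<in> A \<Longrightarrow> 0 < w x"
  shows "pmf (proportional_pmf w A) x = (if x \<in> A then w x / (\<Sum>y\<in>A. w y) else 0)"
proof -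
  let ?f = "\<lambda>x. if x \<in> A then w x / (\<Sum>y\<in>A. w y) else 0"
  have pos: "0 < (\<Sum>y\<in>A. w y)"
    using assms by (intro sum_pos) auto
  have nonneg: "0 \<le> ?f x" for x
    using assms(3) pos by (auto intro!: divide_nonneg_nonneg less_imp_le)
  have "(\<integral>\<^sup>+x. ennreal (?f x) \<partial>count_space UNIV) = (\<integral>\<^sup>+x. ennreal (?f x) \<partial>count_space A)"
    by (subst nn_integral_count_space_indicator)
       (auto intro!: nn_integral_cong simp: indicator_def)
  also have "\<dots> = (\<Sum>x\<in>A. ennreal (?f x))"
    using assms(1) by (simp add: nn_integral_count_space_finite)
  also have "\<dots> = ennreal (\<Sum>x\<in>A. ?f x)"
    by (intro sum_ennreal nonneg)
  also have "(\<Sum>x\<in>A. ?f x) = 1"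
    using pos by (simp flip: sum_divide_distrib)
  finally show ?thesis
    unfolding proportional_pmf_def by (subst pmf_embed_pmf) (use nonneg in auto)
qed

definition available_pairs :: "nat \<Rightarrow> nat \<Rightarrow> graph \<Rightarrow> (vertex \<times> vertex) set" where
  "available_pairs l r E = {(u, v). u \<in> left_part l \<and> v \<in> right_part r \<and> {u, v} \<notin> E}"

definition pair_weight :: "real \<Rightarrow> real \<Rightarrow> graph \<Rightarrow> vertex \<times> vertex \<Rightarrow> real" where
  "pair_weight \<alpha> \<beta> E = (\<lambda>(u, v). (real (degree E u) + \<alpha>) * (real (degree E v) + \<beta>))"

text \<open>Once the graph is complete bipartite no edge can be added, and the process stays put.\<close>

definition add_random_edge :: "nat \<Rightarrow> nat \<Rightarrow> real \<Rightarrow> real \<Rightarrow> graph \<Rightarrow> graph pmf" where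
  "add_random_edge l r \<alpha> \<beta> E =
     (if available_pairs l r E = {} then return_pmf E
      else map_pmf (\<lambda>(u, v). insert {u, v} E)
             (proportional_pmf (pair_weight \<alpha> \<beta> E) (available_pairs l r E)))"

text \<open>\<open>graph_process l r \<alpha> \<beta> t\<close> is the law of the graph \<open>B\<^sub>t\<close>.\<close>

primrec graph_process :: "nat \<Rightarrow> nat \<Rightarrow> real \<Rightarrow> real \<Rightarrow> nat \<Rightarrow> graph pmf" where
  "graph_process l r \<alpha> \<beta> 0 = return_pmf {}"
| "graph_process l r \<alpha> \<beta> (Suc t) = bind_pmf (graph_process l r \<alpha> \<beta> t) (add_random_edge l r \<alpha> \<beta>)"

text \<open>
  Convergence in probability to a constant; the \<open>n\<close>-th variable \<open>X n\<close> lives on its own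
  probability space \<open>P n\<close>.
\<close>

definition tendsto_in_prob :: "(nat \<Rightarrow> 'a pmf) \<Rightarrow> (nat \<Rightarrow> 'a \<Rightarrow> real) \<Rightarrow> real \<Rightarrow> bool" where
  "tendsto_in_prob P X c \<longleftrightarrow>
     (\<forall>\<delta>>0. (\<lambda>n. measure_pmf.prob (P n) {x. \<bar>X n x - c\<bar> > \<delta>}) \<longlonglongrightarrow> 0)"


section \<open>The critical time and the limiting constants\<close>

definition t_crit :: "real \<Rightarrow> real \<Rightarrow> real \<Rightarrow> real" where
  "t_crit \<alpha> \<beta> \<gamma> = sqrt \<gamma> / ((\<gamma> + 1) * sqrt ((1 + 1 / \<alpha>) * (1 + 1 / \<beta>)))"

text \<open>
  The number of steps at time \<open>c (l + r)\<close>, rounded down (and \<open>0\<close> for negative \<open>c\<close>).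
\<close>

definition steps :: "real \<Rightarrow> nat \<Rightarrow> nat \<Rightarrow> nat" where
  "steps c l r = nat \<lfloor>c * real (l + r)\<rfloor>"

text \<open>
  At time \<open>t\<^sub>c (1 + \<epsilon>) (L\<^sub>n + R\<^sub>n)\<close> the mean degree in the left part tends to
  \<open>t\<^sub>c (1 + \<epsilon>) (1 + \<gamma>) = (1 + \<epsilon>) sqrt (\<gamma> / ((1 + 1/\<alpha>) (1 + 1/\<beta>)))\<close>, and the degrees there are
  asymptotically negative binomial, with generating function
  \<open>((1 - p\<^sub>L) / (1 - p\<^sub>L x)) powr \<alpha>\<close> and mean \<open>\<alpha> p\<^sub>L / (1 - p\<^sub>L)\<close>. This determines \<open>p\<^sub>L\<close>;
  similarly for \<open>p\<^sub>R\<close>. (In the published formulas for \<open>p\<^sub>L\<close> and \<open>p\<^sub>R\<close> the square roots are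
  inverted, which is a misprint: it contradicts these means and the value of \<open>t\<^sub>c\<close>.)
\<close>

definition p_L :: "real \<Rightarrow> real \<Rightarrow> real \<Rightarrow> real \<Rightarrow> real" where
  "p_L \<alpha> \<beta> \<gamma> \<epsilon> =
     (let s = 1 / sqrt ((1 / \<gamma>) * (1 + 1 / \<alpha>) * (1 + 1 / \<beta>)) in s / (s + \<alpha> / (1 + \<epsilon>)))"

definition p_R :: "real \<Rightarrow> real \<Rightarrow> real \<Rightarrow> real \<Rightarrow> real" where
  "p_R \<alpha> \<beta> \<gamma> \<epsilon> =
     (let s = 1 / sqrt (\<gamma> * (1 + 1 / \<alpha>) * (1 + 1 / \<beta>)) in s / (s + \<beta> / (1 + \<epsilon>)))"

text \<open>
  The solutions of the equation for \<open>\<eta>\<^sub>L\<close>, among all real \<open>x\<close> for which the bases of its real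
  powers are positive. The equation is obtained by eliminating \<open>\<eta>\<^sub>R\<close> from the extinction equations
  \<open>\<eta>\<^sub>L = ((1 - p\<^sub>R) / (1 - p\<^sub>R \<eta>\<^sub>R)) powr (\<beta> + 1)\<close> and
  \<open>\<eta>\<^sub>R = ((1 - p\<^sub>L) / (1 - p\<^sub>L \<eta>\<^sub>L)) powr (\<alpha> + 1)\<close> of the two-type branching process in which the
  offspring numbers are size-biased degrees minus one. (The published equation has
  \<open>1 - \<eta>\<^sub>L\<close> in place of \<open>\<eta>\<^sub>L\<close> as the base of the power on the right, a misprint.)
\<close>

definition eta_L_solutions :: "real \<Rightarrow> real \<Rightarrow> real \<Rightarrow> real \<Rightarrow> real set" where
  "eta_L_solutions \<alpha> \<beta> \<gamma> \<epsilon> =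
     {x. 0 < x \<and> x * p_L \<alpha> \<beta> \<gamma> \<epsilon> < 1 \<and>
         p_R \<alpha> \<beta> \<gamma> \<epsilon> *
           ((1 - p_L \<alpha> \<beta> \<gamma> \<epsilon>) / (1 - x * p_L \<alpha> \<beta> \<gamma> \<epsilon>)) powr (\<alpha> + 1)
         = 1 - (1 - p_R \<alpha> \<beta> \<gamma> \<epsilon>) * x powr (- (1 / (\<beta> + 1)))}"

definition is_smallest :: "real \<Rightarrow> real set \<Rightarrow> bool" where
  "is_smallest x S \<longleftrightarrow> x \<in> S \<and> (\<forall>y\<in>S. x \<le> y)"

end

theory Submission
  imports Defs
begin

text \<open>
  Record of each component the numbers of its left vertices, right vertices and edges. These types
  evolve by coagulation: two components merge at a rate proportional to the left weight (sum of
  \<open>degree + \<alpha>\<close>) of one times the right weight (sum of \<open>degree + \<beta>\<close>) of the other, and both weights are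
  functions of the type. Pairs that are already adjacent lie in the same component, so the simplicity
  constraint perturbs this dynamics only by \<open>O(1/n)\<close> per step as long as the third moments of the
  degrees are bounded; a Gronwall argument for the second moments then yields the fluid limit of the
  numbers of components of each fixed type.

  The limiting Smoluchowski equation is solved explicitly by the law of the total progeny of the
  two-type branching process with negative binomial offspring, so the extinction probabilities give
  the proportion of vertices in bounded components, at all times and in both regimes.

  In the supercritical regime stop at a slightly earlier time and sprinkle the remaining edges. A given
  splitting of the components with more than \<open>m\<close> vertices into two parts of linear size survives with
  a probability exponentially small in \<open>n\<close>, uniformly in \<open>m\<close>, while there are at most \<open>2 powr (n / m)\<close>
  splittings; hence for large \<open>m\<close> almost all these vertices end up in one component. Convexity of the
  generating functions makes the extinction probabilities left-continuous in time, which closes the gap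
  between the two times.
\<close>

text \<open>The edge count belongs to the type because the weights depend on it and must do so again
  after a merger. Two trees merge into a tree, so in the limit only trees carry density. The count
  of a type changes at a rate that involves only the finitely many types into which it splits and
  the total weights \<open>W_L\<close> and \<open>W_R\<close>, which are deterministic because the
  number of edges is the time. So a finite set of types closed under splitting is a closed system
  that does not see the giant component, and one Gronwall estimate crosses the critical time.

  The explicit solution rests on one identity: a branching forest with one left and one right root
  is a pair of independent trees, so its size law is a convolution, and this is the gain term of the
  equation. Choosing such a root edge multiplies a tree density by the number of edges, and this
  factor is also what differentiating the power of time produces.

  The subscripts of \<eta> in the theorem name the end from which an edge is explored: \<eta> with
  index L is the extinction probability of a tree whose root is on the right, and vice
  versa.\<close>

definition nb_coeff :: "real \<Rightarrow> nat \<Rightarrow> real" where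
  "nb_coeff x c = pochhammer x c / fact c"

lemma nb_coeff_0 [simp]: "nb_coeff x 0 = 1"
  by (simp add: nb_coeff_def)

lemma nb_coeff_zero_left: "nb_coeff 0 c = (if c = 0 then 1 else 0)"
  by (simp add: nb_coeff_def pochhammer_0_left)

lemma nb_coeff_nonneg: "0 \<le> x \<Longrightarrow> 0 \<le> nb_coeff x c"
  by (simp add: nb_coeff_def pochhammer_prod prod_nonneg)

lemma nb_coeff_Suc: "real (Suc c) * nb_coeff x (Suc c) = x * nb_coeff (x + 1) c"
proof -
  have "real (Suc c) * nb_coeff x (Suc c) = (real (Suc c) / fact (Suc c)) * (x * pochhammer (x + 1) c)"
    unfolding nb_coeff_def pochhammer_rec by simp
  also have "real (Suc c) / fact (Suc c) = 1 / fact c"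
    by (simp add: divide_simps)
  finally show ?thesis by (simp add: nb_coeff_def)
qed

text \<open>Comparison of coefficients in (1 - z) powr (-x) times (1 - z) powr (-y); equivalently,
  the binomial theorem for rising factorials.\<close>

lemma nb_coeff_Vandermonde:
  "(\<Sum>c\<le>n. nb_coeff x c * nb_coeff y (n - c)) = nb_coeff (x + y) n"
  unfolding nb_coeff_def pochhammer_binomial_sum sum_divide_distrib
  by (intro sum.cong refl) (simp add: binomial_fact)

text \<open>For positive x and y the summands of the plain identity are Polya urn weights, and each
  of the n draws has the first colour with probability x / (x + y). The factor c is absorbed by
  \<open>nb_coeff_Suc\<close>, which raises x by one and leaves a plain Vandermonde sum.\<close>

lemma nb_coeff_Vandermonde_weighted:
  assumes "x + y \<noteq> 0"
  shows "(\<Sum>c\<le>n. real c * nb_coeff x c * nb_coeff y (n - c)) = x / (x + y) * real n * nb_coeff (x + y) n"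
proof (cases n)
  case (Suc m)
  have "(\<Sum>c\<le>n. real c * nb_coeff x c * nb_coeff y (n - c))
      = (\<Sum>c\<le>m. real (Suc c) * nb_coeff x (Suc c) * nb_coeff y (m - c))"
    unfolding Suc by (subst sum.atMost_Suc_shift) simp
  also have "\<dots> = x * (\<Sum>c\<le>m. nb_coeff (x + 1) c * nb_coeff y (m - c))"
    unfolding nb_coeff_Suc by (simp add: sum_distrib_left mult.assoc)
  also have "\<dots> = x * nb_coeff (x + y + 1) m"
    unfolding nb_coeff_Vandermonde by (simp add: add_ac)
  also have "\<dots> = x / (x + y) * real n * nb_coeff (x + y) n"
  proof -
    have "x / (x + y) * real n * nb_coeff (x + y) n = x / (x + y) * (real (Suc m) * nb_coeff (x + y) (Suc m))"
      unfolding Suc by simp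
    also have "\<dots> = x * nb_coeff (x + y + 1) m"
      unfolding nb_coeff_Suc using assms by simp
    finally show ?thesis by simp
  qed
  finally show ?thesis .
qed simp

lemma nb_series:
  assumes "\<bar>z\<bar> < 1"
  shows "(\<lambda>c. nb_coeff x c * z ^ c) sums (1 - z) powr (- x)"
proof -
  have "nb_coeff x c * z ^ c = ((- x) gchoose c) * (- z) ^ c" for c
    unfolding nb_coeff_def gbinomial_pochhammer by (simp add: power_minus')
  then show ?thesis
    using gen_binomial_real[of "- z" "- x"] assms by simp
qed

section \<open>Total progeny of the two-type branching process\<close>

text \<open>
  Kemperman's formula for two types: \<open>forest_coeff A B i j a b\<close> is the coefficient for a forest
  with \<open>i\<close> left and \<open>j\<close> right roots and \<open>a\<close> left and \<open>b\<close> right nodes in total, where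
  \<open>nb_coeff A\<close> and \<open>nb_coeff B\<close> are the weights of the numbers of children, which have the opposite type.
\<close>

definition forest_coeff :: "real \<Rightarrow> real \<Rightarrow> nat \<Rightarrow> nat \<Rightarrow> nat \<Rightarrow> nat \<Rightarrow> real" where
  "forest_coeff A B i j a b =
     (if i \<le> a \<and> j \<le> b then
        nb_coeff (real a * A) (b - j) * nb_coeff (real b * B) (a - i) *
        (if a = 0 then 1 else real i / real a + real j * real (a - i) / (real a * real b))
      else 0)"

lemma forest_coeff_nonneg: "0 \<le> A \<Longrightarrow> 0 \<le> B \<Longrightarrow> 0 \<le> forest_coeff A B i j a b"
  unfolding forest_coeff_def by (auto intro!: mult_nonneg_nonneg nb_coeff_nonneg add_nonneg_nonneg)

text \<open>The children of one left root are revealed: a root with c right children is replaced by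
  c right roots. The last factor of \<open>forest_coeff\<close> is linear in the number of right
  roots, so the sum over c is a combination of the plain and the weighted Vandermonde sums.\<close>

lemma forest_coeff_left:
  assumes "0 < A"
  shows "forest_coeff A B (Suc i) j (Suc a) b =
         (\<Sum>c\<le>b - j. nb_coeff A c * forest_coeff A B i (j + c) a b)"
proof (cases "i \<le> a \<and> j \<le> b")
  case True
  define m where "m = b - j"
  have b: "b = j + m" using True m_def by simp
  define N where "N = nb_coeff (real b * B) (a - i)"
  have step: "nb_coeff A c * forest_coeff A B i (j + c) a b =
      N * (nb_coeff A c * nb_coeff (real a * A) (m - c) *
      (if a = 0 then 1 else real i / real a + real (j + c) * real (a - i) / (real a * real b)))"
    if "c \<le> m" for c
    using that True unfolding forest_coeff_def b N_def by simp
  have L: "(\<Sum>c\<le>b - j. nb_coeff A c * forest_coeff A B i (j + c) a b) =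
      N * (\<Sum>c\<le>m. nb_coeff A c * nb_coeff (real a * A) (m - c) *
      (if a = 0 then 1 else real i / real a + real (j + c) * real (a - i) / (real a * real b)))"
    unfolding m_def[symmetric] sum_distrib_left by (intro sum.cong refl step) simp
  have AA: "A + real a * A = real (Suc a) * A"
    by (simp add: algebra_simps)
  have V: "(\<Sum>c\<le>m. nb_coeff A c * nb_coeff (real a * A) (m - c)) = nb_coeff (real (Suc a) * A) m"
    unfolding nb_coeff_Vandermonde AA ..
  have W: "(\<Sum>c\<le>m. real c * nb_coeff A c * nb_coeff (real a * A) (m - c)) =
      real m / real (Suc a) * nb_coeff (real (Suc a) * A) m"
    using assms by (subst nb_coeff_Vandermonde_weighted)
      (simp_all only: AA, auto simp: divide_simps)
  show ?thesis
  proof (cases "a = 0")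
    case a0: True
    then have "i = 0" using True by simp
    then show ?thesis
      unfolding L using a0 True V by (simp add: forest_coeff_def N_def m_def)
  next
    case False
    have "(\<Sum>c\<le>m. nb_coeff A c * nb_coeff (real a * A) (m - c) *
      (if a = 0 then 1 else real i / real a + real (j + c) * real (a - i) / (real a * real b))) =
      (real i / real a + real j * real (a - i) / (real a * real b)) *
        (\<Sum>c\<le>m. nb_coeff A c * nb_coeff (real a * A) (m - c)) +
      real (a - i) / (real a * real b) * (\<Sum>c\<le>m. real c * nb_coeff A c * nb_coeff (real a * A) (m - c))"
      using False unfolding sum_distrib_left sum.distrib[symmetric]
      by (intro sum.cong refl) (simp add: algebra_simps add_divide_distrib)
    also have "\<dots> = nb_coeff (real (Suc a) * A) m *
        (real i / real a + real (a - i) / (real a * real b) * (real j + real m / real (Suc a)))"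
      unfolding V W by (simp add: algebra_simps add_divide_distrib)
    finally have E: "(\<Sum>c\<le>b - j. nb_coeff A c * forest_coeff A B i (j + c) a b) = 
        N * nb_coeff (real (Suc a) * A) m *
        (real i / real a + real (a - i) / (real a * real b) * (real j + real m / real (Suc a)))"
      unfolding L by simp
    have R: "forest_coeff A B (Suc i) j (Suc a) b = N * nb_coeff (real (Suc a) * A) m *
        (real (Suc i) / real (Suc a) + real j * real (a - i) / (real (Suc a) * real b))"
      using True unfolding forest_coeff_def N_def m_def by simp
    show ?thesis
    proof (cases "b = 0")
      case b0: True
      then have "j = 0" "m = 0" using b by auto
      have "N = (if a = i then 1 else 0)"
        unfolding N_def using b0 True by (auto simp: nb_coeff_zero_left)
      then show ?thesis unfolding E R using b0 \<open>j = 0\<close> \<open>m = 0\<close> False by auto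
    next
      case b1: False
      define k where "k = a - i"
      have a: "a = i + k" using True k_def by simp
      have "real i / real a + real (a - i) / (real a * real b) * (real j + real m / real (Suc a))
          = real (Suc i) / real (Suc a) + real j * real (a - i) / (real (Suc a) * real b)"
      proof -
        have ne: "real a \<noteq> 0" "real b \<noteq> 0" "real (Suc a) \<noteq> 0" using False b1 by auto
        have "real j * real (Suc a) + real m = real j * real a + real b"
          unfolding b by (simp add: algebra_simps)
        then have "real j + real m / real (Suc a) = (real j * real a + real b) / real (Suc a)"
          using ne by (simp add: divide_simps)
        moreover have "real i / real a + real k / (real a * real b) * ((real j * real a + real b) / real (Suc a))
           = real (Suc i) / real (Suc a) + real j * real k / (real (Suc a) * real b)"
        proof -
          have "real i * real b * real (Suc a) + real k * (real j * real a + real b) =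
                (real (Suc i) * real b + real j * real k) * real a"
            unfolding a by (simp add: algebra_simps)
          then have "(real i * real b * real (Suc a) + real k * (real j * real a + real b)) / (real a * real b * real (Suc a)) =
                (real (Suc i) * real b + real j * real k) / (real b * real (Suc a))"
            using ne by (simp add: divide_simps)
          \<comment> \<open>Fraction arithmetic over free variables, so that only the polynomial
            identity above involves the actual counts.\<close>
          moreover have "u / X + w / (X * Y) * (v / Z) = (u * Y * Z + w * v) / (X * Y * Z)"
            "u / X + v / (X * Y) = (u * Y + v) / (Y * X)"
            if "X \<noteq> 0" "Y \<noteq> 0" "Z \<noteq> 0" for u v w X Y Z :: real
            using that by (simp_all add: field_simps)
          ultimately show ?thesis using ne by metis
        qed
        ultimately show ?thesis unfolding k_def by simp
      qed
      then show ?thesis unfolding E R by simp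
    qed
  qed
next
  case False
  then show ?thesis
    by (auto simp: forest_coeff_def intro!: sum.neutral)
qed

text \<open>Over a common denominator the last factor is (i b + j a - i j) / (a b), which is
  symmetric in the two kinds of vertices.\<close>

lemma forest_coeff_swap:
  assumes "0 < a" "0 < b"
  shows "forest_coeff A B i j a b = forest_coeff B A j i b a"
proof (cases "i \<le> a \<and> j \<le> b")
  case True
  have "real i / real a + real j * real (a - i) / (real a * real b) =
        real j / real b + real i * real (b - j) / (real b * real a)"
    using assms True by (simp add: of_nat_diff field_simps)
  then show ?thesis
    using assms True unfolding forest_coeff_def by simp
qed (auto simp: forest_coeff_def)

lemma forest_coeff_no_left: "forest_coeff A B i j 0 b = (if i = 0 \<and> j = b then 1 else 0)"
  unfolding forest_coeff_def by (auto simp: nb_coeff_zero_left)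

lemma forest_coeff_no_right: "forest_coeff A B i j a 0 = (if i = a \<and> j = 0 then 1 else 0)"
  unfolding forest_coeff_def by (auto simp: nb_coeff_zero_left)

lemma forest_coeff_swap':
  "forest_coeff A B i j a b = forest_coeff B A j i b a"
  using forest_coeff_swap[of a b A B i j]
  by (cases "a = 0"; cases "b = 0") (auto simp: forest_coeff_no_left forest_coeff_no_right)

section \<open>The branching process with negative binomial offspring\<close>

locale two_type_tree =
  fixes A B p q :: real
  assumes A_pos: "0 < A" and B_pos: "0 < B"
    and p_range: "0 \<le> p" "p < 1" and q_range: "0 \<le> q" "q < 1"
begin

definition offspring_L :: "nat \<Rightarrow> real" where
  "offspring_L c = nb_coeff A c * p ^ c * (1 - p) powr A"

definition offspring_R :: "nat \<Rightarrow> real" where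
  "offspring_R c = nb_coeff B c * q ^ c * (1 - q) powr B"

definition gen_L :: "real \<Rightarrow> real" where
  "gen_L x = ((1 - p) / (1 - p * x)) powr A"

definition gen_R :: "real \<Rightarrow> real" where
  "gen_R x = ((1 - q) / (1 - q * x)) powr B"

text \<open>The right nodes that are not roots are exactly the children of left nodes. So the a left
  nodes have b - j children in total, which explains the exponent of p; symmetrically for q.\<close>

definition forest_prob :: "nat \<Rightarrow> nat \<Rightarrow> nat \<Rightarrow> nat \<Rightarrow> real" where
  "forest_prob i j a b =
     ((1 - p) powr A) ^ a * ((1 - q) powr B) ^ b * p ^ (b - j) * q ^ (a - i) * forest_coeff A B i j a b"

definition forest_size_prob :: "nat \<Rightarrow> nat \<Rightarrow> nat \<Rightarrow> real" where
  "forest_size_prob i j n = (\<Sum>a\<le>n. forest_prob i j a (n - a))"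

text \<open>The probability that the forest is finite, as the sum of the size series; no probability
  space of trees is constructed.\<close>

definition extinction :: "nat \<Rightarrow> nat \<Rightarrow> real" where
  "extinction i j = (\<Sum>n. forest_size_prob i j n)"

text \<open>Exchanges the two kinds of vertices; the right-hand versions below are obtained from the
  left-hand ones through this instance.\<close>

lemma swap: "two_type_tree B A q p"
  using A_pos B_pos p_range q_range by unfold_locales

lemma offspring_swap: "two_type_tree.offspring_L B q = offspring_R"
  unfolding two_type_tree.offspring_L_def[OF swap] offspring_R_def ..

lemma gen_swap: "two_type_tree.gen_L B q = gen_R"
  unfolding two_type_tree.gen_L_def[OF swap] gen_R_def ..

lemma forest_prob_swap: "two_type_tree.forest_prob B A q p j i b a = forest_prob i j a b"
  unfolding two_type_tree.forest_prob_def[OF swap] forest_prob_def forest_coeff_swap'[of B A]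
  by (simp only: mult_ac)

lemma forest_size_prob_swap: "two_type_tree.forest_size_prob B A q p j i n = forest_size_prob i j n"
  unfolding two_type_tree.forest_size_prob_def[OF swap] forest_size_prob_def forest_prob_swap
  by (rule sum.reindex_bij_witness[where i = "\<lambda>a. n - a" and j = "\<lambda>a. n - a"]) auto

lemma extinction_swap: "two_type_tree.extinction B A q p j i = extinction i j"
  unfolding two_type_tree.extinction_def[OF swap] extinction_def forest_size_prob_swap ..

lemma offspring_nonneg: "0 \<le> offspring_L c" "0 \<le> offspring_R c"
  using A_pos B_pos p_range q_range by (auto simp: offspring_L_def offspring_R_def intro!: mult_nonneg_nonneg nb_coeff_nonneg)

lemma gen_sums:
  assumes "0 \<le> x" "x \<le> 1"
  shows "(\<lambda>c. offspring_L c * x ^ c) sums gen_L x" "(\<lambda>c. offspring_R c * x ^ c) sums gen_R x"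
proof -
  have px: "0 \<le> p * x" "p * x < 1" and qx: "0 \<le> q * x" "q * x < 1"
    using assms p_range q_range mult_left_le[of x p] mult_left_le[of x q] by (auto intro: mult_nonneg_nonneg)
  have "(\<lambda>c. (1 - p) powr A * (nb_coeff A c * (p * x) ^ c)) sums ((1 - p) powr A * (1 - p * x) powr (- A))"
    using px by (intro sums_mult nb_series) auto
  then show "(\<lambda>c. offspring_L c * x ^ c) sums gen_L x"
    unfolding offspring_L_def gen_L_def using px p_range
    by (simp add: powr_divide powr_minus_divide power_mult_distrib mult_ac)
  have "(\<lambda>c. (1 - q) powr B * (nb_coeff B c * (q * x) ^ c)) sums ((1 - q) powr B * (1 - q * x) powr (- B))"
    using qx by (intro sums_mult nb_series) auto
  then show "(\<lambda>c. offspring_R c * x ^ c) sums gen_R x"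
    unfolding offspring_R_def gen_R_def using qx q_range
    by (simp add: powr_divide powr_minus_divide power_mult_distrib mult_ac)
qed

lemma gen_partial_sums:
  assumes "0 \<le> x" "x \<le> 1"
  shows "(\<Sum>c\<le>n. offspring_L c * x ^ c) \<le> gen_L x" "(\<Sum>c\<le>n. offspring_R c * x ^ c) \<le> gen_R x"
proof -
  note g = gen_sums[OF assms]
  have nn: "0 \<le> offspring_L c * x ^ c" "0 \<le> offspring_R c * x ^ c" for c
    using assms offspring_nonneg[of c] by auto
  show "(\<Sum>c\<le>n. offspring_L c * x ^ c) \<le> gen_L x"
    unfolding sums_unique[OF g(1)] by (rule sum_le_suminf[OF sums_summable[OF g(1)]]) (auto simp: nn)
  show "(\<Sum>c\<le>n. offspring_R c * x ^ c) \<le> gen_R x"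
    unfolding sums_unique[OF g(2)] by (rule sum_le_suminf[OF sums_summable[OF g(2)]]) (auto simp: nn)
qed

lemma forest_prob_nonneg: "0 \<le> forest_prob i j a b"
proof -
  have "0 \<le> forest_coeff A B i j a b"
    using A_pos B_pos by (intro forest_coeff_nonneg) simp_all
  moreover have "0 \<le> p ^ (b - j)" "0 \<le> q ^ (a - i)"
    using p_range q_range by simp_all
  ultimately show ?thesis
    unfolding forest_prob_def by (intro mult_nonneg_nonneg zero_le_power[OF powr_ge_zero])
qed

lemma forest_prob_eq_0: "a < i \<or> b < j \<Longrightarrow> forest_prob i j a b = 0"
proof -
  assume "a < i \<or> b < j"
  then have "forest_coeff A B i j a b = 0" by (auto simp: forest_coeff_def)
  then show ?thesis by (simp add: forest_prob_def)
qed

lemma forest_prob_0_0: "forest_prob 0 0 a b = (if a = 0 \<and> b = 0 then 1 else 0)"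
proof (cases "a = 0")
  case True
  then show ?thesis by (simp add: forest_prob_def forest_coeff_no_left)
next
  case False
  then show ?thesis by (simp add: forest_prob_def forest_coeff_def)
qed

text \<open>The terms with j + c > b vanish, so any upper limit from b on is allowed. This lets sums
  for different b share one range of c.\<close>

lemma forest_prob_left:
  assumes "b \<le> n"
  shows "forest_prob (Suc i) j (Suc a) b = (\<Sum>c\<le>n. offspring_L c * forest_prob i (j + c) a b)"
proof -
  have "forest_prob (Suc i) j (Suc a) b = (\<Sum>c\<le>b - j. offspring_L c * forest_prob i (j + c) a b)"
    unfolding forest_prob_def offspring_L_def forest_coeff_left[OF A_pos] sum_distrib_left
  proof (intro sum.cong refl, goal_cases)
    case (1 c)
    then have "p ^ (b - j) = p ^ c * p ^ (b - (j + c))"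
      unfolding power_add[symmetric] by (intro arg_cong[where f = "(^) p"]) simp
    then show ?case by simp
  qed
  also have "\<dots> = (\<Sum>c\<le>n. offspring_L c * forest_prob i (j + c) a b)"
    using assms by (intro sum.mono_neutral_left) (auto intro: forest_prob_eq_0)
  finally show ?thesis .
qed

lemma forest_prob_right:
  "a \<le> n \<Longrightarrow> forest_prob i (Suc j) a (Suc b) = (\<Sum>c\<le>n. offspring_R c * forest_prob (i + c) j a b)"
  using two_type_tree.forest_prob_left[OF swap, of a n j i b] unfolding forest_prob_swap offspring_swap .

lemma sum_swap_inner:
  "(\<Sum>c\<in>C. \<Sum>x\<in>X. \<Sum>y\<in>Y. f c x y) = (\<Sum>x\<in>X. \<Sum>y\<in>Y. \<Sum>c\<in>C. f c x y)"
  by (subst sum.swap) (intro sum.cong refl sum.swap)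

text \<open>The trees of a forest are independent. The induction on the number of nodes reveals the
  children of one root of the first forest and leaves the second forest alone until the first has no
  roots.\<close>

lemma forest_prob_convolution:
  "forest_prob (i + i') (j + j') a b =
     (\<Sum>x\<le>a. \<Sum>y\<le>b. forest_prob i j x y * forest_prob i' j' (a - x) (b - y))"
proof (induction "a + b" arbitrary: i j a b rule: less_induct)
  case less
  consider (L) k where "i = Suc k" | (R) k where "i = 0" "j = Suc k" | (0) "i = 0" "j = 0"
    by (metis not0_implies_Suc)
  then show ?case
  proof cases
    case L
    show ?thesis
    proof (cases a)
      case 0
      then show ?thesis using L by (simp add: forest_prob_eq_0)
    next
      case (Suc a')
      have "forest_prob (i + i') (j + j') a b = (\<Sum>c\<le>b. offspring_L c * forest_prob (k + i') ((j + c) + j') a' b)"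
        unfolding L Suc add_Suc by (subst forest_prob_left[OF order_refl]) (simp add: add_ac)
      also have "\<dots> = (\<Sum>c\<le>b. offspring_L c *
          (\<Sum>x\<le>a'. \<Sum>y\<le>b. forest_prob k (j + c) x y * forest_prob i' j' (a' - x) (b - y)))"
        using less[of a' b] Suc by simp
      also have "\<dots> = (\<Sum>x\<le>a'. \<Sum>y\<le>b. \<Sum>c\<le>b. offspring_L c * forest_prob k (j + c) x y * forest_prob i' j' (a' - x) (b - y))"
        unfolding sum_distrib_left by (subst sum_swap_inner) (simp add: mult_ac)
      also have "\<dots> = (\<Sum>x\<le>a'. \<Sum>y\<le>b. forest_prob i j (Suc x) y * forest_prob i' j' (a' - x) (b - y))"
        unfolding L by (intro sum.cong refl) (subst forest_prob_left[of _ b], auto simp: sum_distrib_right)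
      also have "\<dots> = (\<Sum>x\<le>a. \<Sum>y\<le>b. forest_prob i j x y * forest_prob i' j' (a - x) (b - y))"
        unfolding Suc sum.atMost_Suc_shift using L by (simp add: forest_prob_eq_0)
      finally show ?thesis .
    qed
  next
    case R
    show ?thesis
    proof (cases b)
      case 0
      then show ?thesis using R by (simp add: forest_prob_eq_0)
    next
      case (Suc b')
      have "forest_prob (i + i') (j + j') a b = (\<Sum>c\<le>a. offspring_R c * forest_prob ((i + c) + i') (k + j') a b')"
        unfolding R(2) Suc add_Suc by (subst forest_prob_right[OF order_refl]) (simp add: add_ac)
      also have "\<dots> = (\<Sum>c\<le>a. offspring_R c *
          (\<Sum>x\<le>a. \<Sum>y\<le>b'. forest_prob (i + c) k x y * forest_prob i' j' (a - x) (b' - y)))"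
        using less[of a b'] Suc by simp
      also have "\<dots> = (\<Sum>x\<le>a. \<Sum>y\<le>b'. \<Sum>c\<le>a. offspring_R c * forest_prob (i + c) k x y * forest_prob i' j' (a - x) (b' - y))"
        unfolding sum_distrib_left by (subst sum_swap_inner) (simp add: mult_ac)
      also have "\<dots> = (\<Sum>x\<le>a. \<Sum>y\<le>b'. forest_prob i j x (Suc y) * forest_prob i' j' (a - x) (b' - y))"
        unfolding R(2) by (intro sum.cong refl) (subst forest_prob_right[of _ a], auto simp: sum_distrib_right)
      also have "\<dots> = (\<Sum>x\<le>a. \<Sum>y\<le>b. forest_prob i j x y * forest_prob i' j' (a - x) (b - y))"
        unfolding Suc sum.atMost_Suc_shift using R by (simp add: forest_prob_eq_0)
      finally show ?thesis .
    qed
  next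
    case 0
    have "(\<Sum>x\<le>a. \<Sum>y\<le>b. forest_prob i j x y * forest_prob i' j' (a - x) (b - y)) =
          (\<Sum>x\<le>a. if x = 0 then forest_prob i' j' a b else 0)"
    proof (intro sum.cong refl)
      fix x
      have "(\<Sum>y\<le>b. forest_prob i j x y * forest_prob i' j' (a - x) (b - y)) =
            (\<Sum>y\<le>b. if y = 0 then (if x = 0 then forest_prob i' j' a b else 0) else 0)"
        unfolding 0 forest_prob_0_0 by (intro sum.cong) auto
      then show "(\<Sum>y\<le>b. forest_prob i j x y * forest_prob i' j' (a - x) (b - y)) =
            (if x = 0 then forest_prob i' j' a b else 0)" by simp
    qed
    then show ?thesis unfolding 0 by simp
  qed
qed

lemma forest_size_prob_nonneg: "0 \<le> forest_size_prob i j n"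
  unfolding forest_size_prob_def by (intro sum_nonneg forest_prob_nonneg)

lemma forest_size_prob_eq_0: "n < i \<or> n < j \<Longrightarrow> forest_size_prob i j n = 0"
  unfolding forest_size_prob_def by (intro sum.neutral ballI forest_prob_eq_0) auto

lemma forest_size_prob_0_0: "forest_size_prob 0 0 n = (if n = 0 then 1 else 0)"
  unfolding forest_size_prob_def forest_prob_0_0 by (auto intro!: sum.neutral)

lemma forest_size_prob_left:
  assumes "n \<le> m"
  shows "forest_size_prob (Suc i) j (Suc n) = (\<Sum>c\<le>m. offspring_L c * forest_size_prob i (j + c) n)"
proof -
  have "forest_size_prob (Suc i) j (Suc n) = (\<Sum>a\<le>n. forest_prob (Suc i) j (Suc a) (n - a))"
    unfolding forest_size_prob_def sum.atMost_Suc_shift by (simp add: forest_prob_eq_0)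
  also have "\<dots> = (\<Sum>a\<le>n. \<Sum>c\<le>m. offspring_L c * forest_prob i (j + c) a (n - a))"
    using assms by (intro sum.cong refl forest_prob_left) auto
  also have "\<dots> = (\<Sum>c\<le>m. offspring_L c * forest_size_prob i (j + c) n)"
    unfolding forest_size_prob_def by (subst sum.swap) (simp add: sum_distrib_left)
  finally show ?thesis .
qed

lemma forest_size_prob_convolution:
  "forest_size_prob (i + i') (j + j') n = (\<Sum>k\<le>n. forest_size_prob i j k * forest_size_prob i' j' (n - k))"
proof -
  have "forest_size_prob (i + i') (j + j') n = (\<Sum>(a, x, y)\<in>(SIGMA a:{..n}. {..a} \<times> {..n - a}).
      forest_prob i j x y * forest_prob i' j' (a - x) (n - a - y))"
    unfolding forest_size_prob_def forest_prob_convolution sum.cartesian_product by (subst sum.Sigma) auto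
  also have "\<dots> = (\<Sum>(k, x, u)\<in>(SIGMA k:{..n}. {..k} \<times> {..n - k}).
      forest_prob i j x (k - x) * forest_prob i' j' u (n - k - u))"
    \<comment> \<open>k = x + y is the size of the first forest and u = a - x the number of left
      nodes of the second.\<close>
    by (rule sum.reindex_bij_witness[where i = "\<lambda>(k, x, u). (x + u, x, k - x)" and j = "\<lambda>(a, x, y). (x + y, x, a - x)"])
      (auto simp: add.commute)
  also have "\<dots> = (\<Sum>k\<le>n. forest_size_prob i j k * forest_size_prob i' j' (n - k))"
    unfolding forest_size_prob_def sum_product sum.cartesian_product by (subst sum.Sigma) auto
  finally show ?thesis .
qed

text \<open>Removing the root lowers the size by one, hence the bound m on the right. The sum over c
  may stop at m because c roots need at least c nodes.\<close>

lemma partial_sums_left: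
  "(\<Sum>n\<le>Suc m. forest_size_prob (Suc i) j n) = (\<Sum>c\<le>m. offspring_L c * (\<Sum>n\<le>m. forest_size_prob i (j + c) n))"
proof -
  have "(\<Sum>n\<le>Suc m. forest_size_prob (Suc i) j n) = (\<Sum>n\<le>m. forest_size_prob (Suc i) j (Suc n))"
    unfolding sum.atMost_Suc_shift by (simp add: forest_size_prob_eq_0)
  also have "\<dots> = (\<Sum>n\<le>m. \<Sum>c\<le>m. offspring_L c * forest_size_prob i (j + c) n)"
    by (intro sum.cong refl forest_size_prob_left) auto
  finally show ?thesis by (subst (asm) sum.swap) (simp add: sum_distrib_left)
qed

lemma partial_sums_right:
  "(\<Sum>n\<le>Suc m. forest_size_prob i (Suc j) n) = (\<Sum>c\<le>m. offspring_R c * (\<Sum>n\<le>m. forest_size_prob (i + c) j n))"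
  using two_type_tree.partial_sums_left[OF swap, of j i m] unfolding forest_size_prob_swap offspring_swap .

text \<open>Comparison principle, by induction on the size: after the first root has been replaced
  by its children, the inductive bound is integrated against the offspring law, and the
  supersolution property closes the estimate. The choice u = v = 1 makes all size series
  summable.\<close>

lemma partial_sums_le_supersolution:
  assumes "0 \<le> u" "u \<le> 1" "0 \<le> v" "v \<le> 1" and "gen_L v \<le> u" "gen_R u \<le> v"
  shows "(\<Sum>n\<le>m. forest_size_prob i j n) \<le> u ^ i * v ^ j"
proof (induction m arbitrary: i j)
  case 0
  show ?case
    using assms by (cases "i = 0 \<and> j = 0") (auto simp: forest_size_prob_0_0 forest_size_prob_eq_0)
next
  case (Suc m)
  consider (L) k where "i = Suc k" | (R) k where "i = 0" "j = Suc k" | (0) "i = 0" "j = 0"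
    by (metis not0_implies_Suc)
  then show ?case
  proof cases
    case L
    have "(\<Sum>n\<le>Suc m. forest_size_prob i j n) \<le> (\<Sum>c\<le>m. offspring_L c * (u ^ k * v ^ (j + c)))"
      unfolding L partial_sums_left by (intro sum_mono mult_left_mono Suc offspring_nonneg)
    also have "\<dots> = u ^ k * v ^ j * (\<Sum>c\<le>m. offspring_L c * v ^ c)"
      unfolding sum_distrib_left by (simp add: power_add mult_ac)
    also have "\<dots> \<le> u ^ k * v ^ j * u"
      using gen_partial_sums(1)[of v m] assms by (intro mult_left_mono) auto
    finally show ?thesis unfolding L by (simp add: mult_ac)
  next
    case R
    have "(\<Sum>n\<le>Suc m. forest_size_prob i j n) \<le> (\<Sum>c\<le>m. offspring_R c * (u ^ (i + c) * v ^ k))"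
      unfolding R(2) partial_sums_right by (intro sum_mono mult_left_mono Suc offspring_nonneg)
    also have "\<dots> = u ^ i * v ^ k * (\<Sum>c\<le>m. offspring_R c * u ^ c)"
      unfolding sum_distrib_left by (simp add: power_add mult_ac)
    also have "\<dots> \<le> u ^ i * v ^ k * v"
      using gen_partial_sums(2)[of u m] assms by (intro mult_left_mono) auto
    finally show ?thesis unfolding R(2) by (simp add: mult_ac)
  next
    case 0
    then show ?thesis by (simp add: forest_size_prob_0_0 sum.delta)
  qed
qed

lemma gen_1 [simp]: "gen_L 1 = 1" "gen_R 1 = 1"
  using p_range q_range by (auto simp: gen_L_def gen_R_def)

lemma summable_forest_size_prob: "summable (forest_size_prob i j)"
proof (rule bounded_imp_summable)
  show "(\<Sum>k\<le>n. forest_size_prob i j k) \<le> 1" for n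
    using partial_sums_le_supersolution[of 1 1 i j n] by simp
qed (rule forest_size_prob_nonneg)

lemma partial_sums_le_extinction: "(\<Sum>n\<le>m. forest_size_prob i j n) \<le> extinction i j"
  unfolding extinction_def
  by (intro sum_le_suminf summable_forest_size_prob) (auto simp: forest_size_prob_nonneg)

lemma extinction_nonneg: "0 \<le> extinction i j"
  unfolding extinction_def by (intro suminf_nonneg summable_forest_size_prob forest_size_prob_nonneg)

lemma extinction_le_bound:
  assumes "\<And>m. (\<Sum>n\<le>m. forest_size_prob i j n) \<le> x"
  shows "extinction i j \<le> x"
  unfolding extinction_def
proof (rule suminf_le_const[OF summable_forest_size_prob])
  fix n show "(\<Sum>k<n. forest_size_prob i j k) \<le> x"
    by (rule order_trans[OF sum_mono2 assms[of n]]) (auto simp: forest_size_prob_nonneg)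
qed

lemma extinction_le_supersolution:
  assumes "0 \<le> u" "u \<le> 1" "0 \<le> v" "v \<le> 1" and "gen_L v \<le> u" "gen_R u \<le> v"
  shows "extinction 1 0 \<le> u" "extinction 0 1 \<le> v"
  using extinction_le_bound[OF partial_sums_le_supersolution[OF assms, of 1 0]]
    extinction_le_bound[OF partial_sums_le_supersolution[OF assms, of 0 1]] by simp_all

text \<open>The convolution of the size laws becomes a Cauchy product of convergent series.\<close>

lemma extinction_add: "extinction (i + i') (j + j') = extinction i j * extinction i' j'"
proof -
  have *: "summable (\<lambda>k. norm (forest_size_prob i j k))" for i j
    using summable_forest_size_prob[of i j] forest_size_prob_nonneg by simp
  show ?thesis
    unfolding extinction_def forest_size_prob_convolution
    using Cauchy_product_sums[OF * *, of i j i' j'] by (simp add: sums_iff)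
qed

lemma extinction_le_1: "extinction i j \<le> 1"
  using extinction_le_bound[OF partial_sums_le_supersolution[of 1 1 i j]] by simp

lemma extinction_pow: "extinction 0 c = extinction 0 1 ^ c" "extinction c 0 = extinction 1 0 ^ c"
proof -
  have z: "extinction 0 0 = 1"
    unfolding extinction_def using suminf_finite[of "{0}" "forest_size_prob 0 0"] by (simp add: forest_size_prob_0_0)
  show "extinction 0 c = extinction 0 1 ^ c"
  proof (induction c)
    case (Suc c)
    then show ?case using extinction_add[of 0 0 1 c] by simp
  qed (simp add: z)
  show "extinction c 0 = extinction 1 0 ^ c"
  proof (induction c)
    case (Suc c)
    then show ?case using extinction_add[of 1 c 0 0] by simp
  qed (simp add: z)
qed

lemma partial_sums_tendsto: "(\<lambda>m. \<Sum>n\<le>m. forest_size_prob i j n) \<longlonglongrightarrow> extinction i j"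
  unfolding extinction_def by (rule summable_LIMSEQ'[OF summable_forest_size_prob])

text \<open>The partial sum identity is passed to the limit although its truncation enters twice, in
  the number of children and in the size. The upper bound replaces each inner sum by its limit; the
  lower bound keeps the number of children at most k while the size bound grows, and only then lets
  k grow.\<close>

lemma extinction_L: "extinction 1 0 = gen_L (extinction 0 1)"
proof (rule antisym)
  note r = extinction_nonneg[of 0 1] extinction_le_1[of 0 1]
  show "extinction 1 0 \<le> gen_L (extinction 0 1)"
  proof (rule extinction_le_bound)
    fix m
    have "(\<Sum>n\<le>m. forest_size_prob 1 0 n) \<le> (\<Sum>n\<le>Suc m. forest_size_prob (Suc 0) 0 n)"
      using forest_size_prob_nonneg[of 1 0 "Suc m"] by simp
    also have "\<dots> \<le> (\<Sum>c\<le>m. offspring_L c * extinction 0 1 ^ c)"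
      unfolding partial_sums_left extinction_pow[symmetric]
      using partial_sums_le_extinction[of 0 _ m] by (intro sum_mono mult_left_mono offspring_nonneg) auto
    also have "\<dots> \<le> gen_L (extinction 0 1)" by (rule gen_partial_sums[OF r])
    finally show "(\<Sum>n\<le>m. forest_size_prob 1 0 n) \<le> gen_L (extinction 0 1)" .
  qed
  have le: "(\<Sum>c\<le>k. offspring_L c * extinction 0 1 ^ c) \<le> extinction 1 0" for k
  proof (rule LIMSEQ_le_const2)
    show "(\<lambda>m. \<Sum>c\<le>k. offspring_L c * (\<Sum>n\<le>m. forest_size_prob 0 c n)) \<longlonglongrightarrow> (\<Sum>c\<le>k. offspring_L c * extinction 0 1 ^ c)"
      unfolding extinction_pow[symmetric] by (intro tendsto_intros partial_sums_tendsto)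
    have "(\<Sum>c\<le>k. offspring_L c * (\<Sum>n\<le>m. forest_size_prob 0 c n)) \<le> extinction 1 0" if "k \<le> m" for m
    proof -
      have "(\<Sum>c\<le>k. offspring_L c * (\<Sum>n\<le>m. forest_size_prob 0 c n)) \<le>
          (\<Sum>c\<le>m. offspring_L c * (\<Sum>n\<le>m. forest_size_prob 0 (0 + c) n))"
        using that by (intro order_trans[OF _ sum_mono2[of "{..m}" "{..k}"]])
          (auto intro!: mult_nonneg_nonneg sum_nonneg offspring_nonneg forest_size_prob_nonneg)
      then show ?thesis
        unfolding partial_sums_left[symmetric] using partial_sums_le_extinction[of 1 0 "Suc m"] by simp
    qed
    then show "\<exists>N. \<forall>m\<ge>N. (\<Sum>c\<le>k. offspring_L c * (\<Sum>n\<le>m. forest_size_prob 0 c n)) \<le> extinction 1 0" by blast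
  qed
  show "gen_L (extinction 0 1) \<le> extinction 1 0"
    using gen_sums(1)[OF r] le by (intro LIMSEQ_le_const2[where X = "\<lambda>k. \<Sum>c\<le>k. offspring_L c * extinction 0 1 ^ c"])
      (auto simp: sums_def_le simp del: One_nat_def)
qed

lemma extinction_R: "extinction 0 1 = gen_R (extinction 1 0)"
  using two_type_tree.extinction_L[OF swap] unfolding extinction_swap gen_swap .

end

section \<open>Negative binomial generating functions, parametrized by the odds\<close>

definition neg_bin_gen :: "real \<Rightarrow> real \<Rightarrow> real \<Rightarrow> real" where
  "neg_bin_gen k c x = (1 + c * (1 - x)) powr (- k)"

lemma neg_bin_gen_1 [simp]: "neg_bin_gen k c 1 = 1"
  by (simp add: neg_bin_gen_def)

lemma neg_bin_gen_pos:
  assumes "0 \<le> c" "x \<le> 1"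
  shows "0 < neg_bin_gen k c x"
proof -
  have "0 < 1 + c * (1 - x)" using assms by (simp add: add_pos_nonneg)
  then show ?thesis by (simp add: neg_bin_gen_def)
qed

lemma neg_bin_gen_mono:
  assumes "0 \<le> c" "0 \<le> k" "x \<le> y" "y \<le> 1"
  shows "neg_bin_gen k c x \<le> neg_bin_gen k c y"
  unfolding neg_bin_gen_def using assms
  by (intro powr_mono2') (auto intro: mult_left_mono add_pos_nonneg)

lemma neg_bin_gen_le_1:
  assumes "0 \<le> c" "0 \<le> k" "x \<le> 1"
  shows "neg_bin_gen k c x \<le> 1"
  using neg_bin_gen_mono[OF assms order_refl] by simp

text \<open>The tangent at x = 1 lies below the curve; it follows from ln (1 + z) \<le> z and 1 + u
  \<le> exp u.\<close>

lemma neg_bin_gen_tangent: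
  assumes "0 \<le> c" "0 \<le> k" "x \<le> 1"
  shows "1 - k * c * (1 - x) \<le> neg_bin_gen k c x"
proof -
  define z where "z = c * (1 - x)"
  have z: "0 \<le> z" using assms by (simp add: z_def)
  have "1 - k * z \<le> 1 + (- k * ln (1 + z))"
    using ln_add_one_self_le_self[OF z] assms by (simp add: mult_left_mono)
  also have "\<dots> \<le> exp (- k * ln (1 + z))" by (rule exp_ge_add_one_self)
  finally show ?thesis
    unfolding neg_bin_gen_def z_def[symmetric] using z by (simp add: powr_def z_def mult.assoc)
qed

text \<open>For p = s / (s + y) the odds p / (1 - p) are s / y, which is linear in s. In this form
  the dependence on time is easy to handle.\<close>

lemma neg_bin_gen_ratio:
  assumes "0 < y" "0 \<le> s" "x \<le> 1"
  shows "((1 - s / (s + y)) / (1 - s / (s + y) * x)) powr k = neg_bin_gen k (s / y) x"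
proof -
  have "0 < s * (1 - x) + y" using assms by (intro add_nonneg_pos) auto
  moreover have "(1 - s / (s + y)) / (1 - s / (s + y) * x) = y / (s * (1 - x) + y)"
    "1 + s / y * (1 - x) = (s * (1 - x) + y) / y"
    using assms by (simp_all add: divide_simps) (simp_all add: algebra_simps)
  ultimately show ?thesis
    unfolding neg_bin_gen_def using assms by (simp add: powr_divide powr_minus)
qed

lemma neg_bin_gen_deriv:
  assumes "0 \<le> c" "x \<le> 1"
  shows "(neg_bin_gen k c has_real_derivative k * c * neg_bin_gen (k + 1) c x) (at x)"
proof -
  have "0 < 1 + c * (1 - x)" using assms by (simp add: add_pos_nonneg)
  then show ?thesis
    unfolding neg_bin_gen_def[abs_def]
    using DERIV_fun_powr[of "\<lambda>x. 1 + c * (1 - x)" "- c" x "- k"]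
    by (auto intro!: derivative_eq_intros simp: mult_ac)
qed

lemma neg_bin_gen_convex:
  assumes "0 \<le> c" "0 < k"
  shows "convex_on {..1} (neg_bin_gen k c)"
proof (rule f''_ge0_imp_convex)
  fix x :: real assume "x \<in> {..1}"
  then have x: "x \<le> 1" by simp
  show "(neg_bin_gen k c has_real_derivative k * c * neg_bin_gen (k + 1) c x) (at x)"
    using assms x by (intro neg_bin_gen_deriv)
  show "((\<lambda>x. k * c * neg_bin_gen (k + 1) c x) has_real_derivative
          k * c * ((k + 1) * c * neg_bin_gen (k + 1 + 1) c x)) (at x)"
    using assms x by (intro DERIV_cmult neg_bin_gen_deriv)
  show "0 \<le> k * c * ((k + 1) * c * neg_bin_gen (k + 1 + 1) c x)"
    using assms x neg_bin_gen_pos[of c x] by (intro mult_nonneg_nonneg) (auto intro: less_imp_le)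
qed simp

section \<open>The limiting densities of the finite components\<close>

locale limit_params =
  fixes \<alpha> \<beta> l r :: real
  assumes \<alpha>_pos: "0 < \<alpha>" and \<beta>_pos: "0 < \<beta>" and l_pos: "0 < l" and r_pos: "0 < r"
begin

text \<open>At time s n the left vertices carry s n edges, so their mean degree is s / l. A negative
  binomial law of shape \<alpha> has mean \<alpha> p / (1 - p), which gives p = s / (s + \<alpha>
  l). Size biasing and subtracting one keeps p and raises the shape to \<alpha> + 1.\<close>

definition forest :: "real \<Rightarrow> nat \<Rightarrow> nat \<Rightarrow> nat \<Rightarrow> nat \<Rightarrow> real" where
  "forest s = two_type_tree.forest_prob (\<alpha> + 1) (\<beta> + 1) (s / (s + \<alpha> * l)) (s / (s + \<beta> * r))"

definition ext_L :: "real \<Rightarrow> real" where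
  "ext_L s = two_type_tree.extinction (\<alpha> + 1) (\<beta> + 1) (s / (s + \<alpha> * l)) (s / (s + \<beta> * r)) 1 0"

definition ext_R :: "real \<Rightarrow> real" where
  "ext_R s = two_type_tree.extinction (\<alpha> + 1) (\<beta> + 1) (s / (s + \<alpha> * l)) (s / (s + \<beta> * r)) 0 1"

text \<open>The odds belonging to s / (s + \<alpha> l). The mean degree of a left vertex is \<alpha>
  times this, its mean number of children \<alpha> + 1 times this.\<close>

definition mean_L :: "real \<Rightarrow> real" where "mean_L s = s / (\<alpha> * l)"

definition mean_R :: "real \<Rightarrow> real" where "mean_R s = s / (\<beta> * r)"

text \<open>
  \<open>tree_coeff a b\<close> is the sum over the spanning trees of the complete bipartite graph on \<open>a + b\<close>
  labelled vertices of the products of \<open>pochhammer \<alpha>\<close> of the left and \<open>pochhammer \<beta>\<close> of the right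
  degrees, divided by \<open>a! b!\<close>; and \<open>tree_density s a b\<close> is the resulting density of tree components
  in the bipartite configuration model whose degrees come from two Polya urns after \<open>s n\<close> draws.
\<close>

definition tree_coeff :: "nat \<Rightarrow> nat \<Rightarrow> real" where
  "tree_coeff a b =
     (if a = 0 \<or> b = 0 then (if a + b = 1 then 1 else 0)
      else \<alpha> ^ a * \<beta> ^ b * pochhammer (real a * (\<alpha> + 1)) (b - 1) * pochhammer (real b * (\<beta> + 1)) (a - 1)
           / (fact a * fact b))"

definition tree_density :: "real \<Rightarrow> nat \<Rightarrow> nat \<Rightarrow> real" where
  "tree_density s a b =
     tree_coeff a b * l ^ a * r ^ b * (\<alpha> * l) powr (\<alpha> * a) * (\<beta> * r) powr (\<beta> * b) *
     s ^ (a + b - 1) *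
     (s + \<alpha> * l) powr (- (\<alpha> * a + real (a + b - 1))) * (s + \<beta> * r) powr (- (\<beta> * b + real (a + b - 1)))"

lemma tree_instance:
  assumes "0 \<le> s"
  shows "two_type_tree (\<alpha> + 1) (\<beta> + 1) (s / (s + \<alpha> * l)) (s / (s + \<beta> * r))"
proof -
  have "0 < s + \<alpha> * l" "0 < s + \<beta> * r"
    using assms \<alpha>_pos \<beta>_pos l_pos r_pos by (auto intro: add_nonneg_pos)
  then show ?thesis
    using assms \<alpha>_pos \<beta>_pos l_pos r_pos by unfold_locales (auto simp: divide_simps)
qed

lemma swap: "limit_params \<beta> \<alpha> r l"
  using \<alpha>_pos \<beta>_pos l_pos r_pos by unfold_locales

lemma tree_coeff_swap: "limit_params.tree_coeff \<beta> \<alpha> b a = tree_coeff a b"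
  unfolding limit_params.tree_coeff_def[OF swap] tree_coeff_def by (simp add: mult_ac add.commute)

lemma tree_density_swap: "limit_params.tree_density \<beta> \<alpha> r l s b a = tree_density s a b"
  unfolding limit_params.tree_density_def[OF swap] tree_density_def tree_coeff_swap
  by (simp only: add.commute[of b a]) (simp only: mult_ac)

lemma forest_swap: "0 \<le> s \<Longrightarrow> limit_params.forest \<beta> \<alpha> r l s j i b a = forest s i j a b"
  unfolding limit_params.forest_def[OF swap] forest_def
  using two_type_tree.forest_prob_swap[OF tree_instance] by simp

text \<open>The first factor is the left weight of the tree. It equals a (\<alpha> + 1) + (b - 1),
  which is precisely the next factor of the rising factorial of length b - 1.\<close>

lemma tree_coeff_left:
  assumes "0 < a + b"
  shows "(\<alpha> * a + real (a + b - 1)) * tree_coeff a b = \<alpha> ^ a * \<beta> ^ b * forest_coeff (\<alpha> + 1) (\<beta> + 1) 1 0 a b"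
proof (cases "a = 0 \<or> b = 0")
  case True
  then show ?thesis
    using assms by (auto simp: tree_coeff_def forest_coeff_no_left forest_coeff_no_right)
next
  case False
  then obtain m n where ab: "a = Suc m" "b = Suc n" by (metis not0_implies_Suc)
  have "(\<alpha> * a + real (a + b - 1)) * pochhammer (real a * (\<alpha> + 1)) n = pochhammer (real a * (\<alpha> + 1)) b"
    unfolding ab pochhammer_Suc by (simp add: algebra_simps)
  then have "(\<alpha> * a + real (a + b - 1)) * tree_coeff a b =
     \<alpha> ^ a * \<beta> ^ b * pochhammer (real a * (\<alpha> + 1)) b * pochhammer (real b * (\<beta> + 1)) m / (fact a * fact b)"
    unfolding tree_coeff_def using ab by (simp add: mult_ac)
  also have "(fact a :: real) = real a * fact m" unfolding ab by simp
  finally show ?thesis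
    unfolding forest_coeff_def nb_coeff_def using ab by (simp add: divide_simps mult_ac)
qed

text \<open>A tree is rooted at one of its a + b - 1 edges, and both ends become roots; for i = j =
  1 the last factor of \<open>forest_coeff\<close> is (a + b - 1) / (a b).\<close>

lemma tree_coeff_edges:
  assumes "0 < a + b"
  shows "real (a + b - 1) * tree_coeff a b = \<alpha> ^ a * \<beta> ^ b * forest_coeff (\<alpha> + 1) (\<beta> + 1) 1 1 a b"
proof (cases "a = 0 \<or> b = 0")
  case True
  then show ?thesis
    using assms by (auto simp: tree_coeff_def forest_coeff_no_left forest_coeff_no_right)
next
  case False
  then obtain m n where ab: "a = Suc m" "b = Suc n" by (metis not0_implies_Suc)
  have "1 / real a + real m / (real a * real b) = real (a + b - 1) / (real a * real b)"
    unfolding ab by (simp add: divide_simps)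
  then have "forest_coeff (\<alpha> + 1) (\<beta> + 1) 1 1 a b =
      pochhammer (real a * (\<alpha> + 1)) n / fact n * (pochhammer (real b * (\<beta> + 1)) m / fact m) *
      (real (a + b - 1) / (real a * real b))"
    unfolding forest_coeff_def nb_coeff_def using ab by simp
  moreover have "(fact a :: real) = real a * fact m" "(fact b :: real) = real b * fact n" unfolding ab by simp_all
  ultimately show ?thesis
    unfolding tree_coeff_def using ab by (simp add: mult_ac)
qed

text \<open>Separates the powers of s, s + \<alpha> l and s + \<beta> r, so that the comparison with
  \<open>tree_density\<close> becomes a comparison of exponents.\<close>

lemma forest_normal_form:
  assumes "0 \<le> s"
  shows "forest s i j a b =
     forest_coeff (\<alpha> + 1) (\<beta> + 1) i j a b * (\<alpha> * l) ^ a * (\<beta> * r) ^ b *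
     (\<alpha> * l) powr (\<alpha> * a) * (\<beta> * r) powr (\<beta> * b) * s ^ (b - j + (a - i)) *
     (s + \<alpha> * l) powr (- (\<alpha> * a + real (a + (b - j)))) * (s + \<beta> * r) powr (- (\<beta> * b + real (b + (a - i))))"
proof -
  interpret two_type_tree "\<alpha> + 1" "\<beta> + 1" "s / (s + \<alpha> * l)" "s / (s + \<beta> * r)"
    by (rule tree_instance[OF assms])
  have pos: "0 < s + \<alpha> * l" "0 < s + \<beta> * r" "0 < \<alpha> * l" "0 < \<beta> * r"
    using assms \<alpha>_pos \<beta>_pos l_pos r_pos by (auto intro: add_nonneg_pos)
  have *: "((1 - s / (s + x)) powr (k + 1)) ^ n * (s / (s + x)) ^ m =
      x ^ n * x powr (k * real n) * s ^ m * (s + x) powr (- (k * real n + real (n + m)))"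
    if "0 < x" "0 < s + x" for x k :: real and n m
  proof -
    have "1 - s / (s + x) = x / (s + x)" using that by (simp add: divide_simps)
    then have "((1 - s / (s + x)) powr (k + 1)) ^ n = x powr ((k + 1) * real n) / (s + x) powr ((k + 1) * real n)"
      using that by (simp add: powr_divide powr_power power_divide mult.commute)
    also have "x powr ((k + 1) * real n) = x ^ n * x powr (k * real n)"
      using that by (simp add: distrib_right powr_add powr_realpow)
    finally have "((1 - s / (s + x)) powr (k + 1)) ^ n * (s / (s + x)) ^ m =
        x ^ n * x powr (k * real n) * s ^ m / ((s + x) powr ((k + 1) * real n) * (s + x) ^ m)"
      by (simp add: power_divide)
    also have "(s + x) powr ((k + 1) * real n) * (s + x) ^ m = (s + x) powr (k * real n + real (n + m))"
      using that by (simp add: powr_realpow[symmetric] powr_add[symmetric] algebra_simps)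
    finally show ?thesis unfolding powr_minus_divide by (simp only: times_divide_eq_right mult_1_right)
  qed
  have "forest s i j a b =
      (((1 - s / (s + \<alpha> * l)) powr (\<alpha> + 1)) ^ a * (s / (s + \<alpha> * l)) ^ (b - j)) *
      (((1 - s / (s + \<beta> * r)) powr (\<beta> + 1)) ^ b * (s / (s + \<beta> * r)) ^ (a - i)) *
      forest_coeff (\<alpha> + 1) (\<beta> + 1) i j a b"
    unfolding forest_def forest_prob_def by (simp only: mult_ac)
  then show ?thesis
    unfolding *[OF pos(3,1)] *[OF pos(4,2)] power_add by (simp only: mult_ac)
qed

text \<open>The right-hand side is the part of the total left weight carried by trees of this type:
  the chance that a left vertex picked by weight lies in one of them. It agrees with the law of the
  branching tree grown from that vertex.\<close>

lemma forest_left_root: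
  assumes "0 \<le> s" "0 < a + b"
  shows "forest s 1 0 a b = (\<alpha> * a + real (a + b - 1)) * tree_density s a b / (s + \<alpha> * l)"
proof (cases a)
  case 0
  then show ?thesis
    using assms tree_coeff_left[of a b] unfolding forest_normal_form[OF assms(1)] tree_density_def
    by (auto simp: forest_coeff_no_left)
next
  case (Suc m)
  have pos: "0 < s + \<alpha> * l" using assms \<alpha>_pos l_pos by (auto intro: add_nonneg_pos)
  have e: "b - 0 + (a - 1) = a + b - 1" "b + (a - 1) = a + b - 1" "a + (b - 0) = Suc (a + b - 1)" using Suc by auto
  have "(s + \<alpha> * l) powr (- (\<alpha> * a + real (Suc (a + b - 1)))) =
      (s + \<alpha> * l) powr (- (\<alpha> * a + real (a + b - 1)) - 1)"
    by (rule arg_cong[where f = "\<lambda>x. (s + \<alpha> * l) powr x"]) simp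
  also have "\<dots> = (s + \<alpha> * l) powr (- (\<alpha> * a + real (a + b - 1))) / (s + \<alpha> * l)"
    using pos by (simp add: powr_diff)
  finally have p: "(s + \<alpha> * l) powr (- (\<alpha> * a + real (Suc (a + b - 1)))) =
      (s + \<alpha> * l) powr (- (\<alpha> * a + real (a + b - 1))) / (s + \<alpha> * l)" .
  have "forest s 1 0 a b = (\<alpha> ^ a * \<beta> ^ b * forest_coeff (\<alpha> + 1) (\<beta> + 1) 1 0 a b) *
      (l ^ a * r ^ b * (\<alpha> * l) powr (\<alpha> * a) * (\<beta> * r) powr (\<beta> * b) *
      s ^ (a + b - 1) *
     (s + \<alpha> * l) powr (- (\<alpha> * a + real (a + b - 1))) * (s + \<beta> * r) powr (- (\<beta> * b + real (a + b - 1)))) / (s + \<alpha> * l)"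
    unfolding forest_normal_form[OF assms(1)] e p power_mult_distrib by (simp add: mult_ac)
  then show ?thesis
    unfolding tree_coeff_left[OF assms(2), symmetric] tree_density_def by (simp add: mult_ac)
qed

lemma forest_right_root:
  assumes "0 \<le> s" "0 < a + b"
  shows "forest s 0 1 a b = (\<beta> * b + real (a + b - 1)) * tree_density s a b / (s + \<beta> * r)"
proof -
  have "0 < b + a" using assms(2) by linarith
  from limit_params.forest_left_root[OF swap assms(1) this] show ?thesis
    unfolding tree_density_swap forest_swap[OF assms(1)] add.commute[of b a] .
qed

lemma forest_edge_root:
  assumes "0 \<le> s" "0 < a + b"
  shows "forest s 1 1 a b = real (a + b - 1) * tree_coeff a b * l ^ a * r ^ b *
     (\<alpha> * l) powr (\<alpha> * a) * (\<beta> * r) powr (\<beta> * b) * s ^ (a + b - 1 - 1) *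
     (s + \<alpha> * l) powr (- (\<alpha> * a + real (a + b - 1))) * (s + \<beta> * r) powr (- (\<beta> * b + real (a + b - 1)))"
proof (cases "a = 0 \<or> b = 0")
  case True
  then show ?thesis
    using assms tree_coeff_edges[of a b] unfolding forest_normal_form[OF assms(1)]
    by (auto simp: forest_coeff_no_right forest_coeff_no_left)
next
  case False
  then have e: "b - 1 + (a - 1) = a + b - 1 - 1" "a + (b - 1) = a + b - 1" "b + (a - 1) = a + b - 1" by auto
  show ?thesis
    unfolding forest_normal_form[OF assms(1)] e power_mult_distrib tree_coeff_edges[OF assms(2)]
    by (simp add: mult_ac)
qed

text \<open>Both sides are the density of the edges lying in trees of this type: there are s edges
  per vertex, and a given one lies in such a tree if the forest grown from its two ends has this
  size.\<close>

lemma forest_edge_root':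
  assumes "0 \<le> s" "0 < a + b"
  shows "s * forest s 1 1 a b = real (a + b - 1) * tree_density s a b"
proof (cases "a + b - 1 = 0")
  case False
  then have "s ^ (a + b - 1) = s * s ^ (a + b - 1 - 1)" by (metis power_minus_mult mult.commute neq0_conv)
  then show ?thesis
    unfolding forest_edge_root[OF assms] tree_density_def by (simp add: mult_ac)
qed (use assms in \<open>simp add: forest_edge_root del: One_nat_def\<close>)

lemma tree_density_nonneg: "0 \<le> s \<Longrightarrow> 0 \<le> tree_density s a b"
  unfolding tree_density_def tree_coeff_def using \<alpha>_pos \<beta>_pos l_pos r_pos
  by (auto intro!: mult_nonneg_nonneg divide_nonneg_nonneg pochhammer_nonneg)

text \<open>The product rule: the power of s yields the gain, the two negative powers yield the
  losses. The gain is written with one factor s less than the density, so that s = 0 is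
  included.\<close>

lemma tree_density_deriv:
  assumes "0 \<le> s" "0 < a + b"
  shows "((\<lambda>s. tree_density s a b) has_real_derivative
          forest s 1 1 a b - forest s 1 0 a b - forest s 0 1 a b) (at s)"
proof -
  have pos: "0 < s + \<alpha> * l" "0 < s + \<beta> * r"
    using assms \<alpha>_pos \<beta>_pos l_pos r_pos by (auto intro: add_nonneg_pos)
  have gen: "((\<lambda>s. C * s ^ m * (s + x) powr (- u) * (s + y) powr (- v)) has_real_derivative
      real m * C * s ^ (m - 1) * (s + x) powr (- u) * (s + y) powr (- v)
      - u * (C * s ^ m * (s + x) powr (- u) * (s + y) powr (- v)) / (s + x)
      - v * (C * s ^ m * (s + x) powr (- u) * (s + y) powr (- v)) / (s + y)) (at s)"
    if "0 < s + x" "0 < s + y" for C x y u v :: real and m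
    using that by (auto intro!: derivative_eq_intros simp: powr_diff) (simp add: field_simps)
  show ?thesis
    using gen[OF pos, of "tree_coeff a b * l ^ a * r ^ b * (\<alpha> * l) powr (\<alpha> * a) * (\<beta> * r) powr (\<beta> * b)"
      "a + b - 1" "\<alpha> * a + real (a + b - 1)" "\<beta> * b + real (a + b - 1)"]
    unfolding forest_left_root[OF assms] forest_right_root[OF assms] forest_edge_root[OF assms]
    unfolding tree_density_def by (simp add: mult_ac)
qed

text \<open>This identifies the gain with coagulation: a new edge joins a tree hit according to left
  weight with a tree hit according to right weight.\<close>

lemma forest_convolution:
  assumes "0 \<le> s"
  shows "forest s 1 1 a b = (\<Sum>x\<le>a. \<Sum>y\<le>b. forest s 1 0 x y * forest s 0 1 (a - x) (b - y))"
  unfolding forest_def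
  using two_type_tree.forest_prob_convolution[OF tree_instance[OF assms], of 1 0 0 1 a b] by simp

lemma forest_0_0: "forest s 1 0 0 b = 0" "forest s 0 1 a 0 = 0" if "0 \<le> s" for s
  using two_type_tree.forest_prob_eq_0[OF tree_instance[OF that]] unfolding forest_def by auto

end

section \<open>Extinction probabilities and the mass of the finite components\<close>

context limit_params
begin

lemma positive_denominators: "0 \<le> s \<Longrightarrow> 0 < s + \<alpha> * l" "0 \<le> s \<Longrightarrow> 0 < s + \<beta> * r"
  using \<alpha>_pos \<beta>_pos l_pos r_pos by (auto intro: add_nonneg_pos)

lemma mean_nonneg: "0 \<le> s \<Longrightarrow> 0 \<le> mean_L s" "0 \<le> s \<Longrightarrow> 0 \<le> mean_R s"
  using \<alpha>_pos \<beta>_pos l_pos r_pos by (auto simp: mean_L_def mean_R_def)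

lemma gen_eq_neg_bin_gen:
  assumes "0 \<le> s" "x \<le> 1"
  shows "two_type_tree.gen_L (\<alpha> + 1) (s / (s + \<alpha> * l)) x = neg_bin_gen (\<alpha> + 1) (mean_L s) x"
    and "two_type_tree.gen_R (\<beta> + 1) (s / (s + \<beta> * r)) x = neg_bin_gen (\<beta> + 1) (mean_R s) x"
proof -
  have "0 < \<alpha> * l" "0 < \<beta> * r" using \<alpha>_pos \<beta>_pos l_pos r_pos by auto
  then show "two_type_tree.gen_L (\<alpha> + 1) (s / (s + \<alpha> * l)) x = neg_bin_gen (\<alpha> + 1) (mean_L s) x"
    "two_type_tree.gen_R (\<beta> + 1) (s / (s + \<beta> * r)) x = neg_bin_gen (\<beta> + 1) (mean_R s) x"
    unfolding two_type_tree.gen_L_def[OF tree_instance[OF assms(1)]] two_type_tree.gen_R_def[OF tree_instance[OF assms(1)]]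
      mean_L_def mean_R_def
    by (intro neg_bin_gen_ratio assms; simp)+
qed

lemma ext_range:
  assumes "0 \<le> s"
  shows "0 \<le> ext_L s" "ext_L s \<le> 1" "0 \<le> ext_R s" "ext_R s \<le> 1"
  unfolding ext_L_def ext_R_def
  using two_type_tree.extinction_nonneg[OF tree_instance[OF assms]]
    two_type_tree.extinction_le_1[OF tree_instance[OF assms]] by auto

lemma ext_L_eq: "0 \<le> s \<Longrightarrow> ext_L s = neg_bin_gen (\<alpha> + 1) (mean_L s) (ext_R s)"
  using two_type_tree.extinction_L[OF tree_instance, of s] gen_eq_neg_bin_gen(1)[of s "ext_R s"] ext_range[of s]
  unfolding ext_L_def ext_R_def by simp

lemma ext_R_eq: "0 \<le> s \<Longrightarrow> ext_R s = neg_bin_gen (\<beta> + 1) (mean_R s) (ext_L s)"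
  using two_type_tree.extinction_R[OF tree_instance, of s] gen_eq_neg_bin_gen(2)[of s "ext_L s"] ext_range[of s]
  unfolding ext_L_def ext_R_def by simp

lemma ext_pos: "0 \<le> s \<Longrightarrow> 0 < ext_L s" "0 \<le> s \<Longrightarrow> 0 < ext_R s"
  using ext_L_eq[of s] ext_R_eq[of s] ext_range[of s] neg_bin_gen_pos mean_nonneg[of s] by metis+

lemma ext_le_supersolution:
  assumes "0 \<le> s" "0 \<le> y" "y \<le> 1"
    and "neg_bin_gen (\<beta> + 1) (mean_R s) (neg_bin_gen (\<alpha> + 1) (mean_L s) y) \<le> y"
  shows "ext_L s \<le> neg_bin_gen (\<alpha> + 1) (mean_L s) y" "ext_R s \<le> y"
proof -
  define u where "u = neg_bin_gen (\<alpha> + 1) (mean_L s) y"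
  have u: "0 \<le> u" "u \<le> 1"
    using neg_bin_gen_pos[of "mean_L s" y "\<alpha> + 1"] neg_bin_gen_le_1[of "mean_L s" "\<alpha> + 1" y]
      mean_nonneg[OF assms(1)] assms \<alpha>_pos by (auto simp: u_def)
  show "ext_L s \<le> neg_bin_gen (\<alpha> + 1) (mean_L s) y" "ext_R s \<le> y"
    unfolding ext_L_def ext_R_def u_def[symmetric]
    using two_type_tree.extinction_le_supersolution[OF tree_instance[OF assms(1)], of u y] u assms
      gen_eq_neg_bin_gen(1)[OF assms(1), of y] gen_eq_neg_bin_gen(2)[OF assms(1), of u]
    by (auto simp: u_def)
qed

text \<open>\<open>finite_mass\<close> with a trial value y in place of \<open>ext_R s\<close>: an
  upper bound whenever y is a supersolution, and for fixed y continuous in s.\<close>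

definition finite_mass_at :: "real \<Rightarrow> real \<Rightarrow> real" where
  "finite_mass_at s y =
     l * neg_bin_gen \<alpha> (mean_L s) y + r * neg_bin_gen \<beta> (mean_R s) (neg_bin_gen (\<alpha> + 1) (mean_L s) y)"

text \<open>All edges of a uniformly chosen vertex are still unexplored, so its exponent is \<alpha>
  or \<beta>; the exponent is larger by one only for vertices reached along an edge.\<close>

definition finite_mass :: "real \<Rightarrow> real" where
  "finite_mass s = l * neg_bin_gen \<alpha> (mean_L s) (ext_R s) + r * neg_bin_gen \<beta> (mean_R s) (ext_L s)"

lemma finite_mass_le_at:
  assumes "0 \<le> s" "0 \<le> y" "y \<le> 1"
    and "neg_bin_gen (\<beta> + 1) (mean_R s) (neg_bin_gen (\<alpha> + 1) (mean_L s) y) \<le> y"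
  shows "finite_mass s \<le> finite_mass_at s y"
  unfolding finite_mass_def finite_mass_at_def
  using ext_le_supersolution[OF assms] mean_nonneg[OF assms(1)] assms \<alpha>_pos \<beta>_pos l_pos r_pos
  by (intro add_mono mult_left_mono neg_bin_gen_mono neg_bin_gen_le_1) auto

lemma finite_mass_eq_at: "0 \<le> s \<Longrightarrow> finite_mass s = finite_mass_at s (ext_R s)"
  unfolding finite_mass_def finite_mass_at_def using ext_L_eq[of s] by simp

text \<open>\<alpha> a is the left weight of a tree minus its number of edges. By
  \<open>forest_left_root\<close> and \<open>forest_edge_root'\<close> both parts are branching
  laws, whose sums over all sizes are \<open>extinction 1 0\<close> and
  \<open>extinction 1 1\<close>.\<close>

lemma left_density_sum:
  assumes "0 \<le> s"
  shows "(\<lambda>m. \<Sum>n\<le>m. \<Sum>a\<le>n. real a * tree_density s a (n - a)) \<longlonglongrightarrow> l * neg_bin_gen \<alpha> (mean_L s) (ext_R s)"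
proof -
  interpret two_type_tree "\<alpha> + 1" "\<beta> + 1" "s / (s + \<alpha> * l)" "s / (s + \<beta> * r)"
    by (rule tree_instance[OF assms])
  note pos = positive_denominators[OF assms]
  have solve: "x * t = (X * ((\<alpha> * x + m) * t / X) - m * t) / \<alpha>" if "X \<noteq> 0" for X x t m :: real
    using that \<alpha>_pos by (simp add: distrib_right)
  have E: "real a * tree_density s a (n - a) = ((s + \<alpha> * l) * forest s 1 0 a (n - a) - s * forest s 1 1 a (n - a)) / \<alpha>"
    if "a \<le> n" for a n
  proof (cases "n = 0")
    case True
    then show ?thesis using that forest_prob_eq_0 by (simp add: forest_def)
  next
    case False
    then have n: "0 < a + (n - a)" using that by simp
    show ?thesis
      unfolding forest_left_root[OF assms n] forest_edge_root'[OF assms n]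
      using solve[of "s + \<alpha> * l"] pos \<alpha>_pos by simp
  qed
  have "(\<Sum>n\<le>m. \<Sum>a\<le>n. real a * tree_density s a (n - a)) =
      ((s + \<alpha> * l) * (\<Sum>n\<le>m. forest_size_prob 1 0 n) - s * (\<Sum>n\<le>m. forest_size_prob 1 1 n)) / \<alpha>" for m
    unfolding forest_size_prob_def forest_def[symmetric]
    by (simp add: E sum_subtractf sum_distrib_left sum_divide_distrib[symmetric] del: of_nat_diff)
  moreover have "(\<lambda>m. ((s + \<alpha> * l) * (\<Sum>n\<le>m. forest_size_prob 1 0 n) - s * (\<Sum>n\<le>m. forest_size_prob 1 1 n)) / \<alpha>)
      \<longlonglongrightarrow> ((s + \<alpha> * l) * extinction 1 0 - s * extinction 1 1) / \<alpha>"
    using \<alpha>_pos by (intro tendsto_intros partial_sums_tendsto) auto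
  moreover have "extinction 1 1 = ext_L s * ext_R s"
    using extinction_add[of 1 0 0 1] by (simp add: ext_L_def ext_R_def)
  moreover have "((s + \<alpha> * l) * ext_L s - s * (ext_L s * ext_R s)) / \<alpha> = l * neg_bin_gen \<alpha> (mean_L s) (ext_R s)"
  proof -
    define z where "z = 1 + mean_L s * (1 - ext_R s)"
    have z: "0 < z" using mean_nonneg[OF assms] ext_range[OF assms] by (auto simp: z_def intro!: add_pos_nonneg)
    have "((s + \<alpha> * l) * ext_L s - s * (ext_L s * ext_R s)) / \<alpha> = l * (z * ext_L s)"
      using \<alpha>_pos l_pos by (simp add: z_def mean_L_def field_simps)
    moreover have "ext_L s = z powr (- \<alpha> - 1)"
      using ext_L_eq[OF assms] by (simp add: neg_bin_gen_def z_def)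
    \<comment> \<open>The factor z lowers the size-biased exponent \<alpha> + 1 to the exponent
      \<alpha> of a uniformly chosen vertex.\<close>
    then have "z * ext_L s = z powr (- \<alpha>)" using z by (simp add: powr_diff)
    ultimately show ?thesis by (simp add: neg_bin_gen_def z_def)
  qed
  ultimately show ?thesis by (simp add: ext_L_def)
qed

lemma ext_swap:
  assumes "0 \<le> s"
  shows "limit_params.ext_L \<beta> \<alpha> r l s = ext_R s" "limit_params.ext_R \<beta> \<alpha> r l s = ext_L s"
  unfolding limit_params.ext_L_def[OF swap] limit_params.ext_R_def[OF swap] ext_L_def ext_R_def
  using two_type_tree.extinction_swap[OF tree_instance[OF assms]] by simp_all

lemma mean_swap: "limit_params.mean_L \<beta> r s = mean_R s"
  unfolding limit_params.mean_L_def[OF swap] mean_R_def ..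

lemma right_density_sum:
  assumes "0 \<le> s"
  shows "(\<lambda>m. \<Sum>n\<le>m. \<Sum>a\<le>n. real (n - a) * tree_density s a (n - a)) \<longlonglongrightarrow> r * neg_bin_gen \<beta> (mean_R s) (ext_L s)"
proof -
  have "(\<Sum>a\<le>n. real (n - a) * tree_density s a (n - a)) = (\<Sum>a\<le>n. real a * tree_density s (n - a) a)" for n
    by (rule sum.reindex_bij_witness[where i = "\<lambda>a. n - a" and j = "\<lambda>a. n - a"]) auto
  then show ?thesis
    using limit_params.left_density_sum[OF swap assms]
    unfolding tree_density_swap ext_swap[OF assms] mean_swap by simp
qed

lemma tree_density_sum:
  assumes "0 \<le> s"
  shows "(\<lambda>m. \<Sum>n\<le>m. \<Sum>a\<le>n. real n * tree_density s a (n - a)) \<longlonglongrightarrow> finite_mass s"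
proof -
  have "(\<Sum>n\<le>m. \<Sum>a\<le>n. real n * tree_density s a (n - a)) =
     (\<Sum>n\<le>m. \<Sum>a\<le>n. real a * tree_density s a (n - a)) + (\<Sum>n\<le>m. \<Sum>a\<le>n. real (n - a) * tree_density s a (n - a))" for m
    unfolding sum.distrib[symmetric]
    by (intro sum.cong refl) (simp add: of_nat_diff algebra_simps)
  then show ?thesis
    unfolding finite_mass_def using tendsto_add[OF left_density_sum[OF assms] right_density_sum[OF assms]] by simp
qed

text \<open>The mean number of grandchildren of a node of either kind; the branching process is
  critical where this equals 1.\<close>

definition growth :: "real \<Rightarrow> real" where
  "growth s = (\<alpha> + 1) * mean_L s * ((\<beta> + 1) * mean_R s)"

text \<open>The tangents at 1 turn the two extinction equations into (1 - \<open>growth s\<close>)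
  (1 - \<open>ext_L s\<close>) \<le> 0.\<close>

lemma subcritical_ext:
  assumes "0 \<le> s" "growth s < 1"
  shows "ext_L s = 1" "ext_R s = 1"
proof -
  note m = mean_nonneg[OF assms(1)] and e = ext_range[OF assms(1)]
  have "1 - ext_L s \<le> (\<alpha> + 1) * mean_L s * (1 - ext_R s)"
    using neg_bin_gen_tangent[of "mean_L s" "\<alpha> + 1" "ext_R s"] m e \<alpha>_pos ext_L_eq[OF assms(1)] by auto
  moreover have R: "1 - ext_R s \<le> (\<beta> + 1) * mean_R s * (1 - ext_L s)"
    using neg_bin_gen_tangent[of "mean_R s" "\<beta> + 1" "ext_L s"] m e \<beta>_pos ext_R_eq[OF assms(1)] by auto
  ultimately have "1 - ext_L s \<le> (\<alpha> + 1) * mean_L s * ((\<beta> + 1) * mean_R s * (1 - ext_L s))"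
    using m \<alpha>_pos by (elim order_trans) (intro mult_left_mono, auto)
  then have "1 - ext_L s \<le> growth s * (1 - ext_L s)"
    unfolding growth_def by (simp add: mult.assoc)
  then have "(1 - growth s) * (1 - ext_L s) \<le> 0" by (simp add: algebra_simps)
  then show L: "ext_L s = 1" using assms(2) e by (simp add: mult_le_0_iff)
  show "ext_R s = 1" using ext_R_eq[OF assms(1)] L by simp
qed

lemma subcritical_finite_mass: "0 \<le> s \<Longrightarrow> growth s < 1 \<Longrightarrow> finite_mass s = l + r"
  by (simp add: finite_mass_def subcritical_ext)

text \<open>The composed map fixes 1 and has derivative \<open>growth s\<close> there, so it runs
  below the diagonal immediately to the left of 1.\<close>

lemma supercritical_near_1:
  assumes "0 \<le> s" "1 < growth s"
  shows "\<exists>d>0. \<forall>h. 0 < h \<longrightarrow> h < d \<longrightarrow>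
    neg_bin_gen (\<beta> + 1) (mean_R s) (neg_bin_gen (\<alpha> + 1) (mean_L s) (1 - h)) < 1 - h"
proof -
  define F where "F = (\<lambda>y. neg_bin_gen (\<beta> + 1) (mean_R s) (neg_bin_gen (\<alpha> + 1) (mean_L s) y) - y)"
  note m = mean_nonneg[OF assms(1)]
  have "((\<lambda>y. neg_bin_gen (\<beta> + 1) (mean_R s) (neg_bin_gen (\<alpha> + 1) (mean_L s) y)) has_real_derivative
     ((\<beta> + 1) * mean_R s * neg_bin_gen (\<beta> + 1 + 1) (mean_R s) (neg_bin_gen (\<alpha> + 1) (mean_L s) 1)) *
     ((\<alpha> + 1) * mean_L s * neg_bin_gen (\<alpha> + 1 + 1) (mean_L s) 1)) (at 1)"
    using m by (intro DERIV_chain2[OF neg_bin_gen_deriv neg_bin_gen_deriv]) auto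
  then have "(F has_real_derivative growth s - 1) (at 1)"
    unfolding F_def growth_def by (auto intro!: derivative_eq_intros simp: mult_ac)
  then obtain d where d: "0 < d" "\<And>h. 0 < h \<Longrightarrow> h < d \<Longrightarrow> F (1 - h) < F 1"
    using DERIV_pos_inc_left[of F "growth s - 1" 1] assms(2) by auto
  show ?thesis
    using d by (intro exI[of _ d]) (auto simp: F_def)
qed

lemma supercritical_ext:
  assumes "0 \<le> s" "1 < growth s"
  shows "ext_R s < 1"
proof -
  obtain d where d: "0 < d" "\<And>h. 0 < h \<Longrightarrow> h < d \<Longrightarrow>
    neg_bin_gen (\<beta> + 1) (mean_R s) (neg_bin_gen (\<alpha> + 1) (mean_L s) (1 - h)) < 1 - h"
    using supercritical_near_1[OF assms] by blast
  define h where "h = min (d / 2) (1 / 2)"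
  have h: "0 < h" "h < d" "h < 1" using d(1) by (auto simp: h_def)
  have "ext_R s \<le> 1 - h"
    using d(2)[OF h(1,2)] h assms(1) by (intro ext_le_supersolution) auto
  then show ?thesis using h by simp
qed

text \<open>y lies between the fixed point \<open>ext_R s\<close> and a point z near 1 where the
  composed map is strictly below the diagonal. Both maps are convex and the outer one is increasing,
  so the chord inequality carries the strict inequality from z to y.\<close>

lemma supercritical_strict:
  assumes "0 \<le> s" "1 < growth s" and y: "ext_R s < y" "y < 1"
  shows "neg_bin_gen (\<beta> + 1) (mean_R s) (neg_bin_gen (\<alpha> + 1) (mean_L s) y) < y"
proof -
  define f where "f = neg_bin_gen (\<alpha> + 1) (mean_L s)"
  define g where "g = neg_bin_gen (\<beta> + 1) (mean_R s)"
  note m = mean_nonneg[OF assms(1)]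
  obtain d where d: "0 < d" "\<And>h. 0 < h \<Longrightarrow> h < d \<Longrightarrow> g (f (1 - h)) < 1 - h"
    using supercritical_near_1[OF assms(1,2)] unfolding f_def g_def by blast
  \<comment> \<open>Small enough for the choice of d, and such that z lies strictly between y and
    1.\<close>
  define h where "h = min (d / 2) ((1 - y) / 2)"
  define z where "z = 1 - h"
  have h: "0 < h" "h < d" using d(1) y by (auto simp: h_def)
  have z: "y < z" "z < 1" "g (f z) < z" using d h y by (auto simp: z_def h_def min_def field_simps split: if_splits)
  define \<theta> where "\<theta> = (z - y) / (z - ext_R s)"
  have \<theta>: "0 < \<theta>" "\<theta> < 1" using y z by (auto simp: \<theta>_def divide_simps)
  have y_eq: "y = \<theta> * ext_R s + (1 - \<theta>) * z"
  proof -
    have "\<theta> * (z - ext_R s) = z - y" using y z by (simp add: \<theta>_def)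
    then show ?thesis by (simp add: algebra_simps)
  qed
  have cf: "convex_on {..1} f" and cg: "convex_on {..1} g"
    unfolding f_def g_def using m \<alpha>_pos \<beta>_pos by (auto intro!: neg_bin_gen_convex)
  have f1: "f x \<le> 1" if "x \<le> 1" for x
    unfolding f_def using m \<alpha>_pos that by (intro neg_bin_gen_le_1) auto
  have "f y \<le> \<theta> * f (ext_R s) + (1 - \<theta>) * f z"
    unfolding y_eq using convex_onD[OF cf, of "1 - \<theta>" "ext_R s" z] \<theta> y z by simp
  moreover have "\<theta> * f (ext_R s) + (1 - \<theta>) * f z \<le> 1"
    using f1[of "ext_R s"] f1[of z] y z \<theta> by (intro convex_bound_le) auto
  ultimately have "g (f y) \<le> g (\<theta> * f (ext_R s) + (1 - \<theta>) * f z)"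
    unfolding g_def using m \<beta>_pos by (intro neg_bin_gen_mono) auto
  also have "\<dots> \<le> \<theta> * g (f (ext_R s)) + (1 - \<theta>) * g (f z)"
    using convex_onD[OF cg, of "1 - \<theta>" "f (ext_R s)" "f z"] \<theta> y z f1 by simp
  also have "g (f (ext_R s)) = ext_R s"
    unfolding f_def g_def using ext_L_eq[OF assms(1)] ext_R_eq[OF assms(1)] by simp
  also have "\<theta> * ext_R s + (1 - \<theta>) * g (f z) < \<theta> * ext_R s + (1 - \<theta>) * z"
    using z \<theta> by simp
  finally show ?thesis unfolding y_eq[symmetric] f_def g_def .
qed

lemma neg_bin_gen_tendsto:
  assumes "0 \<le> c" "x \<le> 1" "(g \<longlongrightarrow> c) F" "(f \<longlongrightarrow> x) F"
  shows "((\<lambda>t. neg_bin_gen k (g t) (f t)) \<longlongrightarrow> neg_bin_gen k c x) F"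
proof -
  have "0 < 1 + c * (1 - x)" using assms by (simp add: add_pos_nonneg)
  then show ?thesis unfolding neg_bin_gen_def using assms by (auto intro!: tendsto_intros)
qed

text \<open>A y slightly above \<open>ext_R s\<close> satisfies the strict inequality at time s,
  hence still at times t near s. It is then a supersolution at time t, so
  \<open>finite_mass t\<close> is at most \<open>finite_mass_at t y\<close>, which is close to
  \<open>finite_mass s\<close>.\<close>

lemma finite_mass_left_semicontinuous:
  assumes "0 < s" "1 < growth s" "0 < \<delta>"
  shows "\<forall>\<^sub>F t in at_left s. finite_mass t < finite_mass s + \<delta>"
proof -
  have s0: "0 \<le> s" using assms by simp
  define f where "f t y = neg_bin_gen (\<alpha> + 1) (mean_L t) y" for t y
  define g where "g t y = neg_bin_gen (\<beta> + 1) (mean_R t) y" for t y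
  note m = mean_nonneg[OF s0] and e = ext_range[OF s0] and e1 = supercritical_ext[OF s0 assms(2)]
  have f1: "f s x \<le> 1" if "x \<le> 1" for x
    unfolding f_def using m \<alpha>_pos that by (intro neg_bin_gen_le_1) auto
  have "((\<lambda>y. finite_mass_at s y) \<longlongrightarrow> finite_mass_at s (ext_R s)) (at_right (ext_R s))"
    unfolding finite_mass_at_def using m e f1[of "ext_R s"] unfolding f_def
    by (intro tendsto_intros neg_bin_gen_tendsto) auto
  then have "\<forall>\<^sub>F y in at_right (ext_R s). finite_mass_at s y < finite_mass s + \<delta>"
    using assms(3) by (intro order_tendstoD(2)) (auto simp: finite_mass_eq_at[OF s0])
  moreover have "\<forall>\<^sub>F y in at_right (ext_R s). y \<in> {ext_R s <..< 1}"
    using e1 by (rule eventually_at_right_real)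
  ultimately have "\<forall>\<^sub>F y in at_right (ext_R s). finite_mass_at s y < finite_mass s + \<delta> \<and> ext_R s < y \<and> y < 1"
    by eventually_elim auto
  then obtain y where y: "finite_mass_at s y < finite_mass s + \<delta>" "ext_R s < y" "y < 1"
    using eventually_happens'[OF trivial_limit_at_right_real] by blast
  have ml: "(mean_L \<longlongrightarrow> mean_L s) (at_left s)" "(mean_R \<longlongrightarrow> mean_R s) (at_left s)"
    unfolding mean_L_def[abs_def] mean_R_def[abs_def] using \<alpha>_pos \<beta>_pos l_pos r_pos by (auto intro!: tendsto_intros)
  have "((\<lambda>t. finite_mass_at t y) \<longlongrightarrow> finite_mass_at s y) (at_left s)"
    unfolding finite_mass_at_def using m y f1[of y] ml unfolding f_def
    by (intro tendsto_intros neg_bin_gen_tendsto) auto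
  then have "\<forall>\<^sub>F t in at_left s. finite_mass_at t y < finite_mass s + \<delta>"
    using y(1) by (rule order_tendstoD(2))
  moreover have "((\<lambda>t. g t (f t y)) \<longlongrightarrow> g s (f s y)) (at_left s)"
    unfolding f_def g_def using m y f1[of y] ml unfolding f_def by (intro neg_bin_gen_tendsto) auto
  then have "\<forall>\<^sub>F t in at_left s. g t (f t y) < y"
    using supercritical_strict[OF s0 assms(2) y(2,3)] unfolding f_def g_def by (rule order_tendstoD(2))
  moreover have "\<forall>\<^sub>F t in at_left s. t \<in> {0 <..< s}"
    using assms(1) by (rule eventually_at_left_real)
  ultimately show ?thesis
  proof eventually_elim
    case (elim t)
    then have "finite_mass t \<le> finite_mass_at t y"
      using y e unfolding f_def g_def by (intro finite_mass_le_at) auto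
    then show ?case using elim by simp
  qed
qed

end

section \<open>Components of bipartite graphs\<close>

definition component :: "graph \<Rightarrow> vertex \<Rightarrow> vertex set" where
  "component G x = (adjacency G)\<^sup>* `` {x}"

lemma adjacency_rtrancl_sym: "(x, y) \<in> (adjacency G)\<^sup>* \<Longrightarrow> (y, x) \<in> (adjacency G)\<^sup>*"
proof -
  have "sym (adjacency G)" by (auto simp: sym_def adjacency_def insert_commute)
  then show "(x, y) \<in> (adjacency G)\<^sup>* \<Longrightarrow> (y, x) \<in> (adjacency G)\<^sup>*"
    by (metis sym_rtrancl symD)
qed

lemma component_self [simp]: "x \<in> component G x"
  by (simp add: component_def)

lemma component_eq_iff: "component G x = component G y \<longleftrightarrow> y \<in> component G x"
  unfolding component_def by (auto dest: adjacency_rtrancl_sym intro: rtrancl_trans)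

lemma component_disjoint: "component G x \<noteq> component G y \<Longrightarrow> component G x \<inter> component G y = {}"
  by (metis component_eq_iff disjoint_iff)

lemma component_edge: "x \<in> component G z \<Longrightarrow> {x, y} \<in> G \<Longrightarrow> y \<in> component G z"
  unfolding component_def by (auto simp: adjacency_def intro: rtrancl_into_rtrancl)

lemma component_subset_closed:
  assumes "x \<in> S" "\<And>y z. y \<in> S \<Longrightarrow> {y, z} \<in> G \<Longrightarrow> z \<in> S"
  shows "component G x \<subseteq> S"
proof
  fix y assume "y \<in> component G x"
  then have "(x, y) \<in> (adjacency G)\<^sup>*" by (simp add: component_def)
  then show "y \<in> S"
    by (induction rule: rtrancl_induct) (use assms in \<open>auto simp: adjacency_def\<close>)
qed

lemma component_mono: "G \<subseteq> G' \<Longrightarrow> component G x \<subseteq> component G' x"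
  by (intro component_subset_closed component_self) (auto intro: component_edge)

lemma component_insert_edge:
  "component (insert {u, v} G) x =
     (if x \<in> component G u \<union> component G v then component G u \<union> component G v else component G x)"
proof -
  let ?G = "insert {u, v} G"
  have sub: "component G y \<subseteq> component ?G y" for y by (intro component_mono) auto
  have uv: "component ?G u = component ?G v"
    unfolding component_eq_iff using component_edge[of u ?G u v] by simp
  have le: "component ?G x \<subseteq> component G u \<union> component G v" if "x \<in> component G u \<union> component G v" for x
    using that by (intro component_subset_closed) (auto simp: doubleton_eq_iff intro: component_edge)
  have ge: "component G u \<union> component G v \<subseteq> component ?G x" if x: "x \<in> component G u \<union> component G v"
  proof -
    have "component ?G x = component ?G u"
      using x sub[of u] sub[of v] uv component_eq_iff by blast
    then show ?thesis using sub[of u] sub[of v] uv by auto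
  qed
  have "component ?G x = component G x" if x: "x \<notin> component G u \<union> component G v"
  proof (rule antisym[OF _ sub], rule component_subset_closed)
    fix y z assume "y \<in> component G x" "{y, z} \<in> ?G"
    moreover have "u \<notin> component G x" "v \<notin> component G x"
      using x component_eq_iff by blast+
    ultimately show "z \<in> component G x" by (auto simp: doubleton_eq_iff intro: component_edge)
  qed simp
  moreover have "component ?G x = component G u \<union> component G v" if "x \<in> component G u \<union> component G v"
    using le[OF that] ge[OF that] by (rule antisym)
  ultimately show ?thesis by simp
qed

lemma components_eq: "components l r G = component G ` vertices l r"
  unfolding components_def quotient_def component_def by auto

lemma finite_parts [simp]: "finite (left_part l)" "finite (right_part r)" "finite (vertices l r)"
  by (auto simp: left_part_def right_part_def vertices_def)

lemma parts_disjoint: "left_part l \<inter> right_part r = {}"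
  by (auto simp: left_part_def right_part_def)

lemma card_parts [simp]: "card (left_part l) = l" "card (right_part r) = r" "card (vertices l r) = l + r"
  using parts_disjoint[of l r]
  by (auto simp: vertices_def card_Un_disjoint left_part_def right_part_def card_image)

lemma finite_components [simp]: "finite (components l r G)"
  by (simp add: components_eq)

lemma components_disjoint: "C \<in> components l r G \<Longrightarrow> D \<in> components l r G \<Longrightarrow> C \<noteq> D \<Longrightarrow> C \<inter> D = {}"
  unfolding components_eq using component_disjoint by blast

definition bipartite :: "nat \<Rightarrow> nat \<Rightarrow> graph \<Rightarrow> bool" where
  "bipartite l r G \<longleftrightarrow> (\<forall>e\<in>G. \<exists>u\<in>left_part l. \<exists>v\<in>right_part r. e = {u, v})"

type_synonym ctype = "nat \<times> nat \<times> nat"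

text \<open>Every edge of a bipartite graph has exactly one left end, so the sum of the left degrees
  is the number of edges; as a sum over vertices it is additive under disjoint unions.\<close>

definition component_type :: "nat \<Rightarrow> nat \<Rightarrow> graph \<Rightarrow> vertex set \<Rightarrow> ctype" where
  "component_type l r G C =
     (card (C \<inter> left_part l), card (C \<inter> right_part r), \<Sum>x\<in>C \<inter> left_part l. degree G x)"

definition merge_types :: "ctype \<Rightarrow> ctype \<Rightarrow> ctype" where
  "merge_types S T = (case (S, T) of ((a, b, e), (a', b', e')) \<Rightarrow> (a + a', b + b', Suc (e + e')))"

text \<open>These are formal splittings, and types without vertices occur in them; no component has
  such a type, and the limit density of such a type is 0.\<close>

definition splits :: "ctype \<Rightarrow> (ctype \<times> ctype) set" where
  "splits T = {(T1, T2). merge_types T1 T2 = T}"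

definition count_type :: "nat \<Rightarrow> nat \<Rightarrow> graph \<Rightarrow> ctype \<Rightarrow> nat" where
  "count_type l r G T = card {C \<in> components l r G. component_type l r G C = T}"

lemma finite_splits [simp]: "finite (splits T)"
proof -
  obtain a b e where T: "T = (a, b, e)" by (cases T) auto
  have "splits T \<subseteq> ({..a} \<times> {..b} \<times> {..e}) \<times> ({..a} \<times> {..b} \<times> {..e})"
    by (auto simp: splits_def merge_types_def T)
  then show ?thesis by (rule finite_subset) auto
qed

lemma count_type_sum: "real (count_type l r G T) = (\<Sum>C\<in>components l r G. of_bool (component_type l r G C = T))"
proof -
  have "(\<Sum>C\<in>components l r G. of_bool (component_type l r G C = T)) =
      (\<Sum>C\<in>{C \<in> components l r G. component_type l r G C = T}. 1 :: real)"
    by (rule sum.mono_neutral_cong_right) auto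
  then show ?thesis by (simp add: count_type_def)
qed

locale bipartite_graph =
  fixes l r :: nat and G :: graph
  assumes bip: "bipartite l r G"
begin

lemma edgeE:
  assumes "e \<in> G"
  obtains u v where "u \<in> left_part l" "v \<in> right_part r" "e = {u, v}"
  using assms bip unfolding bipartite_def by blast

lemma finite_graph [simp]: "finite G"
proof (rule finite_subset)
  show "G \<subseteq> (\<lambda>(u, v). {u, v}) ` (left_part l \<times> right_part r)"
    by (auto elim!: edgeE)
qed auto

lemma edge_subset_vertices: "e \<in> G \<Longrightarrow> e \<subseteq> vertices l r"
  by (auto elim!: edgeE simp: vertices_def)

lemma component_subset_vertices: "x \<in> vertices l r \<Longrightarrow> component G x \<subseteq> vertices l r"
  by (rule component_subset_closed) (use edge_subset_vertices in auto)

lemma degree_left: "u \<in> left_part l \<Longrightarrow> degree G u = card {v \<in> right_part r. {u, v} \<in> G}"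
proof -
  assume u: "u \<in> left_part l"
  have "bij_betw (\<lambda>v. {u, v}) {v \<in> right_part r. {u, v} \<in> G} {e \<in> G. u \<in> e}"
  proof (rule bij_betwI')
    fix e assume "e \<in> {e \<in> G. u \<in> e}"
    then have "e \<in> G" "u \<in> e" by auto
    moreover from this(1) obtain x y where "x \<in> left_part l" "y \<in> right_part r" "e = {x, y}"
      by (rule edgeE)
    ultimately show "\<exists>v\<in>{v \<in> right_part r. {u, v} \<in> G}. e = {u, v}"
      using u parts_disjoint[of l r] by blast
  qed (auto simp: doubleton_eq_iff)
  then show ?thesis unfolding degree_def by (rule bij_betw_same_card[symmetric])
qed

lemma degree_right: "v \<in> right_part r \<Longrightarrow> degree G v = card {u \<in> left_part l. {u, v} \<in> G}"
proof -
  assume v: "v \<in> right_part r"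
  have "bij_betw (\<lambda>u. {u, v}) {u \<in> left_part l. {u, v} \<in> G} {e \<in> G. v \<in> e}"
  proof (rule bij_betwI')
    fix e assume "e \<in> {e \<in> G. v \<in> e}"
    then have "e \<in> G" "v \<in> e" by auto
    moreover from this(1) obtain x y where "x \<in> left_part l" "y \<in> right_part r" "e = {x, y}"
      by (rule edgeE)
    ultimately show "\<exists>u\<in>{u \<in> left_part l. {u, v} \<in> G}. e = {u, v}"
      using v parts_disjoint[of l r] by blast
  qed (auto simp: doubleton_eq_iff)
  then show ?thesis unfolding degree_def by (rule bij_betw_same_card[symmetric])
qed

text \<open>An edge that meets S lies in S, and it has one end in either part; so both degree sums
  count each edge inside S once.\<close>

lemma degree_sum_closed:
  assumes closed: "\<And>y z. y \<in> S \<Longrightarrow> {y, z} \<in> G \<Longrightarrow> z \<in> S"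
  shows "(\<Sum>x\<in>S \<inter> left_part l. degree G x) = card {e \<in> G. e \<subseteq> S}"
    and "(\<Sum>x\<in>S \<inter> right_part r. degree G x) = card {e \<in> G. e \<subseteq> S}"
proof -
  have e: "\<exists>u v. u \<in> S \<inter> left_part l \<and> v \<in> S \<inter> right_part r \<and> e = {u, v}"
    if eG: "e \<in> G" "e \<inter> S \<noteq> {}" for e
  proof -
    obtain u v where uv: "u \<in> left_part l" "v \<in> right_part r" "e = {u, v}" using eG(1) by (rule edgeE)
    then have "u \<in> S" "v \<in> S" using eG closed[of u v] closed[of v u] by (auto simp: insert_commute)
    then show ?thesis using uv by blast
  qed
  have "(\<Sum>x\<in>S \<inter> left_part l. degree G x) = card (\<Union>x\<in>S \<inter> left_part l. {e \<in> G. x \<in> e})"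
    unfolding degree_def using parts_disjoint[of l r]
    by (intro card_UN_disjoint[symmetric]) (auto elim!: edgeE)
  also have "(\<Union>x\<in>S \<inter> left_part l. {e \<in> G. x \<in> e}) = {e \<in> G. e \<subseteq> S}"
  proof safe
    fix e x y assume "e \<in> G" "x \<in> S" "x \<in> left_part l" "x \<in> e" "y \<in> e"
    then show "y \<in> S" using e[of e] by blast
  next
    fix e assume *: "e \<in> G" "e \<subseteq> S"
    then have "e \<inter> S \<noteq> {}" by (auto elim!: edgeE)
    then show "e \<in> (\<Union>x\<in>S \<inter> left_part l. {e \<in> G. x \<in> e})" using e[of e] * by blast
  qed
  finally show "(\<Sum>x\<in>S \<inter> left_part l. degree G x) = card {e \<in> G. e \<subseteq> S}" .
  have "(\<Sum>x\<in>S \<inter> right_part r. degree G x) = card (\<Union>x\<in>S \<inter> right_part r. {e \<in> G. x \<in> e})"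
    unfolding degree_def using parts_disjoint[of l r]
    by (intro card_UN_disjoint[symmetric]) (auto elim!: edgeE)
  also have "(\<Union>x\<in>S \<inter> right_part r. {e \<in> G. x \<in> e}) = {e \<in> G. e \<subseteq> S}"
  proof safe
    fix e x y assume "e \<in> G" "x \<in> S" "x \<in> right_part r" "x \<in> e" "y \<in> e"
    then show "y \<in> S" using e[of e] by blast
  next
    fix e assume *: "e \<in> G" "e \<subseteq> S"
    then have "e \<inter> S \<noteq> {}" by (auto elim!: edgeE)
    then show "e \<in> (\<Union>x\<in>S \<inter> right_part r. {e \<in> G. x \<in> e})" using e[of e] * by blast
  qed
  finally show "(\<Sum>x\<in>S \<inter> right_part r. degree G x) = card {e \<in> G. e \<subseteq> S}" .
qed

lemma degree_sums_component:
  "(\<Sum>y\<in>component G x \<inter> right_part r. degree G y) = (\<Sum>y\<in>component G x \<inter> left_part l. degree G y)"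
  using degree_sum_closed[of "component G x"] component_edge by metis

lemma degree_sums_total:
  "(\<Sum>x\<in>left_part l. degree G x) = card G" "(\<Sum>x\<in>right_part r. degree G x) = card G"
  using degree_sum_closed[of UNIV] by auto

lemma degree_insert:
  "{u, v} \<notin> G \<Longrightarrow> degree (insert {u, v} G) x = degree G x + (if x = u \<or> x = v then 1 else 0)"
proof -
  assume "{u, v} \<notin> G"
  moreover have "{e \<in> insert {u, v} G. x \<in> e} =
     (if x = u \<or> x = v then insert {u, v} {e \<in> G. x \<in> e} else {e \<in> G. x \<in> e})" by auto
  ultimately show ?thesis by (simp add: degree_def)
qed

lemma component_vertex_sum:
  fixes f :: "vertex \<Rightarrow> real"
  assumes "S \<subseteq> vertices l r"
  shows "(\<Sum>x\<in>S. f x) = (\<Sum>C\<in>components l r G. \<Sum>x\<in>C \<inter> S. f x)"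
proof -
  have "S = (\<Union>C\<in>components l r G. C \<inter> S)"
    using assms component_self unfolding components_eq by blast
  moreover have "(\<Sum>x\<in>(\<Union>C\<in>components l r G. C \<inter> S). f x) = (\<Sum>C\<in>components l r G. \<Sum>x\<in>C \<inter> S. f x)"
  proof (rule sum.UNION_disjoint)
    show "\<forall>C\<in>components l r G. finite (C \<inter> S)"
      using assms finite_parts(3) finite_subset by blast
    show "\<forall>C\<in>components l r G. \<forall>D\<in>components l r G. C \<noteq> D \<longrightarrow> C \<inter> S \<inter> (D \<inter> S) = {}"
      using components_disjoint by blast
  qed simp
  ultimately show ?thesis by simp
qed

lemma component_eq_if_mem: "C \<in> components l r G \<Longrightarrow> x \<in> C \<Longrightarrow> component G x = C"
  unfolding components_eq using component_eq_iff by blast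

abbreviation vtype :: "vertex \<Rightarrow> ctype" where
  "vtype x \<equiv> component_type l r G (component G x)"

lemma components_insert:
  assumes "u \<in> left_part l" "v \<in> right_part r"
  shows "components l r (insert {u, v} G) =
    insert (component G u \<union> component G v) (components l r G - {component G u, component G v})"
proof -
  have V: "u \<in> vertices l r" "v \<in> vertices l r" using assms by (auto simp: vertices_def)
  have x_in: "x \<in> component G u \<union> component G v \<longleftrightarrow> component G x = component G u \<or> component G x = component G v" for x
    using component_eq_iff[of G u x] component_eq_iff[of G v x] by auto
  show ?thesis
  proof (intro equalityI subsetI)
    fix C assume "C \<in> components l r (insert {u, v} G)"
    then obtain x where x: "x \<in> vertices l r" "C = component (insert {u, v} G) x" unfolding components_eq by blast
    show "C \<in> insert (component G u \<union> component G v) (components l r G - {component G u, component G v})"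
    proof (cases "x \<in> component G u \<union> component G v")
      case True
      then show ?thesis using x component_insert_edge[of u v G x] by simp
    next
      case False
      then have "C = component G x" using x component_insert_edge[of u v G x] by simp
      then show ?thesis using x(1) False x_in[of x] unfolding components_eq by blast
    qed
  next
    fix C assume "C \<in> insert (component G u \<union> component G v) (components l r G - {component G u, component G v})"
    then consider "C = component G u \<union> component G v" |
      x where "x \<in> vertices l r" "C = component G x" "C \<noteq> component G u" "C \<noteq> component G v"
      unfolding components_eq by blast
    then show "C \<in> components l r (insert {u, v} G)"
    proof cases
      case 1
      then have "C = component (insert {u, v} G) u" using component_insert_edge[of u v G u] by simp
      then show ?thesis using V unfolding components_eq by blast
    next
      case 2
      then have "x \<notin> component G u \<union> component G v" using x_in[of x] by blast
      then have "C = component (insert {u, v} G) x" using 2 component_insert_edge[of u v G x] by simp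
      then show ?thesis using 2 unfolding components_eq by blast
    qed
  qed
qed

lemma component_type_insert_other:
  assumes "{u, v} \<notin> G" "C \<in> components l r G" "C \<noteq> component G u" "C \<noteq> component G v"
  shows "component_type l r (insert {u, v} G) C = component_type l r G C"
proof -
  have "u \<notin> C" "v \<notin> C" using assms component_eq_if_mem by blast+
  then have "degree (insert {u, v} G) x = degree G x" if "x \<in> C" for x
    using that degree_insert[OF assms(1)] by auto
  then show ?thesis unfolding component_type_def by simp
qed

lemma finite_component: "x \<in> vertices l r \<Longrightarrow> finite (component G x)"
  using component_subset_vertices finite_parts(3) finite_subset by blast

lemma degree_sum_insert_left:
  assumes "{u, v} \<notin> G" "u \<in> left_part l" "v \<in> right_part r" "u \<in> C"
  shows "(\<Sum>x\<in>C \<inter> left_part l. degree (insert {u, v} G) x) = Suc (\<Sum>x\<in>C \<inter> left_part l. degree G x)"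
proof -
  have "v \<notin> left_part l" using assms parts_disjoint[of l r] by auto
  then have "(\<Sum>x\<in>C \<inter> left_part l. degree (insert {u, v} G) x) =
      (\<Sum>x\<in>C \<inter> left_part l. degree G x + (if x = u then 1 else 0))"
    unfolding degree_insert[OF assms(1)] by (intro sum.cong) auto
  also have "\<dots> = (\<Sum>x\<in>C \<inter> left_part l. degree G x) + 1"
    unfolding sum.distrib using assms by simp
  finally show ?thesis by simp
qed

lemma component_type_insert_new:
  assumes "{u, v} \<notin> G" "u \<in> left_part l" "v \<in> right_part r"
  shows "component_type l r (insert {u, v} G) (component G u \<union> component G v) =
    (if component G u = component G v then (case vtype u of (a, b, e) \<Rightarrow> (a, b, Suc e))
     else merge_types (vtype u) (vtype v))"
proof (cases "component G u = component G v")
  case True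
  have "(\<Sum>x\<in>component G u \<inter> left_part l. degree (insert {u, v} G) x) =
     Suc (\<Sum>x\<in>component G u \<inter> left_part l. degree G x)"
    by (rule degree_sum_insert_left[OF assms]) simp
  then show ?thesis using True by (simp add: component_type_def)
next
  case False
  have V: "u \<in> vertices l r" "v \<in> vertices l r" using assms by (auto simp: vertices_def)
  note fin = finite_component[OF V(1)] finite_component[OF V(2)]
  have d: "(component G u \<inter> X) \<inter> (component G v \<inter> X) = {}" for X using component_disjoint[OF False] by auto
  have "(\<Sum>x\<in>(component G u \<union> component G v) \<inter> left_part l. degree (insert {u, v} G) x) =
     Suc (\<Sum>x\<in>(component G u \<union> component G v) \<inter> left_part l. degree G x)"
    by (rule degree_sum_insert_left[OF assms]) simp
  then show ?thesis
    using False fin d unfolding component_type_def Int_Un_distrib2 merge_types_def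
    by (simp add: card_Un_disjoint sum.union_disjoint)
qed

text \<open>One new component replaces the one or two old ones; all other components keep their
  vertices and degrees, hence their types.\<close>

lemma count_type_insert:
  assumes "{u, v} \<notin> G" "u \<in> left_part l" "v \<in> right_part r"
  shows "real (count_type l r (insert {u, v} G) T) - real (count_type l r G T) =
    (if component G u = component G v
     then of_bool ((case vtype u of (a, b, e) \<Rightarrow> (a, b, Suc e)) = T) - of_bool (vtype u = T)
     else of_bool (merge_types (vtype u) (vtype v) = T) - of_bool (vtype u = T) - of_bool (vtype v = T))"
proof -
  let ?Cu = "component G u" and ?Cv = "component G v" and ?G = "insert {u, v} G"
  let ?R = "components l r G - {?Cu, ?Cv}"
  have V: "u \<in> vertices l r" "v \<in> vertices l r" using assms by (auto simp: vertices_def)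
  have C: "?Cu \<in> components l r G" "?Cv \<in> components l r G" using V by (auto simp: components_eq)
  have n: "?Cu \<union> ?Cv \<notin> ?R"
    using component_eq_if_mem[of "?Cu \<union> ?Cv" u] component_self[of u G] by auto
  have "real (count_type l r ?G T) =
     of_bool (component_type l r ?G (?Cu \<union> ?Cv) = T) + (\<Sum>C\<in>?R. of_bool (component_type l r ?G C = T))"
    unfolding count_type_sum components_insert[OF assms(2,3)] using n by (subst sum.insert) auto
  also have "(\<Sum>C\<in>?R. of_bool (component_type l r ?G C = T)) = (\<Sum>C\<in>?R. of_bool (component_type l r G C = T) :: real)"
    by (intro sum.cong refl) (auto simp: component_type_insert_other[OF assms(1)])
  also have "\<dots> = real (count_type l r G T) - (\<Sum>C\<in>{?Cu, ?Cv}. of_bool (component_type l r G C = T))"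
    unfolding count_type_sum using C by (subst sum_diff) auto
  finally show ?thesis
    unfolding component_type_insert_new[OF assms] by (auto simp del: of_bool_eq_iff)
qed

end

section \<open>Attachment weights and the effect of one random edge\<close>

definition vweight :: "real \<Rightarrow> graph \<Rightarrow> vertex \<Rightarrow> real" where
  "vweight k G x = real (degree G x) + k"

definition left_weight :: "real \<Rightarrow> ctype \<Rightarrow> real" where
  "left_weight k T = (case T of (a, b, e) \<Rightarrow> k * real a + real e)"

definition right_weight :: "real \<Rightarrow> ctype \<Rightarrow> real" where
  "right_weight k T = (case T of (a, b, e) \<Rightarrow> k * real b + real e)"

locale weighted_graph = bipartite_graph +
  fixes \<alpha> \<beta> :: real
  assumes \<alpha>_pos: "0 < \<alpha>" and \<beta>_pos: "0 < \<beta>"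
begin

definition W_L :: real where "W_L = real (card G) + \<alpha> * real l"
definition W_R :: real where "W_R = real (card G) + \<beta> * real r"
definition Z :: real where
  "Z = (\<Sum>(u, v)\<in>available_pairs l r G. vweight \<alpha> G u * vweight \<beta> G v)"

lemma vweight_pos: "0 < vweight \<alpha> G x" "0 < vweight \<beta> G x" "\<alpha> \<le> vweight \<alpha> G x" "\<beta> \<le> vweight \<beta> G x"
  using \<alpha>_pos \<beta>_pos by (auto simp: vweight_def intro: add_nonneg_pos)

lemma vweight_nonneg: "0 \<le> vweight \<alpha> G x" "0 \<le> vweight \<beta> G x"
  using vweight_pos by (simp_all add: less_imp_le)

lemma vweight_prod_nonneg: "0 \<le> vweight \<alpha> G x * vweight \<beta> G y"
  by (intro mult_nonneg_nonneg vweight_nonneg)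

lemma W_sum: "(\<Sum>u\<in>left_part l. vweight \<alpha> G u) = W_L" "(\<Sum>v\<in>right_part r. vweight \<beta> G v) = W_R"
  unfolding vweight_def W_L_def W_R_def sum.distrib
  using degree_sums_total by (simp_all flip: of_nat_sum)

lemma W_nonneg: "0 \<le> W_L" "0 \<le> W_R"
  using \<alpha>_pos \<beta>_pos by (simp_all add: W_L_def W_R_def)

lemma available_subset: "available_pairs l r G \<subseteq> left_part l \<times> right_part r"
  by (auto simp: available_pairs_def)

lemma finite_available [simp]: "finite (available_pairs l r G)"
  by (rule finite_subset[OF available_subset]) auto

lemma expectation_add_random_edge:
  assumes "available_pairs l r G \<noteq> {}"
  shows "measure_pmf.expectation (add_random_edge l r \<alpha> \<beta> G) f =
    (\<Sum>(u, v)\<in>available_pairs l r G. vweight \<alpha> G u * vweight \<beta> G v * f (insert {u, v} G)) / Z"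
proof -
  let ?A = "available_pairs l r G"
  have pw: "pair_weight \<alpha> \<beta> G = (\<lambda>(u, v). vweight \<alpha> G u * vweight \<beta> G v)"
    by (simp add: pair_weight_def vweight_def)
  have "0 < pair_weight \<alpha> \<beta> G x" for x
    unfolding pw using vweight_pos by (auto split: prod.split)
  note pmf = pmf_proportional_pmf[OF finite_available assms this]
  have set: "set_pmf (proportional_pmf (pair_weight \<alpha> \<beta> G) ?A) \<subseteq> ?A"
    using pmf by (auto simp: set_pmf_iff split: if_splits)
  have "measure_pmf.expectation (add_random_edge l r \<alpha> \<beta> G) f =
      measure_pmf.expectation (proportional_pmf (pair_weight \<alpha> \<beta> G) ?A) (\<lambda>(u, v). f (insert {u, v} G))"
    using assms by (simp add: add_random_edge_def case_prod_unfold)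
  also have "\<dots> = (\<Sum>x\<in>?A. pmf (proportional_pmf (pair_weight \<alpha> \<beta> G) ?A) x *\<^sub>R (case x of (u, v) \<Rightarrow> f (insert {u, v} G)))"
    by (rule integral_measure_pmf) (use set in auto)
  also have "\<dots> = (\<Sum>x\<in>?A. (case x of (u, v) \<Rightarrow> vweight \<alpha> G u * vweight \<beta> G v * f (insert {u, v} G)) / Z)"
    by (intro sum.cong refl) (auto simp: pmf[unfolded pw] pw Z_def)
  finally show ?thesis by (simp add: sum_divide_distrib)
qed

lemma W_prod: "W_L * W_R = (\<Sum>(u, v)\<in>left_part l \<times> right_part r. vweight \<alpha> G u * vweight \<beta> G v)"
  unfolding W_sum[symmetric] sum_product sum.cartesian_product ..

lemma W_prod_split:
  "W_L * W_R = Z + (\<Sum>(u, v)\<in>{(u, v) \<in> left_part l \<times> right_part r. {u, v} \<in> G}. vweight \<alpha> G u * vweight \<beta> G v)"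
proof -
  define adj where "adj = {(u, v) \<in> left_part l \<times> right_part r. {u, v} \<in> G}"
  have "finite adj" by (rule finite_subset[of _ "left_part l \<times> right_part r"]) (auto simp: adj_def)
  moreover have "available_pairs l r G \<inter> adj = {}" "left_part l \<times> right_part r = available_pairs l r G \<union> adj"
    by (auto simp: available_pairs_def adj_def)
  ultimately show ?thesis
    unfolding W_prod Z_def adj_def[symmetric] by (simp add: sum.union_disjoint)
qed

lemma card_adjacent: "card {(u, v) \<in> left_part l \<times> right_part r. {u, v} \<in> G} \<le> card G"
proof (rule card_inj_on_le[where f = "\<lambda>(u, v). {u, v}"])
  show "inj_on (\<lambda>(u, v). {u, v}) {(u, v) \<in> left_part l \<times> right_part r. {u, v} \<in> G}"
    using parts_disjoint[of l r] by (auto simp: inj_on_def doubleton_eq_iff)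
qed auto

text \<open>At most \<open>card G\<close> pairs are adjacent, and every other pair weighs at least
  \<alpha> \<beta>. With linearly many edges this makes Z quadratic in the number of
  vertices.\<close>

lemma Z_lower: "\<alpha> * \<beta> * (real l * real r - real (card G)) \<le> Z"
proof -
  let ?adj = "{(u, v) \<in> left_part l \<times> right_part r. {u, v} \<in> G}"
  have A: "available_pairs l r G = left_part l \<times> right_part r - ?adj"
    by (auto simp: available_pairs_def)
  have "card (left_part l \<times> right_part r) - card ?adj \<le> card (available_pairs l r G)"
    unfolding A by (rule diff_card_le_card_Diff) (rule finite_subset[of _ "left_part l \<times> right_part r"], auto)
  then have "l * r \<le> card (available_pairs l r G) + card G"
    using card_adjacent by (simp add: card_cartesian_product)
  then have "real l * real r \<le> real (card (available_pairs l r G)) + real (card G)"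
    unfolding of_nat_mult[symmetric] of_nat_add[symmetric] of_nat_le_iff .
  then have "\<alpha> * \<beta> * (real l * real r - real (card G)) \<le> \<alpha> * \<beta> * real (card (available_pairs l r G))"
    using \<alpha>_pos \<beta>_pos by (intro mult_left_mono) auto
  also have "\<dots> = (\<Sum>(u, v)\<in>available_pairs l r G. \<alpha> * \<beta>)"
    by (simp add: case_prod_unfold mult.commute)
  also have "\<dots> \<le> Z"
    unfolding Z_def case_prod_unfold
    by (intro sum_mono mult_mono vweight_pos(3,4) vweight_nonneg) (use \<beta>_pos in simp)
  finally show ?thesis .
qed

lemma Z_le: "Z \<le> W_L * W_R"
  unfolding W_prod_split case_prod_unfold by (simp add: sum_nonneg vweight_prod_nonneg)

text \<open>The excess is the weight of the adjacent pairs. A product of two weights is at most the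
  mean of their squares, and each vertex lies in as many adjacent pairs as its degree, which is at
  most its weight; this produces the cubes.\<close>

lemma rejection_le:
  "W_L * W_R - Z \<le> ((\<Sum>u\<in>left_part l. vweight \<alpha> G u ^ 3) + (\<Sum>v\<in>right_part r. vweight \<beta> G v ^ 3)) / 2"
proof -
  let ?adj = "{(u, v) \<in> left_part l \<times> right_part r. {u, v} \<in> G}"
  have S: "(\<Sum>(u, v)\<in>?adj. f u v) = (\<Sum>(u, v)\<in>left_part l \<times> right_part r. of_bool ({u, v} \<in> G) * f u v)"
    for f :: "vertex \<Rightarrow> vertex \<Rightarrow> real"
    by (rule sum.mono_neutral_cong_left) auto
  have L: "(\<Sum>(u, v)\<in>?adj. vweight \<alpha> G u ^ 2) \<le> (\<Sum>u\<in>left_part l. vweight \<alpha> G u ^ 3)"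
    unfolding S sum.cartesian_product[symmetric]
  proof (rule sum_mono)
    fix u assume u: "u \<in> left_part l"
    have "(\<Sum>v\<in>right_part r. of_bool ({u, v} \<in> G)) = real (degree G u)"
      unfolding degree_left[OF u] by (simp add: Int_def)
    then have "(\<Sum>v\<in>right_part r. of_bool ({u, v} \<in> G) * vweight \<alpha> G u ^ 2) = real (degree G u) * vweight \<alpha> G u ^ 2"
      unfolding sum_distrib_right[symmetric] by simp
    also have "\<dots> \<le> vweight \<alpha> G u * vweight \<alpha> G u ^ 2"
      using \<alpha>_pos by (intro mult_right_mono) (auto simp: vweight_def)
    finally show "(\<Sum>v\<in>right_part r. of_bool ({u, v} \<in> G) * vweight \<alpha> G u ^ 2) \<le> vweight \<alpha> G u ^ 3"
      by (simp add: power2_eq_square power3_eq_cube)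
  qed
  have R: "(\<Sum>(u, v)\<in>?adj. vweight \<beta> G v ^ 2) \<le> (\<Sum>v\<in>right_part r. vweight \<beta> G v ^ 3)"
    unfolding S sum.cartesian_product[symmetric]
  proof (subst sum.swap, rule sum_mono)
    fix v assume v: "v \<in> right_part r"
    have "(\<Sum>u\<in>left_part l. of_bool ({u, v} \<in> G)) = real (degree G v)"
      unfolding degree_right[OF v] by (simp add: Int_def)
    then have "(\<Sum>u\<in>left_part l. of_bool ({u, v} \<in> G) * vweight \<beta> G v ^ 2) = real (degree G v) * vweight \<beta> G v ^ 2"
      unfolding sum_distrib_right[symmetric] by simp
    also have "\<dots> \<le> vweight \<beta> G v * vweight \<beta> G v ^ 2"
      using \<beta>_pos by (intro mult_right_mono) (auto simp: vweight_def)
    finally show "(\<Sum>u\<in>left_part l. of_bool ({u, v} \<in> G) * vweight \<beta> G v ^ 2) \<le> vweight \<beta> G v ^ 3"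
      by (simp add: power2_eq_square power3_eq_cube)
  qed
  have "W_L * W_R - Z = (\<Sum>(u, v)\<in>?adj. vweight \<alpha> G u * vweight \<beta> G v)"
    unfolding W_prod_split by simp
  also have "\<dots> \<le> (\<Sum>(u, v)\<in>?adj. (vweight \<alpha> G u ^ 2 + vweight \<beta> G v ^ 2) / 2)"
  proof -
    have "x * y \<le> (x ^ 2 + y ^ 2) / 2" for x y :: real using sum_squares_bound[of x y] by simp
    then show ?thesis unfolding case_prod_unfold by (intro sum_mono)
  qed
  also have "\<dots> = ((\<Sum>(u, v)\<in>?adj. vweight \<alpha> G u ^ 2) + (\<Sum>(u, v)\<in>?adj. vweight \<beta> G v ^ 2)) / 2"
    by (simp add: case_prod_unfold sum.distrib sum_divide_distrib[symmetric] add_divide_distrib)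
  finally show ?thesis using L R by simp
qed

text \<open>The vertices are grouped by component, and the left weight of a component is determined
  by its type.\<close>

lemma left_mass:
  "(\<Sum>u\<in>left_part l. vweight \<alpha> G u * of_bool (vtype u = T)) = left_weight \<alpha> T * real (count_type l r G T)"
proof -
  have "(\<Sum>u\<in>left_part l. vweight \<alpha> G u * of_bool (vtype u = T)) =
     (\<Sum>C\<in>components l r G. \<Sum>u\<in>C \<inter> left_part l. vweight \<alpha> G u * of_bool (vtype u = T))"
    by (rule component_vertex_sum) (auto simp: vertices_def)
  also have "\<dots> = (\<Sum>C\<in>components l r G. left_weight \<alpha> T * of_bool (component_type l r G C = T))"
  proof (rule sum.cong[OF refl])
    fix C assume C: "C \<in> components l r G"
    have "(\<Sum>u\<in>C \<inter> left_part l. vweight \<alpha> G u * of_bool (vtype u = T)) =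
       (\<Sum>u\<in>C \<inter> left_part l. vweight \<alpha> G u) * of_bool (component_type l r G C = T)"
      unfolding sum_distrib_right using component_eq_if_mem[OF C] by (intro sum.cong refl) auto
    also have "(\<Sum>u\<in>C \<inter> left_part l. vweight \<alpha> G u) = left_weight \<alpha> (component_type l r G C)"
      unfolding vweight_def sum.distrib by (simp add: component_type_def left_weight_def)
    finally show "(\<Sum>u\<in>C \<inter> left_part l. vweight \<alpha> G u * of_bool (vtype u = T)) =
       left_weight \<alpha> T * of_bool (component_type l r G C = T)" by auto
  qed
  finally show ?thesis by (simp add: count_type_sum sum_distrib_left)
qed

lemma right_component_weight:
  assumes "C \<in> components l r G"
  shows "(\<Sum>u\<in>C \<inter> right_part r. vweight \<beta> G u) = right_weight \<beta> (component_type l r G C)"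
proof -
  obtain x where "C = component G x" using assms by (auto simp: components_eq)
  then show ?thesis
    unfolding vweight_def sum.distrib using degree_sums_component[of x]
    by (simp add: component_type_def right_weight_def flip: of_nat_sum)
qed

lemma right_mass:
  "(\<Sum>u\<in>right_part r. vweight \<beta> G u * of_bool (vtype u = T)) = right_weight \<beta> T * real (count_type l r G T)"
proof -
  have "(\<Sum>u\<in>right_part r. vweight \<beta> G u * of_bool (vtype u = T)) =
     (\<Sum>C\<in>components l r G. \<Sum>u\<in>C \<inter> right_part r. vweight \<beta> G u * of_bool (vtype u = T))"
    by (rule component_vertex_sum) (auto simp: vertices_def)
  also have "\<dots> = (\<Sum>C\<in>components l r G. right_weight \<beta> T * of_bool (component_type l r G C = T))"
  proof (rule sum.cong[OF refl])
    fix C assume C: "C \<in> components l r G"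
    have "(\<Sum>u\<in>C \<inter> right_part r. vweight \<beta> G u * of_bool (vtype u = T)) =
       (\<Sum>u\<in>C \<inter> right_part r. vweight \<beta> G u) * of_bool (component_type l r G C = T)"
      unfolding sum_distrib_right using component_eq_if_mem[OF C] by (intro sum.cong refl) auto
    then show "(\<Sum>u\<in>C \<inter> right_part r. vweight \<beta> G u * of_bool (vtype u = T)) =
       right_weight \<beta> T * of_bool (component_type l r G C = T)"
      unfolding right_component_weight[OF C] by auto
  qed
  finally show ?thesis by (simp add: count_type_sum sum_distrib_left)
qed

text \<open>Only if \<open>u\<close> and \<open>v\<close> lie in different components is this the effect of the edge \<open>{u, v}\<close>, but
  summed over all pairs it factorizes.\<close>

definition merge_effect :: "ctype \<Rightarrow> vertex \<Rightarrow> vertex \<Rightarrow> real" where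
  "merge_effect T u v =
     of_bool (merge_types (vtype u) (vtype v) = T) - of_bool (vtype u = T) - of_bool (vtype v = T)"

lemma merge_effect_bound: "\<bar>merge_effect T u v\<bar> \<le> 2"
  by (simp add: merge_effect_def)

definition share_L :: "ctype \<Rightarrow> real" where
  "share_L T = left_weight \<alpha> T * real (count_type l r G T) / W_L"

definition share_R :: "ctype \<Rightarrow> real" where
  "share_R T = right_weight \<beta> T * real (count_type l r G T) / W_R"

definition drift :: "ctype \<Rightarrow> real" where
  "drift T = (\<Sum>(T1, T2)\<in>splits T. share_L T1 * share_R T2) - share_L T - share_R T"

text \<open>Once the indicator of a merger into T is a sum of products over \<open>splits T\<close>,
  every summand is a function of u times a function of v, and the sum over all pairs
  factorizes.\<close>

lemma merge_effect_sum:
  assumes "0 < W_L" "0 < W_R"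
  shows "(\<Sum>(u, v)\<in>left_part l \<times> right_part r. vweight \<alpha> G u * vweight \<beta> G v * merge_effect T u v) =
    W_L * W_R * drift T"
proof -
  have split: "of_bool (merge_types S S' = T) = (\<Sum>(T1, T2)\<in>splits T. of_bool (S = T1) * of_bool (S' = T2) :: real)" for S S'
  proof (cases "merge_types S S' = T")
    case True
    have "(\<Sum>(T1, T2)\<in>splits T. of_bool (S = T1) * of_bool (S' = T2) :: real) = (\<Sum>x\<in>{(S, S')}. 1)"
      using True by (intro sum.mono_neutral_cong_right finite_splits) (auto simp: splits_def)
    then show ?thesis using True by simp
  next
    case False
    then have "(\<Sum>(T1, T2)\<in>splits T. of_bool (S = T1) * of_bool (S' = T2) :: real) = 0"
      by (intro sum.neutral) (auto simp: splits_def)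
    then show ?thesis using False by simp
  qed
  have L: "(\<Sum>u\<in>left_part l. vweight \<alpha> G u * of_bool (vtype u = S)) = W_L * share_L S" for S
    unfolding left_mass share_L_def using assms by simp
  have R: "(\<Sum>u\<in>right_part r. vweight \<beta> G u * of_bool (vtype u = S)) = W_R * share_R S" for S
    unfolding right_mass share_R_def using assms by simp
  have "(\<Sum>(u, v)\<in>left_part l \<times> right_part r. vweight \<alpha> G u * vweight \<beta> G v * of_bool (merge_types (vtype u) (vtype v) = T)) =
    (\<Sum>p\<in>left_part l \<times> right_part r. \<Sum>q\<in>splits T.
        (vweight \<alpha> G (fst p) * of_bool (vtype (fst p) = fst q)) * (vweight \<beta> G (snd p) * of_bool (vtype (snd p) = snd q)))"
    unfolding case_prod_unfold split sum_distrib_left by (intro sum.cong refl) (simp only: mult_ac)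
  also have "\<dots> = (\<Sum>(T1, T2)\<in>splits T. \<Sum>(u, v)\<in>left_part l \<times> right_part r.
        (vweight \<alpha> G u * of_bool (vtype u = T1)) * (vweight \<beta> G v * of_bool (vtype v = T2)))"
    unfolding case_prod_unfold by (rule sum.swap)
  also have "\<dots> = (\<Sum>(T1, T2)\<in>splits T. (W_L * share_L T1) * (W_R * share_R T2))"
    unfolding sum.cartesian_product[symmetric] sum_product[symmetric] L R ..
  also have "\<dots> = W_L * W_R * (\<Sum>(T1, T2)\<in>splits T. share_L T1 * share_R T2)"
    by (simp add: sum_distrib_left case_prod_unfold mult_ac)
  finally have 1: "(\<Sum>(u, v)\<in>left_part l \<times> right_part r. vweight \<alpha> G u * vweight \<beta> G v * of_bool (merge_types (vtype u) (vtype v) = T)) =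
    W_L * W_R * (\<Sum>(T1, T2)\<in>splits T. share_L T1 * share_R T2)" .
  have 2: "(\<Sum>(u, v)\<in>left_part l \<times> right_part r. vweight \<alpha> G u * vweight \<beta> G v * of_bool (vtype u = T)) = W_L * W_R * share_L T"
  proof -
    have "(\<Sum>(u, v)\<in>left_part l \<times> right_part r. vweight \<alpha> G u * vweight \<beta> G v * of_bool (vtype u = T)) =
      (\<Sum>u\<in>left_part l. vweight \<alpha> G u * of_bool (vtype u = T)) * (\<Sum>v\<in>right_part r. vweight \<beta> G v)"
      unfolding sum_product sum.cartesian_product by (simp add: mult_ac)
    then show ?thesis unfolding L W_sum by simp
  qed
  have 3: "(\<Sum>(u, v)\<in>left_part l \<times> right_part r. vweight \<alpha> G u * vweight \<beta> G v * of_bool (vtype v = T)) = W_L * W_R * share_R T"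
  proof -
    have "(\<Sum>(u, v)\<in>left_part l \<times> right_part r. vweight \<alpha> G u * vweight \<beta> G v * of_bool (vtype v = T)) =
      (\<Sum>u\<in>left_part l. vweight \<alpha> G u) * (\<Sum>v\<in>right_part r. vweight \<beta> G v * of_bool (vtype v = T))"
      unfolding sum_product sum.cartesian_product by (simp add: mult_ac)
    then show ?thesis unfolding R W_sum by simp
  qed
  have "(\<Sum>(u, v)\<in>left_part l \<times> right_part r. vweight \<alpha> G u * vweight \<beta> G v * merge_effect T u v) =
    (\<Sum>(u, v)\<in>left_part l \<times> right_part r. vweight \<alpha> G u * vweight \<beta> G v * of_bool (merge_types (vtype u) (vtype v) = T)) -
    (\<Sum>(u, v)\<in>left_part l \<times> right_part r. vweight \<alpha> G u * vweight \<beta> G v * of_bool (vtype u = T)) -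
    (\<Sum>(u, v)\<in>left_part l \<times> right_part r. vweight \<alpha> G u * vweight \<beta> G v * of_bool (vtype v = T))"
    unfolding merge_effect_def sum_subtractf[symmetric] by (simp add: case_prod_unfold right_diff_distrib)
  then show ?thesis unfolding 1 2 3 drift_def by (simp add: algebra_simps)
qed

lemma drift_bound:
  assumes "0 < W_L" "0 < W_R"
  shows "\<bar>drift T\<bar> \<le> 2"
proof -
  have "\<bar>W_L * W_R * drift T\<bar> \<le> (\<Sum>(u, v)\<in>left_part l \<times> right_part r. vweight \<alpha> G u * vweight \<beta> G v * 2)"
    unfolding merge_effect_sum[OF assms, symmetric] case_prod_unfold
    by (intro order_trans[OF sum_abs] sum_mono)
      (simp only: abs_mult abs_of_nonneg[OF vweight_nonneg(1)] abs_of_nonneg[OF vweight_nonneg(2)],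
       intro mult_left_mono merge_effect_bound vweight_prod_nonneg)
  also have "\<dots> = W_L * W_R * 2"
    unfolding W_prod by (simp add: sum_distrib_right case_prod_unfold)
  finally show ?thesis using assms by (simp add: abs_mult)
qed

definition count_change :: "ctype \<Rightarrow> vertex \<Rightarrow> vertex \<Rightarrow> real" where
  "count_change T u v = real (count_type l r (insert {u, v} G) T) - real (count_type l r G T)"

lemma available_if_different:
  assumes "u \<in> left_part l" "v \<in> right_part r" "component G u \<noteq> component G v"
  shows "(u, v) \<in> available_pairs l r G"
  using assms component_edge[of u G u v] component_eq_iff[of G u v] by (auto simp: available_pairs_def)

text \<open>\<open>merge_effect\<close> is wrong only if u and v lie in the same component. When it
  is wrong, the right vertices of that component weigh at most
  \<open>right_weight \<beta> T\<close>, so the total error is of order \<open>W_L\<close> instead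
  of \<open>W_L * W_R\<close>.\<close>

lemma count_change_sum:
  assumes "0 < W_L" "0 < W_R"
  shows "\<bar>(\<Sum>(u, v)\<in>available_pairs l r G. vweight \<alpha> G u * vweight \<beta> G v * count_change T u v) - W_L * W_R * drift T\<bar>
    \<le> 2 * right_weight \<beta> T * W_L"
proof -
  obtain a b e where T: "T = (a, b, e)" by (cases T) auto
  \<comment> \<open>Only the two coordinates that enter the right weight are tested. If one of them
    exceeds that of T, then neither the component nor what it becomes can have type T.\<close>
  define small where "small u \<longleftrightarrow> fst (snd (vtype u)) \<le> b \<and> snd (snd (vtype u)) \<le> e" for u
  define D where "D u v = of_bool ((u, v) \<in> available_pairs l r G) * count_change T u v - merge_effect T u v" for u v
  have DD: "\<bar>D u v\<bar> \<le> 2 * of_bool (component G u = component G v \<and> small u)"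
    if uv: "u \<in> left_part l" "v \<in> right_part r" for u v
  proof (cases "component G u = component G v")
    case False
    have av: "(u, v) \<in> available_pairs l r G" using available_if_different[OF uv False] .
    then have "{u, v} \<notin> G" by (auto simp: available_pairs_def)
    from count_type_insert[OF this uv, of T] False av show ?thesis
      by (simp add: D_def count_change_def merge_effect_def)
  next
    case True
    obtain a' b' e' where V: "vtype u = (a', b', e')" by (cases "vtype u") auto
    have V2: "vtype v = (a', b', e')" using V True by simp
    have D: "D u v = (if (u, v) \<in> available_pairs l r G then of_bool ((a', b', Suc e') = T) - of_bool ((a', b', e') = T) else 0)
        - (of_bool ((a' + a', b' + b', Suc (e' + e')) = T) - of_bool ((a', b', e') = T) - of_bool ((a', b', e') = T))"
    proof (cases "(u, v) \<in> available_pairs l r G")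
      case av: True
      then have "{u, v} \<notin> G" by (auto simp: available_pairs_def)
      from count_type_insert[OF this uv, of T] True av V V2 show ?thesis
        by (simp add: D_def count_change_def merge_effect_def merge_types_def)
    next
      case False
      then show ?thesis using V V2 by (simp add: D_def merge_effect_def merge_types_def)
    qed
    show ?thesis
    proof (cases "small u")
      case sm: True
      show ?thesis unfolding D using True sm by (auto simp: of_bool_def)
    next
      case False
      then have "D u v = 0" unfolding D T using V by (auto simp: small_def)
      then show ?thesis by simp
    qed
  qed
  have "(\<Sum>(u, v)\<in>available_pairs l r G. vweight \<alpha> G u * vweight \<beta> G v * count_change T u v) =
     (\<Sum>(u, v)\<in>left_part l \<times> right_part r. vweight \<alpha> G u * vweight \<beta> G v * (of_bool ((u, v) \<in> available_pairs l r G) * count_change T u v))"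
    using available_subset by (intro sum.mono_neutral_cong_left) auto
  then have "(\<Sum>(u, v)\<in>available_pairs l r G. vweight \<alpha> G u * vweight \<beta> G v * count_change T u v) - W_L * W_R * drift T =
    (\<Sum>(u, v)\<in>left_part l \<times> right_part r. vweight \<alpha> G u * vweight \<beta> G v * D u v)"
    unfolding merge_effect_sum[OF assms, symmetric] D_def
    by (simp add: sum_subtractf[symmetric] case_prod_unfold right_diff_distrib)
  also have "\<bar>\<dots>\<bar> \<le> (\<Sum>(u, v)\<in>left_part l \<times> right_part r.
      vweight \<alpha> G u * vweight \<beta> G v * (2 * of_bool (component G u = component G v \<and> small u)))"
    unfolding case_prod_unfold
    by (intro order_trans[OF sum_abs] sum_mono)
      (simp only: abs_mult abs_of_nonneg[OF vweight_nonneg(1)] abs_of_nonneg[OF vweight_nonneg(2)],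
       intro mult_left_mono DD vweight_prod_nonneg, auto)
  also have "\<dots> = (\<Sum>u\<in>left_part l. 2 * vweight \<alpha> G u * of_bool (small u) *
      (\<Sum>v\<in>right_part r. vweight \<beta> G v * of_bool (component G u = component G v)))"
    unfolding sum.cartesian_product[symmetric] sum_distrib_left by (intro sum.cong refl) (auto simp: of_bool_def)
  also have "\<dots> \<le> (\<Sum>u\<in>left_part l. 2 * vweight \<alpha> G u * right_weight \<beta> T)"
  proof (rule sum_mono)
    fix u assume u: "u \<in> left_part l"
    have C: "component G u \<in> components l r G" using u by (auto simp: components_eq vertices_def)
    have "(\<Sum>v\<in>right_part r. vweight \<beta> G v * of_bool (component G u = component G v)) =
        (\<Sum>v\<in>component G u \<inter> right_part r. vweight \<beta> G v)"
      using component_eq_iff[of G u] by (intro sum.mono_neutral_cong_right) auto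
    also have "\<dots> = right_weight \<beta> (vtype u)" by (rule right_component_weight[OF C])
    finally have "of_bool (small u) * (\<Sum>v\<in>right_part r. vweight \<beta> G v * of_bool (component G u = component G v)) \<le> right_weight \<beta> T"
      using \<beta>_pos unfolding small_def right_weight_def T
      by (cases "vtype u") (auto simp: of_bool_def intro!: add_mono mult_left_mono)
    then have "(2 * vweight \<alpha> G u) * (of_bool (small u) * (\<Sum>v\<in>right_part r. vweight \<beta> G v * of_bool (component G u = component G v)))
       \<le> (2 * vweight \<alpha> G u) * right_weight \<beta> T"
      using vweight_pos(1)[of u] by (intro mult_left_mono) auto
    then show "2 * vweight \<alpha> G u * of_bool (small u) *
      (\<Sum>v\<in>right_part r. vweight \<beta> G v * of_bool (component G u = component G v)) \<le> 2 * vweight \<alpha> G u * right_weight \<beta> T"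
      by (simp add: mult.assoc)
  qed
  also have "\<dots> = 2 * right_weight \<beta> T * W_L"
    unfolding W_sum[symmetric] sum_distrib_left by (simp add: mult_ac)
  finally show ?thesis .
qed

lemma count_change_bound:
  assumes "(u, v) \<in> available_pairs l r G"
  shows "\<bar>count_change T u v\<bar> \<le> 2"
proof -
  have "{u, v} \<notin> G" "u \<in> left_part l" "v \<in> right_part r" using assms by (auto simp: available_pairs_def)
  from count_type_insert[OF this, of T] show ?thesis
    by (simp add: count_change_def)
qed

text \<open>Two errors add up: pairs inside one component, by \<open>count_change_sum\<close>, and
  the normalization by Z in place of \<open>W_L * W_R\<close>. The second costs at most 2, the bound
  for the drift, times the weight of the adjacent pairs.\<close>

lemma expected_change:
  assumes "0 < W_L" "0 < W_R" "0 < Z"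
  shows "\<bar>measure_pmf.expectation (add_random_edge l r \<alpha> \<beta> G) (\<lambda>H. real (count_type l r H T) - real (count_type l r G T)) - drift T\<bar>
    \<le> (2 * right_weight \<beta> T * W_L + (\<Sum>u\<in>left_part l. vweight \<alpha> G u ^ 3) + (\<Sum>v\<in>right_part r. vweight \<beta> G v ^ 3)) / Z"
proof -
  have ne: "available_pairs l r G \<noteq> {}" using assms(3) by (auto simp: Z_def)
  let ?S = "(\<Sum>(u, v)\<in>available_pairs l r G. vweight \<alpha> G u * vweight \<beta> G v * count_change T u v)"
  have "measure_pmf.expectation (add_random_edge l r \<alpha> \<beta> G) (\<lambda>H. real (count_type l r H T) - real (count_type l r G T)) = ?S / Z"
    unfolding expectation_add_random_edge[OF ne] count_change_def ..
  moreover have "?S / Z - drift T = (?S - W_L * W_R * drift T) / Z + (W_L * W_R - Z) * drift T / Z"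
    using assms(3) by (simp add: field_simps)
  moreover have "\<bar>(?S - W_L * W_R * drift T) / Z\<bar> \<le> 2 * right_weight \<beta> T * W_L / Z"
    using count_change_sum[OF assms(1,2)] assms(3) by (simp add: divide_right_mono)
  moreover have "\<bar>(W_L * W_R - Z) * drift T / Z\<bar> \<le> ((\<Sum>u\<in>left_part l. vweight \<alpha> G u ^ 3) + (\<Sum>v\<in>right_part r. vweight \<beta> G v ^ 3)) / Z"
  proof -
    have "\<bar>(W_L * W_R - Z) * drift T\<bar> \<le> (W_L * W_R - Z) * 2"
      unfolding abs_mult using Z_le drift_bound[OF assms(1,2)] by (intro mult_mono) auto
    also have "\<dots> \<le> (\<Sum>u\<in>left_part l. vweight \<alpha> G u ^ 3) + (\<Sum>v\<in>right_part r. vweight \<beta> G v ^ 3)"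
      using rejection_le by simp
    finally show ?thesis using assms(3) by (simp add: divide_right_mono)
  qed
  moreover have "(x + y + z) / Z = x / Z + (y + z) / Z" for x y z
    by (simp add: add_divide_distrib)
  ultimately show ?thesis by (simp only:)
qed

end

section \<open>The process\<close>

lemma discrete_gronwall:
  fixes x :: "nat \<Rightarrow> real"
  assumes "0 \<le> a" "0 \<le> b" "0 \<le> x 0" and step: "\<And>t. t < m \<Longrightarrow> x (Suc t) \<le> (1 + a) * x t + b"
    and "t \<le> m"
  shows "x t \<le> exp (a * real t) * (x 0 + real t * b)"
  using \<open>t \<le> m\<close>
proof (induction t)
  case (Suc t)
  have e: "1 \<le> exp (a * real (Suc t))" using assms by simp
  have nn: "0 \<le> x 0 + real t * b" using assms by simp
  have "x (Suc t) \<le> (1 + a) * x t + b" using step Suc by simp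
  also have "\<dots> \<le> (1 + a) * (exp (a * real t) * (x 0 + real t * b)) + b"
    using Suc assms by (intro add_right_mono mult_left_mono) auto
  also have "\<dots> \<le> exp a * (exp (a * real t) * (x 0 + real t * b)) + exp (a * real (Suc t)) * b"
    using exp_ge_add_one_self[of a] nn assms e mult_right_mono[OF e assms(2)]
    by (intro add_mono mult_right_mono mult_nonneg_nonneg) auto
  also have "\<dots> = exp (a * real (Suc t)) * (x 0 + real (Suc t) * b)"
    by (simp add: algebra_simps exp_add)
  finally show ?case .
qed simp

lemma finite_bipartite_graphs: "finite {G. bipartite l r G}"
proof (rule finite_subset)
  show "{G. bipartite l r G} \<subseteq> Pow ((\<lambda>(u, v). {u, v}) ` (left_part l \<times> right_part r))"
    unfolding bipartite_def by (auto simp: image_iff)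
qed auto

lemma bipartite_insert: "bipartite l r G \<Longrightarrow> (u, v) \<in> available_pairs l r G \<Longrightarrow> bipartite l r (insert {u, v} G)"
  by (auto simp: bipartite_def available_pairs_def)

context weighted_graph
begin

lemma set_add_random_edge:
  "set_pmf (add_random_edge l r \<alpha> \<beta> G) \<subseteq>
     (if available_pairs l r G = {} then {G} else (\<lambda>(u, v). insert {u, v} G) ` available_pairs l r G)"
proof (cases "available_pairs l r G = {}")
  case False
  have "0 < pair_weight \<alpha> \<beta> G x" for x
    using vweight_pos by (auto simp: pair_weight_def vweight_def split: prod.split)
  note pmf = pmf_proportional_pmf[OF finite_available False this]
  have "set_pmf (proportional_pmf (pair_weight \<alpha> \<beta> G) (available_pairs l r G)) \<subseteq> available_pairs l r G"
    using pmf by (auto simp: set_pmf_iff split: if_splits)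
  then show ?thesis using False by (auto simp: add_random_edge_def)
qed (simp add: add_random_edge_def)

lemma available_nonempty: "card G < l * r \<Longrightarrow> available_pairs l r G \<noteq> {}"
proof
  assume "card G < l * r" "available_pairs l r G = {}"
  then have "0 < \<alpha> * \<beta> * (real l * real r - real (card G))"
    using \<alpha>_pos \<beta>_pos by (intro mult_pos_pos) (auto simp flip: of_nat_mult)
  then show False using Z_lower \<open>available_pairs l r G = {}\<close> by (simp add: Z_def)
qed

lemma Z_pos: "available_pairs l r G \<noteq> {} \<Longrightarrow> 0 < Z"
  unfolding Z_def case_prod_unfold by (intro sum_pos mult_pos_pos vweight_pos) auto

lemma card_insert_available: "(u, v) \<in> available_pairs l r G \<Longrightarrow> card (insert {u, v} G) = Suc (card G)"
  by (simp add: available_pairs_def)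

lemma finite_set_add_random_edge: "finite (set_pmf (add_random_edge l r \<alpha> \<beta> G))"
  by (rule finite_subset[OF set_add_random_edge]) auto

text \<open>A vertex of weight x is hit with probability at most x times the opposite total weight
  over Z, and its cube then grows by (x + 1)^3 - x^3. The product x ((x + 1)^3 - x^3) is again at
  most a constant times x^3, which gives a relative growth.\<close>

lemma cube_sum_step:
  assumes "available_pairs l r G \<noteq> {}"
  shows "measure_pmf.expectation (add_random_edge l r \<alpha> \<beta> G) (\<lambda>H. \<Sum>u\<in>left_part l. vweight \<alpha> H u ^ 3)
      \<le> (\<Sum>u\<in>left_part l. vweight \<alpha> G u ^ 3) * (1 + (3 + 3 / \<alpha> + 1 / \<alpha> ^ 2) * W_R / Z)" (is ?L)
    and "measure_pmf.expectation (add_random_edge l r \<alpha> \<beta> G) (\<lambda>H. \<Sum>v\<in>right_part r. vweight \<beta> H v ^ 3)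
      \<le> (\<Sum>v\<in>right_part r. vweight \<beta> G v ^ 3) * (1 + (3 + 3 / \<beta> + 1 / \<beta> ^ 2) * W_L / Z)" (is ?R)
proof -
  let ?A = "available_pairs l r G"
  note Z = Z_pos[OF assms]
  \<comment> \<open>The left side is 3 x^3 + 3 x^2 + x, and for x \<ge> k the last two terms are at
    most 3 / k and 1 / k^2 times x^3.\<close>
  have inc: "x * ((x + 1) ^ 3 - x ^ 3) \<le> (3 + 3 / k + 1 / k ^ 2) * x ^ 3" if "0 < k" "k \<le> x" for x k :: real
  proof -
    have "1 \<le> x / k" using that by simp
    then have "x \<le> x * (x / k)" "1 * 1 \<le> (x / k) * (x / k)"
      using mult_left_mono[of 1 "x / k" x] mult_mono[of 1 "x / k" 1 "x / k"] less_le_trans[OF that] by auto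
    then have "3 * x + 1 \<le> 3 * (x * (x / k)) + (x / k) * (x / k)" by linarith
    also have "\<dots> = (3 / k + 1 / k ^ 2) * x ^ 2" by (simp add: power2_eq_square distrib_right)
    finally have "3 * x + 1 \<le> (3 / k + 1 / k ^ 2) * x ^ 2" .
    moreover have "(x + 1) ^ 3 - x ^ 3 = 3 * x ^ 2 + (3 * x + 1)"
      by (simp add: power3_eq_cube power2_eq_square algebra_simps)
    ultimately have "(x + 1) ^ 3 - x ^ 3 \<le> (3 + 3 / k + 1 / k ^ 2) * x ^ 2"
      by (simp add: algebra_simps)
    then have "x * ((x + 1) ^ 3 - x ^ 3) \<le> x * ((3 + 3 / k + 1 / k ^ 2) * x ^ 2)"
      using that by (intro mult_left_mono) auto
    then show ?thesis by (simp add: power3_eq_cube power2_eq_square mult_ac)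
  qed
  have upd: "vweight k (insert {u, v} G) x = vweight k G x + (if x = u \<or> x = v then 1 else 0)"
    if "(u, v) \<in> ?A" for u v x k
    using that degree_insert[of u v] by (auto simp: vweight_def available_pairs_def)
  \<comment> \<open>The increments g are nonnegative, so the sum over the available pairs may be
    extended to all pairs, where it can be factorized.\<close>
  have general: "measure_pmf.expectation (add_random_edge l r \<alpha> \<beta> G) f \<le> S + X / Z"
    if f: "\<And>u v. (u, v) \<in> ?A \<Longrightarrow> f (insert {u, v} G) = S + g u v"
      and g: "\<And>u v. 0 \<le> g u v"
      and X: "(\<Sum>(u, v)\<in>left_part l \<times> right_part r. vweight \<alpha> G u * vweight \<beta> G v * g u v) \<le> X"
    for f S g X
  proof -
    have "(\<Sum>(u, v)\<in>?A. vweight \<alpha> G u * vweight \<beta> G v * f (insert {u, v} G)) =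
       (\<Sum>(u, v)\<in>?A. vweight \<alpha> G u * vweight \<beta> G v * S + vweight \<alpha> G u * vweight \<beta> G v * g u v)"
      by (intro sum.cong refl) (auto simp: f algebra_simps)
    also have "\<dots> = Z * S + (\<Sum>(u, v)\<in>?A. vweight \<alpha> G u * vweight \<beta> G v * g u v)"
      by (simp add: case_prod_unfold sum.distrib sum_distrib_right Z_def)
    also have "(\<Sum>(u, v)\<in>?A. vweight \<alpha> G u * vweight \<beta> G v * g u v) \<le>
       (\<Sum>(u, v)\<in>left_part l \<times> right_part r. vweight \<alpha> G u * vweight \<beta> G v * g u v)"
      unfolding case_prod_unfold using g
      by (intro sum_mono2 available_subset mult_nonneg_nonneg vweight_nonneg) auto
    also have "\<dots> \<le> X" by (rule X)
    finally have "(\<Sum>(u, v)\<in>?A. vweight \<alpha> G u * vweight \<beta> G v * f (insert {u, v} G)) / Z \<le> (Z * S + X) / Z"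
      using Z by (intro divide_right_mono) auto
    then show ?thesis
      unfolding expectation_add_random_edge[OF assms] using Z by (simp add: add_divide_distrib)
  qed
  have "measure_pmf.expectation (add_random_edge l r \<alpha> \<beta> G) (\<lambda>H. \<Sum>u\<in>left_part l. vweight \<alpha> H u ^ 3)
    \<le> (\<Sum>u\<in>left_part l. vweight \<alpha> G u ^ 3) + (3 + 3 / \<alpha> + 1 / \<alpha> ^ 2) * W_R * (\<Sum>u\<in>left_part l. vweight \<alpha> G u ^ 3) / Z"
  proof (rule general[where g = "\<lambda>u v. (vweight \<alpha> G u + 1) ^ 3 - vweight \<alpha> G u ^ 3"])
    fix u v assume uv: "(u, v) \<in> ?A"
    have "(\<Sum>x\<in>left_part l. vweight \<alpha> (insert {u, v} G) x ^ 3) =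
      (\<Sum>x\<in>left_part l. vweight \<alpha> G x ^ 3 + (if x = u then (vweight \<alpha> G u + 1) ^ 3 - vweight \<alpha> G u ^ 3 else 0))"
      using uv parts_disjoint[of l r] by (intro sum.cong refl) (auto simp: upd[OF uv] available_pairs_def)
    also have "\<dots> = (\<Sum>u\<in>left_part l. vweight \<alpha> G u ^ 3) + ((vweight \<alpha> G u + 1) ^ 3 - vweight \<alpha> G u ^ 3)"
      unfolding sum.distrib using uv by (auto simp: available_pairs_def)
    finally show "(\<Sum>x\<in>left_part l. vweight \<alpha> (insert {u, v} G) x ^ 3) =
      (\<Sum>u\<in>left_part l. vweight \<alpha> G u ^ 3) + ((vweight \<alpha> G u + 1) ^ 3 - vweight \<alpha> G u ^ 3)" .
  next
    fix u v show "0 \<le> (vweight \<alpha> G u + 1) ^ 3 - vweight \<alpha> G u ^ 3"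
      using vweight_nonneg(1)[of u] by (simp add: power_mono)
  next
    have "(\<Sum>(u, v)\<in>left_part l \<times> right_part r. vweight \<alpha> G u * vweight \<beta> G v * ((vweight \<alpha> G u + 1) ^ 3 - vweight \<alpha> G u ^ 3)) =
      (\<Sum>u\<in>left_part l. vweight \<alpha> G u * ((vweight \<alpha> G u + 1) ^ 3 - vweight \<alpha> G u ^ 3)) * W_R"
      unfolding W_sum[symmetric] sum_product sum.cartesian_product by (simp add: mult_ac)
    also have "\<dots> \<le> (\<Sum>u\<in>left_part l. (3 + 3 / \<alpha> + 1 / \<alpha> ^ 2) * vweight \<alpha> G u ^ 3) * W_R"
      by (intro mult_right_mono sum_mono inc \<alpha>_pos vweight_pos W_nonneg)
    also have "\<dots> = (3 + 3 / \<alpha> + 1 / \<alpha> ^ 2) * W_R * (\<Sum>u\<in>left_part l. vweight \<alpha> G u ^ 3)"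
      by (simp add: sum_distrib_left[symmetric])
    finally show "(\<Sum>(u, v)\<in>left_part l \<times> right_part r. vweight \<alpha> G u * vweight \<beta> G v * ((vweight \<alpha> G u + 1) ^ 3 - vweight \<alpha> G u ^ 3))
      \<le> (3 + 3 / \<alpha> + 1 / \<alpha> ^ 2) * W_R * (\<Sum>u\<in>left_part l. vweight \<alpha> G u ^ 3)" .
  qed
  then show ?L by (simp add: algebra_simps)
  have "measure_pmf.expectation (add_random_edge l r \<alpha> \<beta> G) (\<lambda>H. \<Sum>u\<in>right_part r. vweight \<beta> H u ^ 3)
    \<le> (\<Sum>u\<in>right_part r. vweight \<beta> G u ^ 3) + (3 + 3 / \<beta> + 1 / \<beta> ^ 2) * W_L * (\<Sum>u\<in>right_part r. vweight \<beta> G u ^ 3) / Z"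
  proof (rule general[where g = "\<lambda>u v. (vweight \<beta> G v + 1) ^ 3 - vweight \<beta> G v ^ 3"])
    fix u v assume uv: "(u, v) \<in> ?A"
    have "(\<Sum>x\<in>right_part r. vweight \<beta> (insert {u, v} G) x ^ 3) =
      (\<Sum>x\<in>right_part r. vweight \<beta> G x ^ 3 + (if x = v then (vweight \<beta> G v + 1) ^ 3 - vweight \<beta> G v ^ 3 else 0))"
      using uv parts_disjoint[of l r] by (intro sum.cong refl) (auto simp: upd[OF uv] available_pairs_def)
    also have "\<dots> = (\<Sum>u\<in>right_part r. vweight \<beta> G u ^ 3) + ((vweight \<beta> G v + 1) ^ 3 - vweight \<beta> G v ^ 3)"
      unfolding sum.distrib using uv by (auto simp: available_pairs_def)
    finally show "(\<Sum>x\<in>right_part r. vweight \<beta> (insert {u, v} G) x ^ 3) =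
      (\<Sum>u\<in>right_part r. vweight \<beta> G u ^ 3) + ((vweight \<beta> G v + 1) ^ 3 - vweight \<beta> G v ^ 3)" .
  next
    fix u v show "0 \<le> (vweight \<beta> G v + 1) ^ 3 - vweight \<beta> G v ^ 3"
      using vweight_nonneg(2)[of v] by (simp add: power_mono)
  next
    have "(\<Sum>(u, v)\<in>left_part l \<times> right_part r. vweight \<alpha> G u * vweight \<beta> G v * ((vweight \<beta> G v + 1) ^ 3 - vweight \<beta> G v ^ 3)) =
      W_L * (\<Sum>u\<in>right_part r. vweight \<beta> G u * ((vweight \<beta> G u + 1) ^ 3 - vweight \<beta> G u ^ 3))"
      unfolding W_sum[symmetric] sum_product sum.cartesian_product by (simp add: mult_ac)
    also have "\<dots> \<le> W_L * (\<Sum>u\<in>right_part r. (3 + 3 / \<beta> + 1 / \<beta> ^ 2) * vweight \<beta> G u ^ 3)"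
      by (intro mult_left_mono sum_mono inc \<beta>_pos vweight_pos W_nonneg)
    also have "\<dots> = (3 + 3 / \<beta> + 1 / \<beta> ^ 2) * W_L * (\<Sum>u\<in>right_part r. vweight \<beta> G u ^ 3)"
      by (simp add: sum_distrib_left[symmetric])
    finally show "(\<Sum>(u, v)\<in>left_part l \<times> right_part r. vweight \<alpha> G u * vweight \<beta> G v * ((vweight \<beta> G v + 1) ^ 3 - vweight \<beta> G v ^ 3))
      \<le> (3 + 3 / \<beta> + 1 / \<beta> ^ 2) * W_L * (\<Sum>u\<in>right_part r. vweight \<beta> G u ^ 3)" .
  qed
  then show ?R by (simp add: algebra_simps)
qed

end

section \<open>Expectations along the process\<close>

locale process =
  fixes l r :: nat and \<alpha> \<beta> :: real
  assumes \<alpha>_pos: "0 < \<alpha>" and \<beta>_pos: "0 < \<beta>"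
begin

abbreviation expect :: "nat \<Rightarrow> (graph \<Rightarrow> real) \<Rightarrow> real" where
  "expect t f \<equiv> measure_pmf.expectation (graph_process l r \<alpha> \<beta> t) f"

abbreviation expect_step :: "graph \<Rightarrow> (graph \<Rightarrow> real) \<Rightarrow> real" where
  "expect_step G f \<equiv> measure_pmf.expectation (add_random_edge l r \<alpha> \<beta> G) f"

lemma weighted_graphI: "bipartite l r G \<Longrightarrow> weighted_graph l r G \<alpha> \<beta>"
  using \<alpha>_pos \<beta>_pos by unfold_locales

text \<open>No step is idle before all l r pairs are used, so until then the number of edges equals
  the time.\<close>

lemma reachable:
  assumes "G \<in> set_pmf (graph_process l r \<alpha> \<beta> t)"
  shows "bipartite l r G \<and> (t \<le> l * r \<longrightarrow> card G = t)"
  using assms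
proof (induction t arbitrary: G)
  case 0
  then show ?case by (simp add: bipartite_def)
next
  case (Suc t)
  then obtain H where H: "H \<in> set_pmf (graph_process l r \<alpha> \<beta> t)" "G \<in> set_pmf (add_random_edge l r \<alpha> \<beta> H)"
    by auto
  interpret weighted_graph l r H \<alpha> \<beta> using Suc.IH[OF H(1)] by (intro weighted_graphI) simp
  consider "G = H" "available_pairs l r H = {}" |
    u v where "(u, v) \<in> available_pairs l r H" "G = insert {u, v} H"
  proof (cases "available_pairs l r H = {}")
    case True
    then show ?thesis using that(1) set_add_random_edge H(2) by auto
  next
    case False
    then have "G \<in> (\<lambda>(u, v). insert {u, v} H) ` available_pairs l r H"
      using set_add_random_edge H(2) by auto
    then obtain p where "p \<in> available_pairs l r H" "G = (\<lambda>(u, v). insert {u, v} H) p" by blast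
    then show ?thesis using that(2)[of "fst p" "snd p"] by (simp add: case_prod_unfold)
  qed
  then show ?case
  proof cases
    case 1
    then show ?thesis using Suc.IH[OF H(1)] available_nonempty by auto
  next
    case 2
    then show ?thesis using Suc.IH[OF H(1)] bipartite_insert[OF bip 2(1)] card_insert_available[OF 2(1)] by auto
  qed
qed

lemma finite_reachable: "finite (set_pmf (graph_process l r \<alpha> \<beta> t))"
  by (rule finite_subset[OF _ finite_bipartite_graphs]) (use reachable in auto)

lemma integrable_expect [simp]: "integrable (measure_pmf (graph_process l r \<alpha> \<beta> t)) (f :: graph \<Rightarrow> real)"
  by (rule integrable_measure_pmf_finite[OF finite_reachable])

lemma expect_mono:
  assumes "\<And>G. G \<in> set_pmf (graph_process l r \<alpha> \<beta> t) \<Longrightarrow> f G \<le> g G"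
  shows "expect t f \<le> expect t g"
  by (rule integral_mono_AE) (use assms in \<open>auto simp: AE_measure_pmf_iff\<close>)

lemma expect_Suc: "expect (Suc t) f = expect t (\<lambda>G. expect_step G f)"
proof -
  let ?A = "set_pmf (graph_process l r \<alpha> \<beta> t)"
  have fin: "finite (set_pmf (add_random_edge l r \<alpha> \<beta> G))" if "G \<in> ?A" for G
    using weighted_graph.finite_set_add_random_edge[OF weighted_graphI] reachable[OF that] by auto
  have "expect (Suc t) f = (\<Sum>G\<in>?A. pmf (graph_process l r \<alpha> \<beta> t) G *\<^sub>R expect_step G f)"
    unfolding graph_process.simps by (rule pmf_expectation_bind[OF finite_reachable fin order_refl])
  also have "\<dots> = expect t (\<lambda>G. expect_step G f)"
    by (rule integral_measure_pmf[symmetric, OF finite_reachable])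
  finally show ?thesis .
qed

end

section \<open>The limit equation for the type counts\<close>

context limit_params
begin

text \<open>Types with a cycle get density 0. The condition is written with \<open>Suc e\<close>
  because truncated subtraction would also admit the type (0, 0, 0).\<close>

definition density :: "ctype \<Rightarrow> real \<Rightarrow> real" where
  "density T s = (case T of (a, b, e) \<Rightarrow> if Suc e = a + b then tree_density s a b else 0)"

definition limit_share_L :: "ctype \<Rightarrow> real \<Rightarrow> real" where
  "limit_share_L T s = left_weight \<alpha> T * density T s / (s + \<alpha> * l)"

definition limit_share_R :: "ctype \<Rightarrow> real \<Rightarrow> real" where
  "limit_share_R T s = right_weight \<beta> T * density T s / (s + \<beta> * r)"

definition limit_drift :: "ctype \<Rightarrow> real \<Rightarrow> real" where
  "limit_drift T s = (\<Sum>(T1, T2)\<in>splits T. limit_share_L T1 s * limit_share_R T2 s) - limit_share_L T s - limit_share_R T s"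

lemma forest_range: "0 \<le> s \<Longrightarrow> 0 \<le> forest s i j a b" "0 \<le> s \<Longrightarrow> forest s i j a b \<le> 1"
proof -
  assume s: "0 \<le> s"
  interpret two_type_tree "\<alpha> + 1" "\<beta> + 1" "s / (s + \<alpha> * l)" "s / (s + \<beta> * r)"
    by (rule tree_instance[OF s])
  show "0 \<le> forest s i j a b" by (simp add: forest_def forest_prob_nonneg)
  have "forest_prob i j a b = (\<Sum>x\<in>{a}. forest_prob i j x (a + b - x))" by simp
  also have "\<dots> \<le> forest_size_prob i j (a + b)"
    unfolding forest_size_prob_def by (rule sum_mono2) (auto simp: forest_prob_nonneg)
  also have "\<dots> \<le> (\<Sum>n\<le>a + b. forest_size_prob i j n)"
    by (rule member_le_sum) (auto simp: forest_size_prob_nonneg)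
  also have "\<dots> \<le> 1"
    using partial_sums_le_supersolution[of 1 1 i j "a + b"] by simp
  finally show "forest s i j a b \<le> 1" by (simp add: forest_def)
qed

lemma limit_share_eq:
  assumes "0 \<le> s"
  shows "limit_share_L (a, b, e) s = (if Suc e = a + b then forest s 1 0 a b else 0)"
    and "limit_share_R (a, b, e) s = (if Suc e = a + b then forest s 0 1 a b else 0)"
proof -
  have "real (a + b - 1) = real e" "0 < a + b" if "Suc e = a + b"
    unfolding that[symmetric] by auto
  then show "limit_share_L (a, b, e) s = (if Suc e = a + b then forest s 1 0 a b else 0)"
    "limit_share_R (a, b, e) s = (if Suc e = a + b then forest s 0 1 a b else 0)"
    using forest_left_root[OF assms, of a b] forest_right_root[OF assms, of a b]
    by (simp_all add: limit_share_L_def limit_share_R_def density_def left_weight_def right_weight_def del: of_nat_add)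
qed

lemma limit_share_range:
  assumes "0 \<le> s"
  shows "0 \<le> limit_share_L T s" "limit_share_L T s \<le> 1" "0 \<le> limit_share_R T s" "limit_share_R T s \<le> 1"
  using forest_range[OF assms] by (cases T; simp add: limit_share_eq[OF assms])+

text \<open>The shares vanish except for trees. A merger of two trees is a tree, so for other types
  every summand is 0, and for trees the sum is the one in \<open>forest_convolution\<close>.\<close>

lemma limit_share_splits:
  assumes "0 \<le> s"
  shows "(\<Sum>(T1, T2)\<in>splits (a, b, e). limit_share_L T1 s * limit_share_R T2 s) =
         (if Suc e = a + b then forest s 1 1 a b else 0)"
proof (cases "Suc e = a + b")
  case True
  define good where "good = {((x, y, z), (x', y', z')). Suc z = x + y \<and> Suc z' = x' + (y' :: nat)}"
  \<comment> \<open>(0, 0) and (a, b) leave one of the two parts without vertices; they are added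
    back at the end, where one of the forest factors is 0.\<close>
  define inner where "inner = {..a} \<times> {..b} - {(0, 0), (a, b)}"
  have "(\<Sum>(T1, T2)\<in>splits (a, b, e). limit_share_L T1 s * limit_share_R T2 s) =
      (\<Sum>(T1, T2)\<in>splits (a, b, e) \<inter> good. limit_share_L T1 s * limit_share_R T2 s)"
    by (rule sum.mono_neutral_right) (auto simp: good_def limit_share_eq[OF assms] split: if_splits)
  also have "\<dots> = (\<Sum>(x, y)\<in>inner. forest s 1 0 x y * forest s 0 1 (a - x) (b - y))"
  proof (rule sum.reindex_bij_witness[
      where i = "\<lambda>p. ((fst p, snd p, fst p + snd p - 1), (a - fst p, b - snd p, a + b - fst p - snd p - 1))"
        and j = "\<lambda>q. (fst (fst q), fst (snd (fst q)))"])
    fix p assume "p \<in> inner"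
    moreover obtain x y where xy: "p = (x, y)" by (cases p)
    ultimately have "x \<le> a" "y \<le> b" "\<not> (x = 0 \<and> y = 0)" "\<not> (x = a \<and> y = b)" by (auto simp: inner_def)
    then have p: "p = (x, y)" "x \<le> a" "y \<le> b" "0 < x + y" "x + y < a + b"
      using xy by linarith+
    show "(fst (fst ((fst p, snd p, fst p + snd p - 1), (a - fst p, b - snd p, a + b - fst p - snd p - 1))), fst (snd (fst ((fst p, snd p, fst p + snd p - 1), (a - fst p, b - snd p, a + b - fst p - snd p - 1))))) = p" by simp
    show "((fst p, snd p, fst p + snd p - 1), (a - fst p, b - snd p, a + b - fst p - snd p - 1)) \<in> splits (a, b, e) \<inter> good"
      using p True by (auto simp: splits_def merge_types_def good_def)
  next
    fix q assume q: "q \<in> splits (a, b, e) \<inter> good"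
    obtain x y z x' y' z' where qq: "q = ((x, y, z), (x', y', z'))" by (metis prod.exhaust)
    have eq: "x + x' = a" "y + y' = b" "Suc (z + z') = e" "Suc z = x + y" "Suc z' = x' + y'"
      using q unfolding qq by (auto simp: splits_def merge_types_def good_def)
    show "((fst (fst (fst q), fst (snd (fst q))), snd (fst (fst q), fst (snd (fst q))), fst (fst (fst q), fst (snd (fst q))) + snd (fst (fst q), fst (snd (fst q))) - 1), (a - fst (fst (fst q), fst (snd (fst q))), b - snd (fst (fst q), fst (snd (fst q))), a + b - fst (fst (fst q), fst (snd (fst q))) - snd (fst (fst q), fst (snd (fst q))) - 1)) = q"
      unfolding qq using eq by auto
    show "(fst (fst q), fst (snd (fst q))) \<in> inner"
      unfolding qq inner_def using eq by auto
    show "(case (fst (fst q), fst (snd (fst q))) of (x, y) \<Rightarrow> forest s 1 0 x y * forest s 0 1 (a - x) (b - y)) =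
       (case q of (T1, T2) \<Rightarrow> limit_share_L T1 s * limit_share_R T2 s)"
      unfolding qq using eq by (auto simp: limit_share_eq[OF assms])
  qed
  also have "\<dots> = (\<Sum>(x, y)\<in>{..a} \<times> {..b}. forest s 1 0 x y * forest s 0 1 (a - x) (b - y))"
    unfolding inner_def using forest_0_0[OF assms] by (intro sum.mono_neutral_left) auto
  finally have "(\<Sum>(T1, T2)\<in>splits (a, b, e). limit_share_L T1 s * limit_share_R T2 s) =
      (\<Sum>(x, y)\<in>{..a} \<times> {..b}. forest s 1 0 x y * forest s 0 1 (a - x) (b - y))" .
  then show ?thesis
    using True forest_convolution[OF assms, of a b] by (simp add: sum.cartesian_product)
next
  case False
  then have "(\<Sum>(T1, T2)\<in>splits (a, b, e). limit_share_L T1 s * limit_share_R T2 s) = 0"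
    by (intro sum.neutral) (auto simp: splits_def merge_types_def limit_share_eq[OF assms])
  then show ?thesis using False by simp
qed

lemma density_deriv:
  assumes "0 \<le> s"
  shows "(density T has_real_derivative limit_drift T s) (at s)"
proof -
  obtain a b e where T: "T = (a, b, e)" by (cases T) auto
  show ?thesis
  proof (cases "Suc e = a + b")
    case True
    then have "0 < a + b" by linarith
    then show ?thesis
      unfolding T limit_drift_def limit_share_splits[OF assms] limit_share_eq[OF assms] density_def[abs_def]
      using True tree_density_deriv[OF assms, of a b] by simp
  next
    case False
    then show ?thesis
      unfolding T limit_drift_def limit_share_splits[OF assms] limit_share_eq[OF assms] density_def[abs_def] by simp
  qed
qed

lemma limit_drift_bound:
  assumes "0 \<le> s"
  shows "\<bar>limit_drift T s\<bar> \<le> 2"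
proof -
  obtain a b e where T: "T = (a, b, e)" by (cases T) auto
  show ?thesis
    using forest_range[OF assms, of 1 1 a b] forest_range[OF assms, of 1 0 a b] forest_range[OF assms, of 0 1 a b]
    unfolding T limit_drift_def limit_share_splits[OF assms] limit_share_eq[OF assms] by auto
qed

lemma continuous_on_limit_drift: "continuous_on {0..} (limit_drift T)"
proof -
  have d: "continuous_on {0..} (density S)" for S
    by (rule DERIV_continuous_on[where D = "limit_drift S"]) (auto intro: has_field_derivative_at_within density_deriv)
  have c: "continuous_on {0..} (limit_share_L S)" "continuous_on {0..} (limit_share_R S)" for S
    unfolding limit_share_L_def[abs_def] limit_share_R_def[abs_def]
    using positive_denominators by (auto intro!: continuous_intros d simp: less_imp_neq[symmetric])
  show ?thesis
    unfolding limit_drift_def[abs_def] case_prod_unfold by (intro continuous_intros c)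
qed

lemma density_nonneg: "0 \<le> s \<Longrightarrow> 0 \<le> density T s"
  by (cases T) (simp add: density_def tree_density_nonneg)

text \<open>A tree has left weight at least \<alpha> or right weight at least \<beta>, and its share
  of the corresponding total weight is at most 1.\<close>

lemma density_bound:
  assumes "0 \<le> s"
  shows "density T s \<le> (s + \<alpha> * l) / \<alpha> + (s + \<beta> * r) / \<beta>"
proof -
  obtain a b e where T: "T = (a, b, e)" by (cases T) auto
  note pos = positive_denominators[OF assms]
  have nn: "0 \<le> (s + \<alpha> * l) / \<alpha>" "0 \<le> (s + \<beta> * r) / \<beta>"
    using pos \<alpha>_pos \<beta>_pos by (auto intro: less_imp_le)
  consider "Suc e \<noteq> a + b" | "1 \<le> a" | "1 \<le> b" by force
  then show ?thesis
  proof cases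
    case 1
    then show ?thesis using nn by (simp add: T density_def)
  next
    case 2
    have "\<alpha> * density T s \<le> left_weight \<alpha> T * density T s"
      using 2 \<alpha>_pos density_nonneg[OF assms] unfolding T left_weight_def
      by (intro mult_right_mono) (auto intro: order_trans[OF _ add_increasing2])
    also have "\<dots> \<le> s + \<alpha> * l"
      using limit_share_range(2)[OF assms, of T] pos by (simp add: limit_share_L_def)
    finally have "density T s \<le> (s + \<alpha> * l) / \<alpha>" using \<alpha>_pos by (simp add: field_simps)
    then show ?thesis using nn by simp
  next
    case 3
    have "\<beta> * density T s \<le> right_weight \<beta> T * density T s"
      using 3 \<beta>_pos density_nonneg[OF assms] unfolding T right_weight_def
      by (intro mult_right_mono) (auto intro: order_trans[OF _ add_increasing2])
    also have "\<dots> \<le> s + \<beta> * r"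
      using limit_share_range(4)[OF assms, of T] pos by (simp add: limit_share_R_def)
    finally have "density T s \<le> (s + \<beta> * r) / \<beta>" using \<beta>_pos by (simp add: field_simps)
    then show ?thesis using nn by simp
  qed
qed

lemma density_0: "density T 0 = (if T = (1, 0, 0) then l else if T = (0, 1, 0) then r else 0)"
proof -
  obtain a b e where T: "T = (a, b, e)" by (cases T) auto
  have p: "(\<alpha> * l) powr \<alpha> * (\<alpha> * l) powr (- \<alpha>) = 1" "(\<beta> * r) powr \<beta> * (\<beta> * r) powr (- \<beta>) = 1"
    "(\<alpha> * l) powr 0 = 1" "(\<beta> * r) powr 0 = 1"
    using \<alpha>_pos \<beta>_pos l_pos r_pos by (simp_all add: powr_add[symmetric])
  consider "a = 1" "b = 0" | "a = 0" "b = 1" | "Suc e \<noteq> a + b" | "0 < a + b - 1" by force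
  then show ?thesis
  proof cases
    case 1
    then show ?thesis using p by (simp add: T density_def tree_density_def tree_coeff_def mult.assoc)
  next
    case 2
    then show ?thesis using p by (simp add: T density_def tree_density_def tree_coeff_def mult.assoc)
  next
    case 3
    then show ?thesis by (auto simp: T density_def)
  next
    case 4
    then have "\<not> (T = (1, 0, 0))" "\<not> (T = (0, 1, 0))" by (auto simp: T)
    with 4 show ?thesis by (simp add: T density_def tree_density_def)
  qed
qed

end

section \<open>Comparison of the type counts with their limit\<close>

lemma component_empty: "component {} x = {x}"
  by (auto simp: component_def adjacency_def)

lemma count_type_empty:
  "count_type l r {} T = (if T = (1, 0, 0) then l else if T = (0, 1, 0) then r else 0)"
proof -
  have C: "components l r {} = (\<lambda>x. {x}) ` vertices l r"
    unfolding components_eq component_empty ..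
  have dis: "x \<notin> right_part r" if "x \<in> left_part l" for x using that parts_disjoint by blast
  have ty: "component_type l r {} {x} = (if x \<in> left_part l then (1, 0, 0) else (0, 1, 0))" if "x \<in> vertices l r" for x
    using that dis by (auto simp: component_type_def vertices_def degree_def)
  have "{C \<in> components l r {}. component_type l r {} C = T} =
     (\<lambda>x. {x}) ` {x \<in> vertices l r. (if x \<in> left_part l then (1, 0, 0) else (0, 1, 0)) = T}"
    unfolding C using ty by auto
  then have "count_type l r {} T = card {x \<in> vertices l r. (if x \<in> left_part l then (1, 0, 0) else (0, 1, 0)) = T}"
    unfolding count_type_def by (simp add: card_image)
  moreover have "{x \<in> vertices l r. (if x \<in> left_part l then (1, 0, 0) else (0, 1, 0)) = T} =
      (if T = (1, 0, 0) then left_part l else if T = (0, 1, 0) then right_part r else {})"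
    using dis by (auto simp: vertices_def split: if_splits)
  ultimately show ?thesis by simp
qed

lemma count_type_le: "count_type l r G T \<le> l + r"
proof -
  have "count_type l r G T \<le> card (components l r G)"
    unfolding count_type_def by (rule card_mono) auto
  also have "\<dots> \<le> card (vertices l r)" unfolding components_eq by (rule card_image_le) simp
  finally show ?thesis by simp
qed

text \<open>With n = l + r and times up to \<open>horizon\<close> n, both total weights lie between
  c n and C n, and Z is at least c n^2. K bounds the coordinates of the types under consideration.
  The final error bound depends on l and r only through n and the deviation of their ratios from the
  limits.\<close>

locale fluid_limit = process l r \<alpha> \<beta> + lim: limit_params \<alpha> \<beta> l0 r0
  for l r :: nat and \<alpha> \<beta> l0 r0 :: real +
  fixes c C horizon :: real and K :: nat
  assumes c_pos: "0 < c" and horizon_nonneg: "0 \<le> horizon" and size_pos: "0 < l + r"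
    and left_large: "c * real (l + r) \<le> \<alpha> * real l" and right_large: "c * real (l + r) \<le> \<beta> * real r"
    and pairs_large: "c * real (l + r) ^ 2 \<le> \<alpha> * \<beta> * (real l * real r - horizon * real (l + r))"
    and C_bound: "horizon + \<alpha> \<le> C" "horizon + \<beta> \<le> C"
begin

definition n :: real where "n = real (l + r)"

lemma n_pos: "0 < n" using size_pos unfolding n_def by (simp only: of_nat_0_less_iff)

definition cubes :: "graph \<Rightarrow> real" where
  "cubes G = (\<Sum>u\<in>left_part l. vweight \<alpha> G u ^ 3) + (\<Sum>v\<in>right_part r. vweight \<beta> G v ^ 3)"

text \<open>Divided by n, this bounds the relative growth of the cube sums in one step, as the
  weights are at most C n and Z is at least c n^2.\<close>

definition cube_rate :: real where
  "cube_rate = (3 + 3 / \<alpha> + 1 / \<alpha> ^ 2 + (3 + 3 / \<beta> + 1 / \<beta> ^ 2)) * C / c"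

definition cube_bound :: real where
  "cube_bound = exp (cube_rate * horizon) * (\<alpha> ^ 3 + \<beta> ^ 3)"

lemma C_pos: "0 < C" using C_bound \<alpha>_pos horizon_nonneg by simp

lemma steps_lt_pairs:
  assumes "real t \<le> horizon * n"
  shows "t < l * r"
proof -
  have "0 < c * n ^ 2" using c_pos n_pos by simp
  also have "\<dots> \<le> \<alpha> * \<beta> * (real l * real r - horizon * n)" using pairs_large by (simp add: n_def)
  finally have "0 < real l * real r - horizon * n"
    by (rule zero_less_mult_pos) (simp add: \<alpha>_pos \<beta>_pos)
  then have "real t < real (l * r)" using assms by simp
  then show ?thesis by (simp only: of_nat_less_iff)
qed

lemma state:
  assumes "real t \<le> horizon * n" "G \<in> set_pmf (graph_process l r \<alpha> \<beta> t)"
  shows "weighted_graph l r G \<alpha> \<beta>" "card G = t" "available_pairs l r G \<noteq> {}"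
    "weighted_graph.W_L l G \<alpha> = real t + \<alpha> * real l" "weighted_graph.W_R r G \<beta> = real t + \<beta> * real r"
    "c * n \<le> weighted_graph.W_L l G \<alpha>" "c * n \<le> weighted_graph.W_R r G \<beta>"
    "weighted_graph.W_L l G \<alpha> \<le> C * n" "weighted_graph.W_R r G \<beta> \<le> C * n"
    "c * n ^ 2 \<le> weighted_graph.Z l r G \<alpha> \<beta>"
proof -
  have t: "t < l * r" by (rule steps_lt_pairs[OF assms(1)])
  show w: "weighted_graph l r G \<alpha> \<beta>" using reachable[OF assms(2)] by (intro weighted_graphI) simp
  interpret weighted_graph l r G \<alpha> \<beta> by (rule w)
  show card: "card G = t" using reachable[OF assms(2)] t by simp
  show "available_pairs l r G \<noteq> {}" using available_nonempty card t by simp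
  show W: "W_L = real t + \<alpha> * real l" "W_R = real t + \<beta> * real r" by (simp_all add: W_L_def W_R_def card)
  show "c * n \<le> W_L" "c * n \<le> W_R" using left_large right_large unfolding W n_def by (simp_all add: add_increasing)
  have "\<alpha> * real l \<le> \<alpha> * n" "\<beta> * real r \<le> \<beta> * n" using \<alpha>_pos \<beta>_pos by (simp_all add: n_def)
  then have "W_L \<le> (horizon + \<alpha>) * n" "W_R \<le> (horizon + \<beta>) * n"
    using assms(1) unfolding W by (simp_all add: distrib_right)
  moreover have "(horizon + \<alpha>) * n \<le> C * n" "(horizon + \<beta>) * n \<le> C * n" using C_bound n_pos by simp_all
  ultimately show "W_L \<le> C * n" "W_R \<le> C * n" by simp_all
  have "c * n ^ 2 \<le> \<alpha> * \<beta> * (real l * real r - horizon * n)" using pairs_large by (simp add: n_def)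
  also have "\<dots> \<le> \<alpha> * \<beta> * (real l * real r - real (card G))"
    using assms(1) \<alpha>_pos \<beta>_pos unfolding card by (intro mult_left_mono) auto
  also have "\<dots> \<le> Z" by (rule Z_lower)
  finally show "c * n ^ 2 \<le> Z" .
qed

lemma cubes_nonneg: "0 \<le> cubes G"
  using \<alpha>_pos \<beta>_pos by (auto simp: cubes_def vweight_def intro!: add_nonneg_nonneg sum_nonneg)

lemma expect_cubes:
  assumes "real t \<le> horizon * n"
  shows "expect t cubes \<le> cube_bound * n"
proof -
  define ka where "ka = 3 + 3 / \<alpha> + 1 / \<alpha> ^ 2"
  define kb where "kb = 3 + 3 / \<beta> + 1 / \<beta> ^ 2"
  have k: "0 \<le> ka" "0 \<le> kb" using \<alpha>_pos \<beta>_pos by (auto simp: ka_def kb_def)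
  have rate: "cube_rate = (ka + kb) * C / c" by (simp add: cube_rate_def ka_def kb_def)
  have rate_nn: "0 \<le> cube_rate" unfolding rate using k C_pos c_pos by simp
  define a where "a = cube_rate / n"
  have step: "expect (Suc t) cubes \<le> (1 + a) * expect t cubes + 0" if t: "real t \<le> horizon * n" for t
  proof -
    have "expect (Suc t) cubes = expect t (\<lambda>G. expect_step G cubes)" by (rule expect_Suc)
    also have "\<dots> \<le> expect t (\<lambda>G. (1 + a) * cubes G)"
    proof (rule expect_mono)
      fix G assume G: "G \<in> set_pmf (graph_process l r \<alpha> \<beta> t)"
      note st = state[OF t G]
      interpret weighted_graph l r G \<alpha> \<beta> by (rule st(1))
      have Zp: "0 < c * n ^ 2" using c_pos n_pos by simp
      define A where "A = (\<Sum>u\<in>left_part l. vweight \<alpha> G u ^ 3)"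
      define B where "B = (\<Sum>v\<in>right_part r. vweight \<beta> G v ^ 3)"
      have AB: "0 \<le> A" "0 \<le> B" using vweight_nonneg by (auto simp: A_def B_def intro!: sum_nonneg)
      have q: "W / Z \<le> C / c / n" if "W \<le> C * n" "0 \<le> W" for W
      proof -
        have "W / Z \<le> (C * n) / (c * n ^ 2)"
          using that st(10) Zp C_pos n_pos by (intro frac_le) auto
        then show ?thesis using n_pos by (simp add: power2_eq_square)
      qed
      have "ka * W_R / Z \<le> a" "kb * W_L / Z \<le> a"
      proof -
        have "ka * (W_R / Z) \<le> ka * (C / c / n)" "kb * (W_L / Z) \<le> kb * (C / c / n)"
          by (rule mult_left_mono[OF q[OF st(9) W_nonneg(2)] k(1)], rule mult_left_mono[OF q[OF st(8) W_nonneg(1)] k(2)])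
        moreover have "a = ka * (C / c / n) + kb * (C / c / n)"
          unfolding a_def rate by (simp add: add_divide_distrib distrib_right)
        moreover have "0 \<le> ka * (C / c / n)" "0 \<le> kb * (C / c / n)" using k C_pos c_pos n_pos by auto
        ultimately show "ka * W_R / Z \<le> a" "kb * W_L / Z \<le> a" by simp_all
      qed
      then have "A * (1 + ka * W_R / Z) \<le> A * (1 + a)" "B * (1 + kb * W_L / Z) \<le> B * (1 + a)"
        using AB by (auto intro!: mult_left_mono)
      moreover have "expect_step G cubes \<le> A * (1 + ka * W_R / Z) + B * (1 + kb * W_L / Z)"
      proof -
        have "expect_step G cubes = expect_step G (\<lambda>H. \<Sum>u\<in>left_part l. vweight \<alpha> H u ^ 3) +
           expect_step G (\<lambda>H. \<Sum>v\<in>right_part r. vweight \<beta> H v ^ 3)"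
          unfolding cubes_def by (intro Bochner_Integration.integral_add integrable_measure_pmf_finite finite_set_add_random_edge)
        then show ?thesis
          using cube_sum_step[OF st(3)] unfolding A_def B_def ka_def kb_def by simp
      qed
      ultimately show "expect_step G cubes \<le> (1 + a) * cubes G"
        unfolding cubes_def A_def[symmetric] B_def[symmetric] by (simp add: algebra_simps)
    qed
    finally show ?thesis by simp
  qed
  have "expect t cubes \<le> exp (a * real t) * (expect 0 cubes + real t * 0)"
  proof (rule discrete_gronwall[where m = t])
    show "0 \<le> a" using rate_nn n_pos by (simp add: a_def)
    show "0 \<le> expect 0 cubes" by (simp add: cubes_nonneg)
    fix t' assume "t' < t"
    then show "expect (Suc t') cubes \<le> (1 + a) * expect t' cubes + 0" using assms by (intro step) auto
  qed auto
  also have "\<dots> \<le> exp (cube_rate * horizon) * ((\<alpha> ^ 3 + \<beta> ^ 3) * n)"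
  proof (rule mult_mono)
    have "real t / n \<le> horizon" using assms n_pos by (simp add: field_simps)
    then have "cube_rate * (real t / n) \<le> cube_rate * horizon" using rate_nn by (rule mult_left_mono)
    then show "exp (a * real t) \<le> exp (cube_rate * horizon)" by (simp add: a_def)
    have "cubes {} = real l * \<alpha> ^ 3 + real r * \<beta> ^ 3" by (simp add: cubes_def vweight_def degree_def)
    also have "\<dots> \<le> n * \<alpha> ^ 3 + n * \<beta> ^ 3"
      using \<alpha>_pos \<beta>_pos by (intro add_mono mult_right_mono) (auto simp: n_def)
    finally show "expect 0 cubes + real t * 0 \<le> (\<alpha> ^ 3 + \<beta> ^ 3) * n" by (simp add: algebra_simps)
    show "0 \<le> expect 0 cubes + real t * 0" by (simp add: cubes_nonneg)
  qed simp
  finally show ?thesis by (simp add: cube_bound_def mult.assoc)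
qed

text \<open>Closed under splitting, because a merger adds all coordinates; hence the deviations of
  these types satisfy a closed system of inequalities.\<close>

definition types :: "ctype set" where "types = {..K} \<times> {..K} \<times> {..K}"

definition N :: real where "N = real (card types)"

lemma finite_types [simp]: "finite types" by (simp add: types_def)

lemma N_nonneg: "0 \<le> N" by (simp add: N_def)

lemma splits_types:
  assumes "T \<in> types"
  shows "splits T \<subseteq> types \<times> types" "real (card (splits T)) \<le> N ^ 2"
proof -
  show s: "splits T \<subseteq> types \<times> types"
    using assms by (auto simp: splits_def merge_types_def types_def)
  have "card (splits T) \<le> card (types \<times> types)" by (rule card_mono[OF _ s]) simp
  then have "real (card (splits T)) \<le> real (card types * card types)"
    unfolding card_cartesian_product by (rule of_nat_mono)
  then show "real (card (splits T)) \<le> N ^ 2" by (simp add: N_def power2_eq_square)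
qed

definition dev :: "nat \<Rightarrow> ctype \<Rightarrow> graph \<Rightarrow> real" where
  "dev t T G = real (count_type l r G T) / n - lim.density T (real t / n)"

definition total_dev :: "nat \<Rightarrow> graph \<Rightarrow> real" where
  "total_dev t G = (\<Sum>T\<in>types. \<bar>dev t T G\<bar>)"

definition square_dev :: "nat \<Rightarrow> graph \<Rightarrow> real" where
  "square_dev t G = (\<Sum>T\<in>types. dev t T G ^ 2)"

definition ratio_error :: real where
  "ratio_error = \<bar>real l / n - l0\<bar> + \<bar>real r / n - r0\<bar>"

definition share_bound :: "nat \<Rightarrow> graph \<Rightarrow> real" where
  "share_bound t G = ((\<alpha> + \<beta> + 1) * real K * total_dev t G + (\<alpha> + \<beta>) * ratio_error) / c"

text \<open>The difference is (A (x - m) - (A m / w0) (w - w0)) / w. The second coefficient is a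
  share, hence at most 1, so no bound for A enters there.\<close>

lemma quotient_difference:
  fixes A x m w w0 :: real
  assumes "0 \<le> A" "0 \<le> A * m / w0" "A * m / w0 \<le> 1" "c \<le> w" "0 < w0"
  shows "\<bar>A * x / w - A * m / w0\<bar> \<le> (A * \<bar>x - m\<bar> + \<bar>w - w0\<bar>) / c"
proof -
  have w: "0 < w" using assms c_pos by simp
  have "A * x / w - A * m / w0 = (A * (x - m) - (A * m / w0) * (w - w0)) / w"
    using w assms(5) by (simp add: field_simps)
  also have "\<bar>\<dots>\<bar> \<le> (A * \<bar>x - m\<bar> + \<bar>w - w0\<bar>) / w"
  proof -
    have "\<bar>A * (x - m) - (A * m / w0) * (w - w0)\<bar> \<le> \<bar>A * (x - m)\<bar> + \<bar>(A * m / w0) * (w - w0)\<bar>"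
      by (rule abs_triangle_ineq4)
    also have "\<bar>(A * m / w0) * (w - w0)\<bar> \<le> 1 * \<bar>w - w0\<bar>"
      unfolding abs_mult[of _ "w - w0"] abs_of_nonneg[OF assms(2)] using assms(3) by (rule mult_right_mono) simp
    finally show ?thesis using w assms(1) by (simp add: abs_mult divide_right_mono)
  qed
  also have "\<dots> \<le> (A * \<bar>x - m\<bar> + \<bar>w - w0\<bar>) / c"
    using assms c_pos by (intro divide_left_mono mult_pos_pos w) auto
  finally show ?thesis .
qed

lemma share_difference:
  assumes t: "real t \<le> horizon * n" and G: "G \<in> set_pmf (graph_process l r \<alpha> \<beta> t)" and T: "T \<in> types"
  shows "\<bar>weighted_graph.share_L l r G \<alpha> T - lim.limit_share_L T (real t / n)\<bar> \<le> share_bound t G"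
    and "\<bar>weighted_graph.share_R l r G \<beta> T - lim.limit_share_R T (real t / n)\<bar> \<le> share_bound t G"
proof -
  note st = state[OF t G]
  interpret weighted_graph l r G \<alpha> \<beta> by (rule st(1))
  define s where "s = real t / n"
  have s: "0 \<le> s" using n_pos by (simp add: s_def)
  obtain a b e where abe: "T = (a, b, e)" "a \<le> K" "b \<le> K" "e \<le> K" using T by (auto simp: types_def)
  have lw: "0 \<le> left_weight \<alpha> T" "left_weight \<alpha> T \<le> (\<alpha> + \<beta> + 1) * real K"
    and rw: "0 \<le> right_weight \<beta> T" "right_weight \<beta> T \<le> (\<alpha> + \<beta> + 1) * real K"
  proof -
    have "\<alpha> * real a \<le> \<alpha> * real K" "\<beta> * real b \<le> \<beta> * real K" "0 \<le> \<alpha> * real K" "0 \<le> \<beta> * real K"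
      using abe \<alpha>_pos \<beta>_pos by auto
    then show "left_weight \<alpha> T \<le> (\<alpha> + \<beta> + 1) * real K" "right_weight \<beta> T \<le> (\<alpha> + \<beta> + 1) * real K"
      using abe by (simp_all add: left_weight_def right_weight_def distrib_right)
    show "0 \<le> left_weight \<alpha> T" "0 \<le> right_weight \<beta> T"
      using \<alpha>_pos \<beta>_pos abe by (simp_all add: left_weight_def right_weight_def)
  qed
  have re: "0 \<le> ratio_error" "\<bar>real l / n - l0\<bar> \<le> ratio_error" "\<bar>real r / n - r0\<bar> \<le> ratio_error" by (auto simp: ratio_error_def)
  have dt: "\<bar>dev t T G\<bar> \<le> total_dev t G"
    unfolding total_dev_def by (rule member_le_sum[OF T]) auto
  have dev: "real (count_type l r G T) / n - lim.density T s = dev t T G" by (simp add: dev_def s_def)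
  show "\<bar>share_L T - lim.limit_share_L T (real t / n)\<bar> \<le> share_bound t G"
  proof -
    have "share_L T = left_weight \<alpha> T * (real (count_type l r G T) / n) / (W_L / n)"
      using n_pos by (simp add: share_L_def)
    also have "\<bar>\<dots> - lim.limit_share_L T s\<bar> \<le>
      (left_weight \<alpha> T * \<bar>real (count_type l r G T) / n - lim.density T s\<bar> + \<bar>W_L / n - (s + \<alpha> * l0)\<bar>) / c"
      unfolding lim.limit_share_L_def
    proof (rule quotient_difference[OF lw(1)])
      show "0 \<le> left_weight \<alpha> T * lim.density T s / (s + \<alpha> * l0)" "left_weight \<alpha> T * lim.density T s / (s + \<alpha> * l0) \<le> 1"
        using lim.limit_share_range[OF s, of T] by (simp_all add: lim.limit_share_L_def)
      show "c \<le> W_L / n" using st(6) n_pos by (simp add: field_simps)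
      show "0 < s + \<alpha> * l0" by (rule lim.positive_denominators[OF s])
    qed
    \<comment> \<open>The time cancels, since the number of edges is not random; only the ratio of
      the part sizes deviates.\<close>
    also have "W_L / n - (s + \<alpha> * l0) = \<alpha> * (real l / n - l0)"
      unfolding st(4) s_def using n_pos by (simp add: field_simps)
    also have "(left_weight \<alpha> T * \<bar>real (count_type l r G T) / n - lim.density T s\<bar> + \<bar>\<alpha> * (real l / n - l0)\<bar>) / c \<le> share_bound t G"
    proof -
      have "left_weight \<alpha> T * \<bar>dev t T G\<bar> \<le> (\<alpha> + \<beta> + 1) * real K * total_dev t G"
        using lw dt \<alpha>_pos \<beta>_pos by (intro mult_mono) auto
      moreover have "\<bar>\<alpha> * (real l / n - l0)\<bar> \<le> (\<alpha> + \<beta>) * ratio_error"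
        unfolding abs_mult using re \<alpha>_pos \<beta>_pos by (intro mult_mono) auto
      ultimately show ?thesis unfolding share_bound_def dev using c_pos by (intro divide_right_mono) auto
    qed
    finally show ?thesis by (simp add: s_def)
  qed
  show "\<bar>share_R T - lim.limit_share_R T (real t / n)\<bar> \<le> share_bound t G"
  proof -
    have "share_R T = right_weight \<beta> T * (real (count_type l r G T) / n) / (W_R / n)"
      using n_pos by (simp add: share_R_def)
    also have "\<bar>\<dots> - lim.limit_share_R T s\<bar> \<le>
      (right_weight \<beta> T * \<bar>real (count_type l r G T) / n - lim.density T s\<bar> + \<bar>W_R / n - (s + \<beta> * r0)\<bar>) / c"
      unfolding lim.limit_share_R_def
    proof (rule quotient_difference[OF rw(1)])
      show "0 \<le> right_weight \<beta> T * lim.density T s / (s + \<beta> * r0)" "right_weight \<beta> T * lim.density T s / (s + \<beta> * r0) \<le> 1"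
        using lim.limit_share_range[OF s, of T] by (simp_all add: lim.limit_share_R_def)
      show "c \<le> W_R / n" using st(7) n_pos by (simp add: field_simps)
      show "0 < s + \<beta> * r0" by (rule lim.positive_denominators[OF s])
    qed
    also have "W_R / n - (s + \<beta> * r0) = \<beta> * (real r / n - r0)"
      unfolding st(5) s_def using n_pos by (simp add: field_simps)
    also have "(right_weight \<beta> T * \<bar>real (count_type l r G T) / n - lim.density T s\<bar> + \<bar>\<beta> * (real r / n - r0)\<bar>) / c \<le> share_bound t G"
    proof -
      have "right_weight \<beta> T * \<bar>dev t T G\<bar> \<le> (\<alpha> + \<beta> + 1) * real K * total_dev t G"
        using rw dt \<alpha>_pos \<beta>_pos by (intro mult_mono) auto
      moreover have "\<bar>\<beta> * (real r / n - r0)\<bar> \<le> (\<alpha> + \<beta>) * ratio_error"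
        unfolding abs_mult using re \<alpha>_pos \<beta>_pos by (intro mult_mono) auto
      ultimately show ?thesis unfolding share_bound_def dev using c_pos by (intro divide_right_mono) auto
    qed
    finally show ?thesis by (simp add: s_def)
  qed
qed

lemma share_le_1:
  assumes t: "real t \<le> horizon * n" and G: "G \<in> set_pmf (graph_process l r \<alpha> \<beta> t)"
  shows "0 \<le> weighted_graph.share_L l r G \<alpha> T" "weighted_graph.share_L l r G \<alpha> T \<le> 1"
proof -
  note st = state[OF t G]
  interpret weighted_graph l r G \<alpha> \<beta> by (rule st(1))
  have W: "0 < W_L" using st(6) mult_pos_pos[OF c_pos n_pos] by linarith
  have "(\<Sum>u\<in>left_part l. vweight \<alpha> G u * of_bool (vtype u = T)) \<le> W_L"
    unfolding W_sum[symmetric] by (rule sum_mono) (simp add: vweight_nonneg)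
  then show "share_L T \<le> 1" unfolding left_mass share_L_def using W by simp
  have "0 \<le> (\<Sum>u\<in>left_part l. vweight \<alpha> G u * of_bool (vtype u = T))"
    by (rule sum_nonneg) (simp add: vweight_nonneg)
  then show "0 \<le> share_L T" unfolding left_mass share_L_def using W by simp
qed

lemma drift_difference:
  assumes t: "real t \<le> horizon * n" and G: "G \<in> set_pmf (graph_process l r \<alpha> \<beta> t)" and T: "T \<in> types"
  shows "\<bar>weighted_graph.drift l r G \<alpha> \<beta> T - lim.limit_drift T (real t / n)\<bar> \<le> 2 * (N ^ 2 + 1) * share_bound t G"
proof -
  note st = state[OF t G]
  interpret weighted_graph l r G \<alpha> \<beta> by (rule st(1))
  define s where "s = real t / n"
  have s: "0 \<le> s" using n_pos by (simp add: s_def)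
  note sd = share_difference[OF t G, folded s_def]
  have E: "0 \<le> share_bound t G" by (rule order_trans[OF abs_ge_zero sd(1)[OF T]])
  have "\<bar>(\<Sum>(T1, T2)\<in>splits T. share_L T1 * share_R T2) - (\<Sum>(T1, T2)\<in>splits T. lim.limit_share_L T1 s * lim.limit_share_R T2 s)\<bar>
    \<le> (\<Sum>p\<in>splits T. 2 * share_bound t G)"
    unfolding sum_subtractf[symmetric] case_prod_unfold
  proof (intro order_trans[OF sum_abs] sum_mono)
    fix p assume "p \<in> splits T"
    then have p: "fst p \<in> types" "snd p \<in> types" using splits_types(1)[OF T] by auto
    define x y x' y' where "x = share_L (fst p)" and "y = share_R (snd p)" and "x' = lim.limit_share_L (fst p) s" and "y' = lim.limit_share_R (snd p) s"
    \<comment> \<open>Only x and y' are left as factors, and both are shares between 0 and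
      1.\<close>
    have "x * y - x' * y' = x * (y - y') + (x - x') * y'" by (simp add: algebra_simps)
    also have "\<bar>\<dots>\<bar> \<le> \<bar>x\<bar> * \<bar>y - y'\<bar> + \<bar>x - x'\<bar> * \<bar>y'\<bar>"
      using abs_triangle_ineq[of "x * (y - y')" "(x - x') * y'"] by (simp only: abs_mult)
    also have "\<dots> \<le> 1 * share_bound t G + share_bound t G * 1"
      using sd(1)[OF p(1)] sd(2)[OF p(2)] share_le_1[OF t G, of "fst p"] lim.limit_share_range(3,4)[OF s, of "snd p"]
      unfolding x_def y_def x'_def y'_def by (intro add_mono mult_mono) auto
    finally show "\<bar>share_L (fst p) * share_R (snd p) - lim.limit_share_L (fst p) s * lim.limit_share_R (snd p) s\<bar> \<le> 2 * share_bound t G"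
      by (simp add: x_def y_def x'_def y'_def)
  qed
  also have "\<dots> = real (card (splits T)) * (2 * share_bound t G)" by simp
  also have "\<dots> \<le> N ^ 2 * (2 * share_bound t G)"
    using splits_types(2)[OF T] E by (intro mult_right_mono) auto
  finally have 1: "\<bar>(\<Sum>(T1, T2)\<in>splits T. share_L T1 * share_R T2) - (\<Sum>(T1, T2)\<in>splits T. lim.limit_share_L T1 s * lim.limit_share_R T2 s)\<bar>
    \<le> N ^ 2 * (2 * share_bound t G)" .
  have "2 * (N ^ 2 + 1) * share_bound t G = N ^ 2 * (2 * share_bound t G) + share_bound t G + share_bound t G"
    by (simp add: algebra_simps)
  then show ?thesis
    using 1 sd(1)[OF T] sd(2)[OF T] unfolding drift_def lim.limit_drift_def s_def[symmetric] by linarith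
qed

definition dev_max :: real where
  "dev_max = 1 + (horizon + \<alpha> * l0) / \<alpha> + (horizon + \<beta> * r0) / \<beta>"

lemma dev_bound:
  assumes "real t \<le> horizon * n"
  shows "\<bar>dev t T G\<bar> \<le> dev_max"
proof -
  define s where "s = real t / n"
  have s: "0 \<le> s" "s \<le> horizon" using n_pos assms by (simp_all add: s_def field_simps)
  have "lim.density T s \<le> (s + \<alpha> * l0) / \<alpha> + (s + \<beta> * r0) / \<beta>" by (rule lim.density_bound[OF s(1)])
  also have "\<dots> \<le> (horizon + \<alpha> * l0) / \<alpha> + (horizon + \<beta> * r0) / \<beta>"
    using s \<alpha>_pos \<beta>_pos by (intro add_mono divide_right_mono) auto
  finally have d: "lim.density T s \<le> dev_max - 1" by (simp add: dev_max_def)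
  have "real (count_type l r G T) \<le> n" unfolding n_def of_nat_le_iff by (rule count_type_le)
  then have x: "0 \<le> real (count_type l r G T) / n" "real (count_type l r G T) / n \<le> 1" using n_pos by simp_all
  have d0: "0 \<le> lim.density T s" by (rule lim.density_nonneg[OF s(1)])
  show ?thesis using x d d0 unfolding dev_def s_def[symmetric] by (simp add: abs_le_iff)
qed

text \<open>The bound of \<open>expected_change\<close> with its deterministic quantities replaced:
  the right weight is at most (\<beta> + 1) K, \<open>W_L\<close> at most C n and Z at least c n^2.
  Only the cube sums remain random.\<close>

definition step_error :: "graph \<Rightarrow> real" where
  "step_error G = (2 * (\<beta> + 1) * real K * C * n + cubes G) / (c * n ^ 2)"

text \<open>The square of the old deviation plus the increment is expanded. The cross term sees only
  the expected increment, which is the error of the drift; the squared increment is of order 1 / n^2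
  and stays negligible when summed over order n steps.\<close>

lemma square_dev_step:
  assumes t: "real (Suc t) \<le> horizon * n" and G: "G \<in> set_pmf (graph_process l r \<alpha> \<beta> t)" and T: "T \<in> types"
    and \<omega>: "\<And>x y. 0 \<le> x \<Longrightarrow> x \<le> horizon \<Longrightarrow> 0 \<le> y \<Longrightarrow> y \<le> horizon \<Longrightarrow> \<bar>x - y\<bar> \<le> 1 / n \<Longrightarrow>
      \<bar>lim.limit_drift T x - lim.limit_drift T y\<bar> \<le> \<omega>"
  shows "expect_step G (\<lambda>H. dev (Suc t) T H ^ 2) \<le>
    dev t T G ^ 2 + 2 / n * \<bar>dev t T G\<bar> * (2 * (N ^ 2 + 1) * share_bound t G + step_error G + \<omega>) + 16 / n ^ 2"
proof -
  have t0: "real t \<le> horizon * n" using t by simp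
  note st = state[OF t0 G]
  interpret weighted_graph l r G \<alpha> \<beta> by (rule st(1))
  define s where "s = real t / n"
  define s' where "s' = real (Suc t) / n"
  have s: "0 \<le> s" "s \<le> horizon" "0 \<le> s'" "s' \<le> horizon" "s' - s = 1 / n" "s < s'"
    using n_pos t t0 by (simp_all add: s_def s'_def field_simps)
  define h where "h = lim.density T s' - lim.density T s"
  \<comment> \<open>The increment of the limit equals its drift at some intermediate time z;
    \<omega> pays for the difference to the drift at time s.\<close>
  have "\<exists>z>s. z < s' \<and> lim.density T s' - lim.density T s = (s' - s) * lim.limit_drift T z"
  proof (rule MVT2[OF s(6)])
    fix x assume "s \<le> x" "x \<le> s'"
    then show "(lim.density T has_real_derivative lim.limit_drift T x) (at x)"
      using s(1) by (intro lim.density_deriv) simp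
  qed
  then obtain z where z: "s < z" "z < s'" "h = (s' - s) * lim.limit_drift T z"
    unfolding h_def by blast
  define D where "D = (\<lambda>H. real (count_type l r H T) - real (count_type l r G T))"
  have int: "integrable (measure_pmf (add_random_edge l r \<alpha> \<beta> G)) (f :: graph \<Rightarrow> real)" for f
    by (intro integrable_measure_pmf_finite finite_set_add_random_edge)
  have devS: "dev (Suc t) T H = dev t T G + (D H / n - h)" for H
    by (simp add: dev_def D_def h_def s_def s'_def diff_divide_distrib)
  have hb: "\<bar>h\<bar> \<le> 2 / n"
    unfolding z(3) s(5) abs_mult using lim.limit_drift_bound[of z T] z s n_pos
    by (simp add: divide_right_mono)
  have Db: "\<bar>D H\<bar> \<le> 2" if "H \<in> set_pmf (add_random_edge l r \<alpha> \<beta> G)" for H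
  proof -
    have "H \<in> (\<lambda>(u, v). insert {u, v} G) ` available_pairs l r G"
      using set_add_random_edge that st(3) by (simp add: subset_iff)
    then obtain p where "p \<in> available_pairs l r G" "H = (\<lambda>(u, v). insert {u, v} G) p" by blast
    moreover obtain u v where "p = (u, v)" by (cases p)
    ultimately have uv: "(u, v) \<in> available_pairs l r G" "H = insert {u, v} G" by simp_all
    then show ?thesis using count_change_bound[OF uv(1), of T] by (simp add: D_def count_change_def)
  qed
  \<comment> \<open>One step changes a count by at most 2 and n times the limit density by at most
    2, so the difference is at most 4 / n.\<close>
  have J2: "(D H / n - h) ^ 2 \<le> 16 / n ^ 2" if "H \<in> set_pmf (add_random_edge l r \<alpha> \<beta> G)" for H
  proof -
    have "\<bar>D H / n\<bar> \<le> 2 / n" using Db[OF that] n_pos by (simp add: divide_right_mono)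
    then have "\<bar>D H / n - h\<bar> \<le> 4 / n" using hb by linarith
    then have "\<bar>D H / n - h\<bar> ^ 2 \<le> (4 / n) ^ 2" by (intro power_mono) auto
    then show ?thesis by (simp add: power_divide)
  qed
  have "expect_step G (\<lambda>H. dev (Suc t) T H ^ 2) =
    expect_step G (\<lambda>H. dev t T G ^ 2 + 2 * dev t T G * (D H / n - h) + (D H / n - h) ^ 2)"
    by (intro Bochner_Integration.integral_cong refl) (simp add: devS power2_sum)
  also have "\<dots> = dev t T G ^ 2 + 2 * dev t T G * (expect_step G D / n - h) + expect_step G (\<lambda>H. (D H / n - h) ^ 2)"
    by (simp add: int)
  also have "expect_step G (\<lambda>H. (D H / n - h) ^ 2) \<le> expect_step G (\<lambda>H. 16 / n ^ 2)"
    by (intro integral_mono_AE int) (use J2 in \<open>auto simp: AE_measure_pmf_iff\<close>)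
  also have "2 * dev t T G * (expect_step G D / n - h) \<le>
     2 / n * \<bar>dev t T G\<bar> * (2 * (N ^ 2 + 1) * share_bound t G + step_error G + \<omega>)"
  proof -
    have W: "0 < W_L" "0 < W_R" "0 < Z"
      using st(6,7,10) mult_pos_pos[OF c_pos n_pos] mult_pos_pos[OF c_pos zero_less_power[OF n_pos, of 2]] by linarith+
    have e: "expect_step G D / n - h = (expect_step G D - lim.limit_drift T z) / n"
      unfolding z(3) s(5) by (simp add: diff_divide_distrib)
    have 1: "\<bar>expect_step G D - drift T\<bar> \<le> step_error G"
    proof -
      have "\<bar>expect_step G D - drift T\<bar> \<le> (2 * right_weight \<beta> T * W_L + cubes G) / Z"
        using expected_change[OF W, of T] unfolding D_def cubes_def by (simp add: add.assoc)
      also have "\<dots> \<le> (2 * (\<beta> + 1) * real K * C * n + cubes G) / (c * n ^ 2)"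
      proof (rule frac_le)
        obtain a b e where abe: "T = (a, b, e)" "b \<le> K" "e \<le> K" using T by (auto simp: types_def)
        have "right_weight \<beta> T \<le> (\<beta> + 1) * real K"
          using abe \<beta>_pos by (auto simp: right_weight_def distrib_right intro!: add_mono)
        then have "right_weight \<beta> T * W_L \<le> ((\<beta> + 1) * real K) * (C * n)"
          using st(8) W \<beta>_pos by (intro mult_mono) auto
        then have "2 * (right_weight \<beta> T * W_L) \<le> 2 * (((\<beta> + 1) * real K) * (C * n))" by (rule mult_left_mono) simp
        then show "2 * right_weight \<beta> T * W_L + cubes G \<le> 2 * (\<beta> + 1) * real K * C * n + cubes G"
          by (simp only: mult.assoc add_le_cancel_right)
        show "0 \<le> 2 * (\<beta> + 1) * real K * C * n + cubes G"
          using \<beta>_pos C_pos n_pos cubes_nonneg by simp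
        show "0 < c * n ^ 2" using c_pos n_pos by simp
      qed (rule st(10))
      finally show ?thesis by (simp add: step_error_def)
    qed
    have 2: "\<bar>drift T - lim.limit_drift T s\<bar> \<le> 2 * (N ^ 2 + 1) * share_bound t G"
      unfolding s_def by (rule drift_difference[OF t0 G T])
    have 3: "\<bar>lim.limit_drift T s - lim.limit_drift T z\<bar> \<le> \<omega>"
      using z s by (intro \<omega>) auto
    have "\<bar>expect_step G D - lim.limit_drift T z\<bar> \<le> 2 * (N ^ 2 + 1) * share_bound t G + step_error G + \<omega>"
      using 1 2 3 by linarith
    then have "\<bar>expect_step G D / n - h\<bar> \<le> (2 * (N ^ 2 + 1) * share_bound t G + step_error G + \<omega>) / n"
      unfolding e using n_pos by (simp add: divide_right_mono)
    then have "(2 * \<bar>dev t T G\<bar>) * \<bar>expect_step G D / n - h\<bar> \<le>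
      (2 * \<bar>dev t T G\<bar>) * ((2 * (N ^ 2 + 1) * share_bound t G + step_error G + \<omega>) / n)"
      by (intro mult_left_mono) auto
    moreover have "2 * dev t T G * (expect_step G D / n - h) \<le> (2 * \<bar>dev t T G\<bar>) * \<bar>expect_step G D / n - h\<bar>"
      using abs_ge_self[of "2 * dev t T G * (expect_step G D / n - h)"] by (simp add: abs_mult)
    ultimately show ?thesis by (simp add: mult_ac)
  qed
  finally show ?thesis by simp
qed

definition growth_rate :: real where
  "growth_rate = 4 * (N ^ 2 + 1) * ((\<alpha> + \<beta> + 1) * real K) * N / c"

definition noise :: "real \<Rightarrow> real" where
  "noise \<omega> = 4 * (N ^ 2 + 1) * ((\<alpha> + \<beta>) * ratio_error) * N * dev_max / c
    + 2 * N * dev_max * ((2 * (\<beta> + 1) * real K * C + cube_bound) / (c * n) + \<omega>) + 16 * N / n"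

lemma total_dev_bounds:
  assumes "real t \<le> horizon * n"
  shows "0 \<le> total_dev t G" "total_dev t G \<le> N * dev_max" "total_dev t G ^ 2 \<le> N * square_dev t G"
proof -
  show "0 \<le> total_dev t G" unfolding total_dev_def by (intro sum_nonneg) auto
  have "total_dev t G \<le> (\<Sum>T\<in>types. dev_max)"
    unfolding total_dev_def by (intro sum_mono dev_bound assms)
  then show "total_dev t G \<le> N * dev_max" by (simp add: N_def)
  show "total_dev t G ^ 2 \<le> N * square_dev t G"
    using sum_squared_le_sum_of_squares[of "\<lambda>T. \<bar>dev t T G\<bar>" types]
    by (simp add: total_dev_def square_dev_def N_def mult.commute)
qed

lemma dev_max_nonneg: "0 \<le> dev_max"
  by (rule order_trans[OF abs_ge_zero dev_bound[of 0]]) (use horizon_nonneg n_pos in simp)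

lemma ratio_error_nonneg: "0 \<le> ratio_error" by (simp add: ratio_error_def)

lemma cube_bound_nonneg: "0 \<le> cube_bound"
  using \<alpha>_pos \<beta>_pos by (simp add: cube_bound_def)

lemma step_error_nonneg: "0 \<le> step_error G"
  using \<beta>_pos C_pos n_pos c_pos cubes_nonneg by (simp add: step_error_def)

text \<open>The bound for one type contains the total deviation of all types, through the shares;
  only after summation over \<open>types\<close> does the inequality close up.\<close>

lemma total_square_dev_step:
  assumes t: "real (Suc t) \<le> horizon * n" and G: "G \<in> set_pmf (graph_process l r \<alpha> \<beta> t)" and "0 \<le> \<omega>"
    and \<omega>: "\<And>T x y. T \<in> types \<Longrightarrow> 0 \<le> x \<Longrightarrow> x \<le> horizon \<Longrightarrow> 0 \<le> y \<Longrightarrow> y \<le> horizon \<Longrightarrow> \<bar>x - y\<bar> \<le> 1 / n \<Longrightarrow>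
      \<bar>lim.limit_drift T x - lim.limit_drift T y\<bar> \<le> \<omega>"
  shows "expect_step G (square_dev (Suc t)) \<le> (1 + growth_rate / n) * square_dev t G +
    (4 * (N ^ 2 + 1) * ((\<alpha> + \<beta>) * ratio_error) * N * dev_max / c + 2 * N * dev_max * (step_error G + \<omega>) + 16 * N / n) / n"
proof -
  have t0: "real t \<le> horizon * n" using t by simp
  interpret weighted_graph l r G \<alpha> \<beta> by (rule state(1)[OF t0 G])
  have int: "integrable (measure_pmf (add_random_edge l r \<alpha> \<beta> G)) (f :: graph \<Rightarrow> real)" for f
    by (intro integrable_measure_pmf_finite finite_set_add_random_edge)
  define D where "D = total_dev t G"
  define A where "A = (\<alpha> + \<beta> + 1) * real K"
  define B where "B = (\<alpha> + \<beta>) * ratio_error"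
  define M where "M = 2 * (N ^ 2 + 1)"
  define E where "E = step_error G + \<omega>"
  note D = total_dev_bounds[OF t0, of G, folded D_def]
  have nn: "0 \<le> A" "0 \<le> B" "0 \<le> M" "0 \<le> E"
    using \<alpha>_pos \<beta>_pos ratio_error_nonneg step_error_nonneg[of G] \<open>0 \<le> \<omega>\<close> by (auto simp: A_def B_def M_def E_def)
  have sb: "share_bound t G = (A * D + B) / c" by (simp add: share_bound_def A_def B_def D_def)
  have "expect_step G (square_dev (Suc t)) = (\<Sum>T\<in>types. expect_step G (\<lambda>H. dev (Suc t) T H ^ 2))"
    unfolding square_dev_def by (rule Bochner_Integration.integral_sum) (rule int)
  also have "\<dots> \<le> (\<Sum>T\<in>types. dev t T G ^ 2 + 2 / n * \<bar>dev t T G\<bar> * (M * share_bound t G + step_error G + \<omega>) + 16 / n ^ 2)"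
    unfolding M_def by (intro sum_mono square_dev_step[OF t G] \<omega>)
  also have "\<dots> = square_dev t G + 2 / n * D * (M * share_bound t G + E) + 16 * N / n ^ 2"
    unfolding sum.distrib sum_distrib_left[symmetric] sum_distrib_right[symmetric]
    by (simp add: square_dev_def D_def total_dev_def E_def N_def add.assoc)
  also have "2 / n * D * (M * share_bound t G + E) = 2 / n * (M / c * (A * D ^ 2 + B * D) + D * E)"
    unfolding sb by (simp add: power2_eq_square algebra_simps add_divide_distrib)
  \<comment> \<open>The square of the total deviation is compared with the sum of squares by
    Cauchy-Schwarz and goes into the growth rate; where the total deviation enters linearly, the
    crude bound \<open>N * dev_max\<close> goes into the noise.\<close>
  also have "\<dots> \<le> 2 / n * (M / c * (A * (N * square_dev t G) + B * (N * dev_max)) + (N * dev_max) * E)"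
    using D nn n_pos c_pos by (intro mult_left_mono add_mono mult_right_mono) auto
  also have "square_dev t G + 2 / n * (M / c * (A * (N * square_dev t G) + B * (N * dev_max)) + (N * dev_max) * E) + 16 * N / n ^ 2 =
    (1 + growth_rate / n) * square_dev t G + (2 * M * B * N * dev_max / c + 2 * N * dev_max * E + 16 * N / n) / n"
    unfolding growth_rate_def A_def[symmetric] M_def using n_pos c_pos
    by (simp add: power2_eq_square add_divide_distrib distrib_left distrib_right mult_ac)
  finally show ?thesis by (simp add: M_def B_def E_def algebra_simps)
qed

text \<open>Gronwall's inequality. At time 0 only isolated vertices exist, so the initial deviation
  is the error of the ratios; the cube sums enter linearly, so \<open>expect_cubes\<close> suffices
  for them.\<close>

lemma expect_square_dev:
  assumes t: "real t \<le> horizon * n" and "0 \<le> \<omega>"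
    and \<omega>: "\<And>T x y. T \<in> types \<Longrightarrow> 0 \<le> x \<Longrightarrow> x \<le> horizon \<Longrightarrow> 0 \<le> y \<Longrightarrow> y \<le> horizon \<Longrightarrow> \<bar>x - y\<bar> \<le> 1 / n \<Longrightarrow>
      \<bar>lim.limit_drift T x - lim.limit_drift T y\<bar> \<le> \<omega>"
  shows "expect t (square_dev t) \<le> exp (growth_rate * horizon) * (N * ratio_error ^ 2 + horizon * noise \<omega>)"
proof -
  have gr: "0 \<le> growth_rate"
    using \<alpha>_pos \<beta>_pos c_pos N_nonneg by (simp add: growth_rate_def)
  have nn: "0 \<le> noise \<omega>"
    using \<alpha>_pos \<beta>_pos c_pos N_nonneg n_pos C_pos ratio_error_nonneg dev_max_nonneg cube_bound_nonneg \<open>0 \<le> \<omega>\<close>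
    unfolding noise_def by (intro add_nonneg_nonneg mult_nonneg_nonneg divide_nonneg_nonneg) auto
  have "expect t (square_dev t) \<le> exp (growth_rate / n * real t) * (expect 0 (square_dev 0) + real t * (noise \<omega> / n))"
  proof (rule discrete_gronwall[where m = t])
    show "0 \<le> growth_rate / n" "0 \<le> noise \<omega> / n" using gr nn n_pos by simp_all
    show "0 \<le> expect 0 (square_dev 0)" by (simp add: square_dev_def sum_nonneg)
    fix t' assume "t' < t"
    then have t': "real (Suc t') \<le> horizon * n" and t0: "real t' \<le> horizon * n" using t by auto
    define F where "F = 4 * (N ^ 2 + 1) * ((\<alpha> + \<beta>) * ratio_error) * N * dev_max / c + 2 * N * dev_max * \<omega> + 16 * N / n"
    have "expect (Suc t') (square_dev (Suc t')) \<le>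
       expect t' (\<lambda>G. (1 + growth_rate / n) * square_dev t' G + (F + 2 * N * dev_max * step_error G) / n)"
      unfolding expect_Suc
    proof (rule expect_mono)
      fix G assume G: "G \<in> set_pmf (graph_process l r \<alpha> \<beta> t')"
      show "expect_step G (square_dev (Suc t')) \<le>
         (1 + growth_rate / n) * square_dev t' G + (F + 2 * N * dev_max * step_error G) / n"
        using total_square_dev_step[OF t' G \<open>0 \<le> \<omega>\<close> \<omega>] by (simp add: F_def distrib_left add_ac)
    qed
    also have "\<dots> = (1 + growth_rate / n) * expect t' (square_dev t') + (F + 2 * N * dev_max * expect t' step_error) / n"
      by (simp add: add_divide_distrib)
    also have "expect t' step_error \<le> (2 * (\<beta> + 1) * real K * C + cube_bound) / (c * n)"
    proof -
      have "expect t' step_error = (2 * (\<beta> + 1) * real K * C * n + expect t' cubes) / (c * n ^ 2)"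
        unfolding step_error_def by simp
      also have "\<dots> \<le> (2 * (\<beta> + 1) * real K * C * n + cube_bound * n) / (c * n ^ 2)"
        using expect_cubes[OF t0] c_pos by (intro divide_right_mono) auto
      also have "\<dots> = (2 * (\<beta> + 1) * real K * C + cube_bound) * n / (c * n * n)"
        by (simp add: distrib_right power2_eq_square mult.assoc)
      also have "\<dots> = (2 * (\<beta> + 1) * real K * C + cube_bound) / (c * n)"
        using n_pos by simp
      finally show ?thesis .
    qed
    finally have "expect (Suc t') (square_dev (Suc t')) \<le> (1 + growth_rate / n) * expect t' (square_dev t') +
      (F + 2 * N * dev_max * ((2 * (\<beta> + 1) * real K * C + cube_bound) / (c * n))) / n"
      using N_nonneg dev_max_nonneg n_pos by (simp add: mult_left_mono divide_right_mono)
    also have "F + 2 * N * dev_max * ((2 * (\<beta> + 1) * real K * C + cube_bound) / (c * n)) = noise \<omega>"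
      unfolding F_def noise_def by (simp add: distrib_left)
    finally show "expect (Suc t') (square_dev (Suc t')) \<le> (1 + growth_rate / n) * expect t' (square_dev t') + noise \<omega> / n" .
  qed simp
  also have "\<dots> \<le> exp (growth_rate * horizon) * (N * ratio_error ^ 2 + horizon * noise \<omega>)"
  proof (rule mult_mono)
    have th: "real t / n \<le> horizon" using t n_pos by (simp add: field_simps)
    then have "growth_rate * (real t / n) \<le> growth_rate * horizon" using gr by (rule mult_left_mono)
    then show "exp (growth_rate / n * real t) \<le> exp (growth_rate * horizon)" by simp
    have "square_dev 0 {} \<le> (\<Sum>T\<in>types. ratio_error ^ 2)"
      unfolding square_dev_def
    proof (rule sum_mono)
      fix T
      have "\<bar>dev 0 T {}\<bar> \<le> ratio_error"
        by (auto simp: dev_def count_type_empty lim.density_0 ratio_error_def)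
      then show "dev 0 T {} ^ 2 \<le> ratio_error ^ 2"
        using ratio_error_nonneg abs_le_square_iff[of "dev 0 T {}" ratio_error] by simp
    qed
    then have "expect 0 (square_dev 0) \<le> N * ratio_error ^ 2" by (simp add: N_def)
    moreover have "real t / n * noise \<omega> \<le> horizon * noise \<omega>" using th nn by (rule mult_right_mono)
    ultimately show "expect 0 (square_dev 0) + real t * (noise \<omega> / n) \<le> N * ratio_error ^ 2 + horizon * noise \<omega>" by simp
    show "0 \<le> expect 0 (square_dev 0) + real t * (noise \<omega> / n)"
      using nn n_pos by (simp add: square_dev_def sum_nonneg)
  qed simp
  finally show ?thesis .
qed

end

text \<open>The bound of \<open>expect_square_dev\<close> as an explicit function of \<theta> (the
  ratio error), \<nu> (the value 1 / n) and the modulus \<omega>, so that n can tend to infinity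
  outside the locale.\<close>

definition fluid_error :: "real \<Rightarrow> real \<Rightarrow> real \<Rightarrow> real \<Rightarrow> real \<Rightarrow> real \<Rightarrow> real \<Rightarrow> nat \<Rightarrow> real \<Rightarrow> real \<Rightarrow> real \<Rightarrow> real" where
  "fluid_error \<alpha> \<beta> l0 r0 c C h K \<theta> \<nu> \<omega> =
    (let N = real (card ({..K} \<times> {..K} \<times> {..K}));
         dm = 1 + (h + \<alpha> * l0) / \<alpha> + (h + \<beta> * r0) / \<beta>;
         cb = exp ((3 + 3 / \<alpha> + 1 / \<alpha> ^ 2 + (3 + 3 / \<beta> + 1 / \<beta> ^ 2)) * C / c * h) * (\<alpha> ^ 3 + \<beta> ^ 3)
     in exp (4 * (N ^ 2 + 1) * ((\<alpha> + \<beta> + 1) * real K) * N / c * h) *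
        (N * \<theta> ^ 2 + h * (4 * (N ^ 2 + 1) * ((\<alpha> + \<beta>) * \<theta>) * N * dm / c
          + 2 * N * dm * ((2 * (\<beta> + 1) * real K * C + cb) / c * \<nu> + \<omega>) + 16 * N * \<nu>)))"

text \<open>The limit is linear in \<omega> with a factor independent of \<omega>; hence \<omega>
  can be fixed small before n tends to infinity.\<close>

lemma fluid_error_tendsto:
  assumes "(\<theta> \<longlongrightarrow> 0) F" "(\<nu> \<longlongrightarrow> 0) F"
  shows "\<exists>D. \<forall>\<omega>. ((\<lambda>k. fluid_error \<alpha> \<beta> l0 r0 c C h K (\<theta> k) (\<nu> k) \<omega>) \<longlongrightarrow> D * \<omega>) F"
proof -
  define N where "N = real (card ({..K} \<times> {..K} \<times> {..K}))"
  define dm where "dm = 1 + (h + \<alpha> * l0) / \<alpha> + (h + \<beta> * r0) / \<beta>"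
  define cb where "cb = exp ((3 + 3 / \<alpha> + 1 / \<alpha> ^ 2 + (3 + 3 / \<beta> + 1 / \<beta> ^ 2)) * C / c * h) * (\<alpha> ^ 3 + \<beta> ^ 3)"
  define E where "E = exp (4 * (N ^ 2 + 1) * ((\<alpha> + \<beta> + 1) * real K) * N / c * h)"
  define Q where "Q = 4 * (N ^ 2 + 1) * (\<alpha> + \<beta>) * N * dm / c"
  define S where "S = (2 * (\<beta> + 1) * real K * C + cb) / c"
  have eq: "fluid_error \<alpha> \<beta> l0 r0 c C h K x y \<omega> =
      E * (N * x ^ 2 + h * (Q * x + 2 * N * dm * (S * y + \<omega>) + 16 * N * y))" for x y \<omega>
    unfolding fluid_error_def Let_def N_def[symmetric] dm_def[symmetric] cb_def[symmetric] E_def Q_def S_def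
    by (simp add: mult_ac)
  have "((\<lambda>k. fluid_error \<alpha> \<beta> l0 r0 c C h K (\<theta> k) (\<nu> k) \<omega>) \<longlongrightarrow> E * (N * 0 ^ 2 + h * (Q * 0 + 2 * N * dm * (S * 0 + \<omega>) + 16 * N * 0))) F" for \<omega>
    unfolding eq by (intro tendsto_intros assms)
  then show ?thesis by (intro exI[of _ "E * h * (2 * N * dm)"]) (simp add: mult_ac)
qed

context fluid_limit
begin

lemma expect_square_dev':
  assumes "real t \<le> horizon * real (l + r)" and "0 \<le> \<omega>"
    and "\<And>T x y. T \<in> {..K} \<times> {..K} \<times> {..K} \<Longrightarrow> 0 \<le> x \<Longrightarrow> x \<le> horizon \<Longrightarrow> 0 \<le> y \<Longrightarrow> y \<le> horizon \<Longrightarrow>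
      \<bar>x - y\<bar> \<le> 1 / real (l + r) \<Longrightarrow> \<bar>lim.limit_drift T x - lim.limit_drift T y\<bar> \<le> \<omega>"
  shows "expect t (\<lambda>G. \<Sum>T\<in>{..K} \<times> {..K} \<times> {..K}. (real (count_type l r G T) / real (l + r) - lim.density T (real t / real (l + r))) ^ 2)
    \<le> fluid_error \<alpha> \<beta> l0 r0 c C horizon K (\<bar>real l / real (l + r) - l0\<bar> + \<bar>real r / real (l + r) - r0\<bar>) (1 / real (l + r)) \<omega>"
proof -
  have "expect t (square_dev t) \<le> exp (growth_rate * horizon) * (N * ratio_error ^ 2 + horizon * noise \<omega>)"
    using assms by (intro expect_square_dev) (auto simp: n_def types_def)
  also have "exp (growth_rate * horizon) * (N * ratio_error ^ 2 + horizon * noise \<omega>) =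
    fluid_error \<alpha> \<beta> l0 r0 c C horizon K ratio_error (1 / n) \<omega>"
    unfolding fluid_error_def Let_def noise_def growth_rate_def N_def types_def dev_max_def cube_bound_def cube_rate_def by simp
  finally show ?thesis
    by (simp add: square_dev_def[abs_def] dev_def types_def ratio_error_def n_def)
qed

end

section \<open>Sequences of processes with converging ratios\<close>

locale bipartite_sequence = limit_params \<alpha> \<beta> l0 r0 for \<alpha> \<beta> l0 r0 :: real +
  fixes L R :: "nat \<Rightarrow> nat"
  assumes size_at_top: "filterlim (\<lambda>k. real (L k + R k)) at_top sequentially"
    and left_ratio: "(\<lambda>k. real (L k) / real (L k + R k)) \<longlonglongrightarrow> l0"
    and right_ratio: "(\<lambda>k. real (R k) / real (L k + R k)) \<longlonglongrightarrow> r0"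
begin

abbreviation total :: "nat \<Rightarrow> real" where "total k \<equiv> real (L k + R k)"

abbreviation law :: "nat \<Rightarrow> nat \<Rightarrow> graph pmf" where "law k t \<equiv> graph_process (L k) (R k) \<alpha> \<beta> t"

lemma process: "process \<alpha> \<beta>"
  using \<alpha>_pos \<beta>_pos by unfold_locales

lemma inverse_size: "(\<lambda>k. 1 / total k) \<longlonglongrightarrow> 0"
  using size_at_top by (intro tendsto_divide_0[OF tendsto_const] filterlim_at_top_imp_at_infinity)

lemma eventually_fluid_limit:
  assumes "0 \<le> h"
  shows "\<exists>c C. \<forall>\<^sub>F k in sequentially. fluid_limit (L k) (R k) \<alpha> \<beta> l0 r0 c C h"
proof -
  \<comment> \<open>Eventually each part has at least half its limiting share, so there are at least
    l0 r0 n^2 / 4 pairs. Half of this absorbs the h n occupied pairs, and l0 r0 / 8 remains.\<close>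
  define c where "c = min (min (\<alpha> * l0 / 2) (\<beta> * r0 / 2)) (\<alpha> * \<beta> * (l0 * r0 / 8))"
  have c: "0 < c" "c \<le> \<alpha> * l0 / 2" "c \<le> \<beta> * r0 / 2" "c \<le> \<alpha> * \<beta> * (l0 * r0 / 8)"
    using \<alpha>_pos \<beta>_pos l_pos r_pos by (auto simp: c_def)
  have "\<forall>\<^sub>F k in sequentially. l0 / 2 < real (L k) / total k"
    using left_ratio l_pos by (intro order_tendstoD(1)) auto
  moreover have "\<forall>\<^sub>F k in sequentially. r0 / 2 < real (R k) / total k"
    using right_ratio r_pos by (intro order_tendstoD(1)) auto
  moreover have "((\<lambda>k. h * (1 / total k)) \<longlongrightarrow> h * 0) sequentially"
    by (intro tendsto_intros inverse_size)
  then have "\<forall>\<^sub>F k in sequentially. h * (1 / total k) < l0 * r0 / 8"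
    using l_pos r_pos by (intro order_tendstoD(2)) auto
  moreover have "\<forall>\<^sub>F k in sequentially. 0 < total k"
    using size_at_top by (simp only: filterlim_at_top_dense)
  ultimately have "\<forall>\<^sub>F k in sequentially. fluid_limit (L k) (R k) \<alpha> \<beta> l0 r0 c (h + \<alpha> + \<beta>) h"
  proof eventually_elim
    case (elim k)
    define n where "n = total k"
    have n: "0 < n" "real (L k) \<ge> l0 / 2 * n" "real (R k) \<ge> r0 / 2 * n" "h \<le> l0 * r0 / 8 * n"
      using elim by (simp_all add: n_def field_simps)
    have LR: "(l0 / 2 * n) * (r0 / 2 * n) \<le> real (L k) * real (R k)"
      using n l_pos r_pos by (intro mult_mono) auto
    show ?case
    proof unfold_locales
      show "0 < \<alpha>" "0 < \<beta>" "0 < c" "0 \<le> h" "h + \<alpha> \<le> h + \<alpha> + \<beta>" "h + \<beta> \<le> h + \<alpha> + \<beta>"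
        using \<alpha>_pos \<beta>_pos c assms by auto
      show "0 < L k + R k" using n(1) unfolding n_def by (simp only: of_nat_0_less_iff)
      have "c * n \<le> \<alpha> * l0 / 2 * n" "c * n \<le> \<beta> * r0 / 2 * n" using c n by (auto intro!: mult_right_mono)
      moreover have "\<alpha> * (l0 / 2 * n) \<le> \<alpha> * real (L k)" "\<beta> * (r0 / 2 * n) \<le> \<beta> * real (R k)"
        using n \<alpha>_pos \<beta>_pos by (auto intro!: mult_left_mono)
      ultimately show "c * total k \<le> \<alpha> * real (L k)" "c * total k \<le> \<beta> * real (R k)" by (simp_all add: n_def)
      have "h * n \<le> l0 * r0 / 8 * n * n" using n by (intro mult_right_mono) auto
      then have "l0 * r0 / 8 * n ^ 2 \<le> real (L k) * real (R k) - h * n"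
      proof -
        have "(l0 / 2 * n) * (r0 / 2 * n) = 2 * (l0 * r0 / 8 * n * n)" "l0 * r0 / 8 * n ^ 2 = l0 * r0 / 8 * n * n"
          by (simp_all add: power2_eq_square)
        then show ?thesis using LR \<open>h * n \<le> l0 * r0 / 8 * n * n\<close> by linarith
      qed
      then have "\<alpha> * \<beta> * (l0 * r0 / 8 * n ^ 2) \<le> \<alpha> * \<beta> * (real (L k) * real (R k) - h * n)"
        using \<alpha>_pos \<beta>_pos by (intro mult_left_mono) auto
      moreover have "c * n ^ 2 \<le> \<alpha> * \<beta> * (l0 * r0 / 8) * n ^ 2" using c by (intro mult_right_mono) auto
      moreover have "\<alpha> * \<beta> * (l0 * r0 / 8) * n ^ 2 = \<alpha> * \<beta> * (l0 * r0 / 8 * n ^ 2)" by (simp only: mult.assoc)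
      ultimately have "c * n ^ 2 \<le> \<alpha> * \<beta> * (real (L k) * real (R k) - h * n)" by linarith
      then show "c * total k ^ 2 \<le> \<alpha> * \<beta> * (real (L k) * real (R k) - h * total k)"
        by (simp only: n_def)
    qed
  qed
  then show ?thesis by blast
qed

lemma uniform_modulus:
  assumes "0 < \<omega>"
  shows "\<forall>\<^sub>F k in sequentially. \<forall>T\<in>{..K} \<times> {..K} \<times> {..K}. \<forall>x y. 0 \<le> x \<longrightarrow> x \<le> h \<longrightarrow> 0 \<le> y \<longrightarrow> y \<le> h \<longrightarrow>
      \<bar>x - y\<bar> \<le> 1 / total k \<longrightarrow> \<bar>limit_drift T x - limit_drift T y\<bar> \<le> \<omega>"
proof (rule eventually_ball_finite)
  show "\<forall>T\<in>{..K} \<times> {..K} \<times> {..K}. \<forall>\<^sub>F k in sequentially. \<forall>x y. 0 \<le> x \<longrightarrow> x \<le> h \<longrightarrow> 0 \<le> y \<longrightarrow> y \<le> h \<longrightarrow>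
      \<bar>x - y\<bar> \<le> 1 / total k \<longrightarrow> \<bar>limit_drift T x - limit_drift T y\<bar> \<le> \<omega>"
  proof
    fix T
    have "uniformly_continuous_on {0..h} (limit_drift T)"
      using continuous_on_subset[OF continuous_on_limit_drift, of "{0..h}" T]
      by (intro compact_uniformly_continuous) auto
    then obtain d where d: "0 < d" "\<And>x y. x \<in> {0..h} \<Longrightarrow> y \<in> {0..h} \<Longrightarrow> dist y x < d \<Longrightarrow> dist (limit_drift T y) (limit_drift T x) < \<omega>"
      unfolding uniformly_continuous_on_def using assms by metis
    have "\<forall>\<^sub>F k in sequentially. 1 / total k < d" using inverse_size d(1) by (rule order_tendstoD(2))
    then show "\<forall>\<^sub>F k in sequentially. \<forall>x y. 0 \<le> x \<longrightarrow> x \<le> h \<longrightarrow> 0 \<le> y \<longrightarrow> y \<le> h \<longrightarrow>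
      \<bar>x - y\<bar> \<le> 1 / total k \<longrightarrow> \<bar>limit_drift T x - limit_drift T y\<bar> \<le> \<omega>"
    proof eventually_elim
      case (elim k)
      show ?case
      proof (intro allI impI)
        fix x y :: real
        assume "0 \<le> x" "x \<le> h" "0 \<le> y" "y \<le> h" "\<bar>x - y\<bar> \<le> 1 / total k"
        then have "dist (limit_drift T x) (limit_drift T y) < \<omega>"
          using elim by (intro d(2)) (auto simp: dist_real_def)
        then show "\<bar>limit_drift T x - limit_drift T y\<bar> \<le> \<omega>" by (simp add: dist_real_def)
      qed
    qed
  qed
qed auto

lemma square_deviation:
  assumes "0 \<le> h" "0 < \<epsilon>"
  shows "\<forall>\<^sub>F k in sequentially. \<forall>t. real t \<le> h * total k \<longrightarrow>
    measure_pmf.expectation (law k t)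
      (\<lambda>G. \<Sum>T\<in>{..K} \<times> {..K} \<times> {..K}. (real (count_type (L k) (R k) G T) / total k - density T (real t / total k)) ^ 2) \<le> \<epsilon>"
proof -
  obtain c C where fl: "\<forall>\<^sub>F k in sequentially. fluid_limit (L k) (R k) \<alpha> \<beta> l0 r0 c C h"
    using eventually_fluid_limit[OF assms(1)] by blast
  define \<theta> where "\<theta> k = \<bar>real (L k) / total k - l0\<bar> + \<bar>real (R k) / total k - r0\<bar>" for k
  have "(\<lambda>k. \<bar>real (L k) / total k - l0\<bar> + \<bar>real (R k) / total k - r0\<bar>) \<longlonglongrightarrow> \<bar>l0 - l0\<bar> + \<bar>r0 - r0\<bar>"
    by (intro tendsto_intros left_ratio right_ratio)
  then have \<theta>: "\<theta> \<longlonglongrightarrow> 0" by (simp add: \<theta>_def[abs_def])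
  obtain D where D: "\<And>\<omega>. (\<lambda>k. fluid_error \<alpha> \<beta> l0 r0 c C h K (\<theta> k) (1 / total k) \<omega>) \<longlonglongrightarrow> D * \<omega>"
    using fluid_error_tendsto[OF \<theta> inverse_size, of \<alpha> \<beta> l0 r0 c C h K] by blast
  \<comment> \<open>This makes the limiting error D \<omega> smaller than \<epsilon>; the added 1
    avoids a division by 0.\<close>
  define \<omega> where "\<omega> = \<epsilon> / (2 * (\<bar>D\<bar> + 1))"
  have \<omega>: "0 < \<omega>" using assms(2) by (simp add: \<omega>_def)
  have "D * \<omega> \<le> \<bar>D\<bar> * \<omega>" using \<omega> by (intro mult_right_mono) auto
  also have "\<dots> < (2 * (\<bar>D\<bar> + 1)) * \<omega>" using \<omega> by (intro mult_strict_right_mono) auto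
  also have "\<dots> = \<epsilon>" unfolding \<omega>_def by simp
  finally have "\<forall>\<^sub>F k in sequentially. fluid_error \<alpha> \<beta> l0 r0 c C h K (\<theta> k) (1 / total k) \<omega> < \<epsilon>"
    by (intro order_tendstoD(2)[OF D])
  with fl uniform_modulus[OF \<omega>, of K h] show ?thesis
  proof eventually_elim
    case (elim k)
    interpret fl: fluid_limit "L k" "R k" \<alpha> \<beta> l0 r0 c C h K by (rule elim(1))
    show ?case
    proof (intro allI impI)
      fix t assume t: "real t \<le> h * total k"
      show "measure_pmf.expectation (law k t)
      (\<lambda>G. \<Sum>T\<in>{..K} \<times> {..K} \<times> {..K}. (real (count_type (L k) (R k) G T) / total k - density T (real t / total k)) ^ 2) \<le> \<epsilon>"
        using fl.expect_square_dev'[OF t less_imp_le[OF \<omega>]] elim(2,3) unfolding \<theta>_def by force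
    qed
  qed
qed

end

section \<open>The vertices in small components\<close>

definition small_mass :: "nat \<Rightarrow> nat \<Rightarrow> nat \<Rightarrow> graph \<Rightarrow> nat" where
  "small_mass l r m G = (\<Sum>C\<in>{C \<in> components l r G. card C \<le> m}. card C)"

definition type_size :: "ctype \<Rightarrow> nat" where
  "type_size T = (case T of (a, b, e) \<Rightarrow> a + b)"

context bipartite_graph
begin

lemma component_subset: "C \<in> components l r G \<Longrightarrow> C \<subseteq> vertices l r"
  unfolding components_eq using component_subset_vertices by auto

lemma type_size_component:
  assumes "C \<in> components l r G"
  shows "type_size (component_type l r G C) = card C"
proof -
  have sub: "C \<subseteq> vertices l r" by (rule component_subset[OF assms])
  then have "C = (C \<inter> left_part l) \<union> (C \<inter> right_part r)" by (auto simp: vertices_def)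
  moreover have "card ((C \<inter> left_part l) \<union> (C \<inter> right_part r)) = card (C \<inter> left_part l) + card (C \<inter> right_part r)"
    using parts_disjoint[of l r] by (intro card_Un_disjoint) auto
  ultimately show ?thesis by (simp add: type_size_def component_type_def)
qed

text \<open>Inside a component of at most m vertices every degree is at most m, so there are at most
  m^2 edges; m + m * m is a common bound for all three coordinates.\<close>

lemma component_type_bounded:
  assumes "C \<in> components l r G" "card C \<le> m"
  shows "component_type l r G C \<in> {..m + m * m} \<times> {..m + m * m} \<times> {..m + m * m}"
proof -
  have sub: "C \<subseteq> vertices l r" by (rule component_subset[OF assms(1)])
  then have fin: "finite C" using finite_parts(3) finite_subset by blast
  have a: "card (C \<inter> left_part l) \<le> m" "card (C \<inter> right_part r) \<le> m"
    using assms(2) card_mono[OF fin, of "C \<inter> left_part l"] card_mono[OF fin, of "C \<inter> right_part r"] by auto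
  have "(\<Sum>x\<in>C \<inter> left_part l. degree G x) \<le> (\<Sum>x\<in>C \<inter> left_part l. m)"
  proof (rule sum_mono)
    fix x assume x: "x \<in> C \<inter> left_part l"
    have "{v \<in> right_part r. {x, v} \<in> G} \<subseteq> C \<inter> right_part r"
      using x component_edge[of x G x] component_eq_if_mem[OF assms(1), of x] by auto
    then have "degree G x \<le> card (C \<inter> right_part r)"
      unfolding degree_left[OF IntD2[OF x]] by (intro card_mono) auto
    then show "degree G x \<le> m" using a by simp
  qed
  also have "\<dots> \<le> m * m" using a by simp
  finally show ?thesis using a by (auto simp: component_type_def)
qed

lemma small_mass_eq:
  "real (small_mass l r m G) =
    (\<Sum>T\<in>{..m + m * m} \<times> {..m + m * m} \<times> {..m + m * m}. of_bool (type_size T \<le> m) * real (type_size T) * real (count_type l r G T))"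
proof -
  let ?S = "{..m + m * m} \<times> {..m + m * m} \<times> {..m + m * m}"
  have "(\<Sum>T\<in>?S. of_bool (type_size T \<le> m) * real (type_size T) * real (count_type l r G T)) =
    (\<Sum>C\<in>components l r G. \<Sum>T\<in>?S. of_bool (type_size T \<le> m) * real (type_size T) * of_bool (component_type l r G C = T))"
    unfolding count_type_sum sum_distrib_left by (rule sum.swap)
  also have "\<dots> = (\<Sum>C\<in>components l r G. if card C \<le> m then real (card C) else 0)"
  proof (rule sum.cong[OF refl])
    fix C assume C: "C \<in> components l r G"
    have "(\<Sum>T\<in>?S. of_bool (type_size T \<le> m) * real (type_size T) * of_bool (component_type l r G C = T)) =
      (\<Sum>T\<in>?S. if T = component_type l r G C then of_bool (card C \<le> m) * real (card C) else 0)"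
      by (intro sum.cong refl) (auto simp: type_size_component[OF C] of_bool_def)
    also have "\<dots> = (if component_type l r G C \<in> ?S then of_bool (card C \<le> m) * real (card C) else 0)"
      by (rule sum.delta) simp
    also have "\<dots> = (if card C \<le> m then real (card C) else 0)"
      using component_type_bounded[OF C, of m] by auto
    finally show "(\<Sum>T\<in>?S. of_bool (type_size T \<le> m) * real (type_size T) * of_bool (component_type l r G C = T)) =
      (if card C \<le> m then real (card C) else 0)" .
  qed
  also have "\<dots> = real (small_mass l r m G)"
    unfolding small_mass_def of_nat_sum by (simp add: sum.inter_filter)
  finally show ?thesis by simp
qed

end

context limit_params
begin

definition small_density :: "nat \<Rightarrow> real \<Rightarrow> real" where
  "small_density m s = (\<Sum>n\<le>m. \<Sum>a\<le>n. real n * tree_density s a (n - a))"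

lemma small_density_eq:
  "small_density m s =
    (\<Sum>T\<in>{..m + m * m} \<times> {..m + m * m} \<times> {..m + m * m}. of_bool (type_size T \<le> m) * real (type_size T) * density T s)"
proof -
  let ?S = "{..m + m * m} \<times> {..m + m * m} \<times> {..m + m * m}"
  have "small_density m s = (\<Sum>(n, a)\<in>(SIGMA n:{..m}. {..n}). real n * tree_density s a (n - a))"
    unfolding small_density_def by (rule sum.Sigma) auto
  also have "\<dots> = (\<Sum>(n, a)\<in>{(n, a). 0 < n \<and> n \<le> m \<and> a \<le> n}. real n * tree_density s a (n - a))"
    by (rule sum.mono_neutral_right) auto
  also have "\<dots> = (\<Sum>T\<in>{(a, b, e). 0 < a + b \<and> a + b \<le> m \<and> Suc e = a + b}. real (type_size T) * density T s)"
    by (rule sum.reindex_bij_witness[where i = "\<lambda>T. (type_size T, fst T)" and j = "\<lambda>p. (snd p, fst p - snd p, fst p - 1)"])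
      (auto simp: type_size_def density_def)
  also have "\<dots> = (\<Sum>T\<in>?S. of_bool (type_size T \<le> m) * real (type_size T) * density T s)"
    by (rule sum.mono_neutral_cong_left) (auto simp: type_size_def density_def split: if_splits)
  finally show ?thesis .
qed

lemma small_density_tendsto: "0 \<le> s \<Longrightarrow> (\<lambda>m. small_density m s) \<longlonglongrightarrow> finite_mass s"
  unfolding small_density_def[abs_def] by (rule tree_density_sum)

lemma small_density_le: 
  assumes "0 \<le> s" shows "small_density m s \<le> finite_mass s"
proof (rule incseq_le[OF _ small_density_tendsto[OF assms]])
  show "incseq (\<lambda>m. small_density m s)"
    unfolding small_density_def
    by (intro incseq_SucI sum_mono2) (auto intro!: sum_nonneg mult_nonneg_nonneg tree_density_nonneg[OF assms])
qed

lemma small_density_cont: "0 \<le> s \<Longrightarrow> isCont (small_density m) s"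
  unfolding small_density_eq[abs_def] using DERIV_isCont[OF density_deriv] by (intro continuous_intros)

end

context bipartite_sequence
begin

text \<open>Chebyshev's inequality: the deviation is a finite linear combination of the deviations
  of the types, which Cauchy-Schwarz reduces to the sum of squares in
  \<open>square_deviation\<close>. Half of \<delta> is reserved for replacing the current time by
  its limit s.\<close>

lemma small_mass_concentration:
  assumes s: "0 \<le> s" and t: "(\<lambda>k. real (t k) / total k) \<longlonglongrightarrow> s" and \<delta>: "0 < \<delta>"
  shows "(\<lambda>k. measure_pmf.prob (law k (t k)) {G. \<bar>real (small_mass (L k) (R k) m G) / total k - small_density m s\<bar> > \<delta>}) \<longlonglongrightarrow> 0"
proof -
  define S where "S = {..m + m * m} \<times> {..m + m * m} \<times> {..m + m * m}"
  define D where "D k G = (\<Sum>T\<in>S. (real (count_type (L k) (R k) G T) / total k - density T (real (t k) / total k)) ^ 2)" for k G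
  \<comment> \<open>Cauchy-Schwarz contributes the number of types; each coefficient is a component
    size, at most m.\<close>
  define M where "M = real (card S) * real m ^ 2"
  have ev_size: "\<forall>\<^sub>F k in sequentially. 0 < total k"
    using size_at_top by (simp only: filterlim_at_top_dense)
  have cont: "(\<lambda>k. small_density m (real (t k) / total k)) \<longlonglongrightarrow> small_density m s"
    by (rule isCont_tendsto_compose[OF small_density_cont[OF s] t])
  have ev_t: "\<forall>\<^sub>F k in sequentially. real (t k) / total k < s + 1"
    using t by (rule order_tendstoD(2)) simp
  have ev_c: "\<forall>\<^sub>F k in sequentially. \<bar>small_density m (real (t k) / total k) - small_density m s\<bar> < \<delta> / 2"
    using tendstoD[OF cont, of "\<delta> / 2"] \<delta> by (simp add: dist_real_def)
  show ?thesis
  proof (rule LIMSEQ_I)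
    fix \<epsilon> :: real assume \<epsilon>: "0 < \<epsilon>"
    \<comment> \<open>The Chebyshev bound becomes \<epsilon> M / (2 (M + 1)), and the 1 covers M =
      0.\<close>
    define \<epsilon>' where "\<epsilon>' = \<epsilon> * (\<delta> / 2) ^ 2 / (2 * (M + 1))"
    have M: "0 \<le> M" by (simp add: M_def)
    have \<epsilon>': "0 < \<epsilon>'" using \<epsilon> \<delta> M by (simp add: \<epsilon>'_def)
    have "\<forall>\<^sub>F k in sequentially. measure_pmf.prob (law k (t k)) {G. \<bar>real (small_mass (L k) (R k) m G) / total k - small_density m s\<bar> > \<delta>} < \<epsilon>"
      using square_deviation[OF add_nonneg_nonneg[OF s zero_le_one] \<epsilon>', of "m + m * m", folded S_def] ev_t ev_c ev_size
    proof eventually_elim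
      case (elim k)
      interpret process "L k" "R k" \<alpha> \<beta> by (rule process)
      let ?E = "{G. \<bar>real (small_mass (L k) (R k) m G) / total k - small_density m s\<bar> > \<delta>}"
      have "real (t k) \<le> (s + 1) * total k" using elim(2,4) by (simp add: field_simps)
      then have ED: "expect (t k) (D k) \<le> \<epsilon>'" using elim(1) unfolding D_def by blast
      have "measure_pmf.prob (law k (t k)) ?E = expect (t k) (indicator ?E)" by simp
      also have "\<dots> \<le> expect (t k) (\<lambda>G. M * D k G / (\<delta> / 2) ^ 2)"
      proof (rule expect_mono)
        fix G assume G: "G \<in> set_pmf (law k (t k))"
        interpret bipartite_graph "L k" "R k" G using reachable[OF G] by unfold_locales simp
        define x where "x T = real (count_type (L k) (R k) G T) / total k - density T (real (t k) / total k)" for T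
        define X where "X = real (small_mass (L k) (R k) m G) / total k - small_density m (real (t k) / total k)"
        have "X = (\<Sum>T\<in>S. of_bool (type_size T \<le> m) * real (type_size T) * x T)"
          unfolding X_def small_mass_eq small_density_eq x_def S_def
          by (simp add: sum_divide_distrib sum_subtractf[symmetric] right_diff_distrib)
        also have "\<bar>\<dots>\<bar> \<le> (\<Sum>T\<in>S. real m * \<bar>x T\<bar>)"
          by (intro order_trans[OF sum_abs] sum_mono) (auto simp: abs_mult of_bool_def intro!: mult_right_mono)
        finally have "\<bar>X\<bar> \<le> real m * (\<Sum>T\<in>S. \<bar>x T\<bar>)" by (simp add: sum_distrib_left)
        then have "\<bar>X\<bar> ^ 2 \<le> (real m * (\<Sum>T\<in>S. \<bar>x T\<bar>)) ^ 2" by (rule power_mono) simp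
        also have "\<dots> \<le> real m ^ 2 * ((\<Sum>T\<in>S. \<bar>x T\<bar> ^ 2) * real (card S))"
          unfolding power_mult_distrib by (intro mult_left_mono sum_squared_le_sum_of_squares) (auto simp: S_def)
        also have "\<dots> = M * D k G" by (simp add: M_def D_def x_def)
        finally have X2: "\<bar>X\<bar> ^ 2 \<le> M * D k G" .
        show "indicator ?E G \<le> M * D k G / (\<delta> / 2) ^ 2"
        proof (cases "G \<in> ?E")
          case True
          then have "\<delta> < \<bar>real (small_mass (L k) (R k) m G) / total k - small_density m s\<bar>"
            by (simp only: mem_Collect_eq)
          then have "\<delta> / 2 \<le> \<bar>X\<bar>" using elim(3) unfolding X_def by linarith
          then have "(\<delta> / 2) ^ 2 \<le> \<bar>X\<bar> ^ 2" using \<delta> by (intro power_mono) auto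
          then have "(\<delta> / 2) ^ 2 \<le> M * D k G" using X2 by linarith
          then show ?thesis using True \<delta> by simp
        next
          case False
          have "0 \<le> M * D k G" using X2 zero_le_power2[of "\<bar>X\<bar>"] by linarith
          then show ?thesis using False by simp
        qed
      qed
      also have "\<dots> = M * expect (t k) (D k) / (\<delta> / 2) ^ 2" by simp
      also have "\<dots> \<le> M * \<epsilon>' / (\<delta> / 2) ^ 2"
        using ED M by (intro divide_right_mono mult_left_mono) auto
      also have "\<dots> = \<epsilon> * (M / (2 * (M + 1)))" using \<delta> by (simp add: \<epsilon>'_def)
      also have "\<dots> < \<epsilon> * 1" using \<epsilon> M by (intro mult_strict_left_mono) (auto simp: divide_simps)
      finally show ?case by simp
    qed
    then obtain k0 where "\<And>k. k \<ge> k0 \<Longrightarrow> measure_pmf.prob (law k (t k)) {G. \<bar>real (small_mass (L k) (R k) m G) / total k - small_density m s\<bar> > \<delta>} < \<epsilon>"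
      unfolding eventually_sequentially by blast
    then show "\<exists>no. \<forall>k\<ge>no. norm (measure_pmf.prob (law k (t k)) {G. \<bar>real (small_mass (L k) (R k) m G) / total k - small_density m s\<bar> > \<delta>} - 0) < \<epsilon>"
      by (intro exI[of _ k0]) auto
  qed
qed

end

section \<open>The two largest components\<close>

definition big_mass :: "nat \<Rightarrow> nat \<Rightarrow> nat \<Rightarrow> graph \<Rightarrow> nat" where
  "big_mass l r m G = (\<Sum>C\<in>{C \<in> components l r G. m < card C}. card C)"

lemma mset_component_sizes: "mset (component_sizes l r G) = image_mset card (mset_set (components l r G))"
  by (simp add: component_sizes_def)

lemma sorted_component_sizes: "sorted_wrt (\<ge>) (component_sizes l r G)"
  by (simp add: component_sizes_def sorted_wrt_rev)

lemma set_component_sizes: "set (component_sizes l r G) = card ` components l r G"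
proof -
  have "set (component_sizes l r G) = set_mset (mset (component_sizes l r G))" by simp
  then show ?thesis unfolding mset_component_sizes by simp
qed

lemma card_le_size_C1:
  assumes "C \<in> components l r G"
  shows "card C \<le> size_C1 l r G"
proof -
  have "card C \<in> set (component_sizes l r G)" using assms by (simp add: set_component_sizes)
  then show ?thesis
    using sorted_component_sizes[of l r G] unfolding size_C1_def
    by (cases "component_sizes l r G") auto
qed

lemma big_mass_sum_list: "big_mass l r m G = sum_list (filter (\<lambda>x. m < x) (component_sizes l r G))"
proof -
  have "sum_list (filter (\<lambda>x. m < x) (component_sizes l r G)) =
    sum_mset (filter_mset (\<lambda>x. m < x) (mset (component_sizes l r G)))"
    by (simp add: sum_mset_sum_list flip: mset_filter)
  also have "\<dots> = (\<Sum>C\<in>{C \<in> components l r G. m < card C}. card C)"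
    unfolding mset_component_sizes by (simp add: filter_mset_image_mset sum_unfold_sum_mset)
  finally show ?thesis by (simp add: big_mass_def)
qed

lemma size_C1_le: "size_C1 l r G \<le> max m (big_mass l r m G)"
  unfolding size_C1_def big_mass_sum_list
  by (cases "component_sizes l r G") auto

text \<open>If the second entry of the descending list exceeds m, then the first two entries,
  possibly equal, are distinct summands of the big mass.\<close>

lemma size_C2_le: "size_C2 l r G \<le> m \<or> size_C1 l r G + size_C2 l r G \<le> big_mass l r m G"
proof (cases "component_sizes l r G")
  case (Cons x xs)
  then show ?thesis
    using sorted_component_sizes[of l r G] unfolding size_C1_def size_C2_def big_mass_sum_list
    by (cases xs) auto
qed (simp add: size_C2_def)

lemma (in bipartite_graph) big_plus_small: "big_mass l r m G + small_mass l r m G = l + r"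
proof -
  have "(\<Sum>C\<in>components l r G. card C) = card (\<Union>(components l r G))"
  proof (rule card_Union_disjoint[symmetric])
    show "pairwise disjnt (components l r G)"
      using components_disjoint by (auto simp: pairwise_def disjnt_def)
    show "finite C" if "C \<in> components l r G" for C
      using component_subset[OF that] finite_parts(3) finite_subset by blast
  qed
  also have "\<Union>(components l r G) = vertices l r"
    using component_subset component_self unfolding components_eq by blast
  finally have "(\<Sum>C\<in>components l r G. card C) = l + r" by simp
  moreover have "{C \<in> components l r G. m < card C} = components l r G - {C \<in> components l r G. card C \<le> m}" by auto
  ultimately show ?thesis
    unfolding big_mass_def small_mass_def
    using sum.subset_diff[of "{C \<in> components l r G. card C \<le> m}" "components l r G" card] by simp
qed

section \<open>Sprinkling\<close>

definition separated :: "vertex set \<Rightarrow> vertex set \<Rightarrow> graph \<Rightarrow> bool" where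
  "separated A B G \<longleftrightarrow> (\<forall>x\<in>A. \<forall>y\<in>B. {x, y} \<notin> G)"

text \<open>Elements are added until the sum reaches d; the last one contributes less than d, so the
  sum stays below 2 d.\<close>

lemma exists_balanced_subset:
  fixes g :: "'a \<Rightarrow> real"
  assumes "finite F" "\<And>x. x \<in> F \<Longrightarrow> g x < d" "d \<le> sum g F" "0 < d"
  shows "\<exists>S\<subseteq>F. d \<le> sum g S \<and> sum g S < 2 * d"
  using assms
proof (induction F rule: finite_induct)
  case (insert x F)
  show ?case
  proof (cases "d \<le> sum g F")
    case True
    then have "\<exists>S\<subseteq>F. d \<le> sum g S \<and> sum g S < 2 * d" using insert by auto
    then show ?thesis by blast
  next
    case False
    moreover have "g x < d" using insert by simp
    moreover have "sum g (insert x F) = g x + sum g F" using insert by simp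
    ultimately have "d \<le> sum g (insert x F) \<and> sum g (insert x F) < 2 * d" using insert.prems(2) by linarith
    then show ?thesis by blast
  qed
qed simp

definition big_components :: "nat \<Rightarrow> nat \<Rightarrow> nat \<Rightarrow> graph \<Rightarrow> vertex set set" where
  "big_components l r m G = {C \<in> components l r G. m < card C}"

lemma finite_big_components [simp]: "finite (big_components l r m G)"
  by (simp add: big_components_def)

context bipartite_graph
begin

lemma card_Union_big:
  assumes "S \<subseteq> big_components l r m G"
  shows "card (\<Union>S) = (\<Sum>C\<in>S. card C)"
proof (rule card_Union_disjoint)
  show "pairwise disjnt S"
    unfolding pairwise_def disjnt_def
  proof (intro ballI impI)
    fix C D assume "C \<in> S" "D \<in> S" "C \<noteq> D"
    moreover from this have "C \<in> components l r G" "D \<in> components l r G" using assms by (auto simp: big_components_def)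
    ultimately show "C \<inter> D = {}" by (intro components_disjoint)
  qed
  show "finite C" if "C \<in> S" for C
  proof -
    have "C \<in> components l r G" using that assms by (auto simp: big_components_def)
    from finite_subset[OF component_subset[OF this] finite_parts(3)] show ?thesis .
  qed
qed

lemma card_big_components: "m * card (big_components l r m G) \<le> l + r"
proof -
  have "m * card (big_components l r m G) \<le> (\<Sum>C\<in>big_components l r m G. card C)"
    using sum_bounded_below[of "big_components l r m G" m card] by (simp add: big_components_def mult.commute)
  also have "\<dots> \<le> l + r"
    using big_plus_small[of m] by (simp add: big_mass_def big_components_def)
  finally show ?thesis .
qed

text \<open>Otherwise every component of \<open>H\<close> contains fewer than \<open>d\<close> of these vertices, and a greedy union of
  such components splits them into two separated parts of size at least \<open>d\<close>.\<close>

lemma giant_if_connected: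
  assumes "G \<subseteq> H" "bipartite l r H" "0 < d" "3 * d \<le> real (big_mass l r m G)"
    and conn: "\<And>S. S \<subseteq> big_components l r m G \<Longrightarrow> d \<le> real (card (\<Union>S)) \<Longrightarrow>
      d \<le> real (card (\<Union>(big_components l r m G - S))) \<Longrightarrow> \<not> separated (\<Union>S) (\<Union>(big_components l r m G - S)) H"
  shows "real (big_mass l r m G) - d \<le> real (size_C1 l r H)"
proof -
  interpret H: bipartite_graph l r H using assms by unfold_locales
  define \<B> where "\<B> = big_components l r m G"
  define U where "U = \<Union>\<B>"
  have U: "card U = big_mass l r m G"
    unfolding U_def \<B>_def using card_Union_big[OF order_refl] by (simp add: big_mass_def big_components_def)
  have UV: "U \<subseteq> vertices l r" using component_subset by (auto simp: U_def \<B>_def big_components_def)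
  then have finU: "finite U" using finite_parts(3) finite_subset by blast
  \<comment> \<open>A union of components of H cuts the vertex set U along components of G, because
    G is a subgraph of H, and no edge of H crosses the cut. So the hypothesis on separations
    excludes that both sides hold d vertices of U.\<close>
  have part: "d > real (card (U \<inter> \<Union>\<D>)) \<or> d > real (card (U - \<Union>\<D>))" if \<D>: "\<D> \<subseteq> components l r H" for \<D>
  proof (rule ccontr)
    assume neg: "\<not> ?thesis"
    define S where "S = {C \<in> \<B>. C \<subseteq> \<Union>\<D>}"
    have inD: "C \<subseteq> \<Union>\<D> \<or> C \<inter> \<Union>\<D> = {}" if "C \<in> \<B>" for C
    proof -
      obtain x where x: "x \<in> vertices l r" "C = component G x" using \<open>C \<in> \<B>\<close> by (auto simp: \<B>_def big_components_def components_eq)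
      have "C \<subseteq> component H x" unfolding x(2) by (rule component_mono[OF assms(1)])
      moreover have "component H x \<in> components l r H" using x(1) by (simp add: components_eq)
      ultimately show ?thesis
        using components_disjoint[of "component H x" l r H] \<D> by (cases "component H x \<in> \<D>") blast+
    qed
    have S1: "\<Union>S = U \<inter> \<Union>\<D>" and S2: "\<Union>(\<B> - S) = U - \<Union>\<D>"
      using inD unfolding S_def U_def by blast+
    have "separated (\<Union>S) (\<Union>(\<B> - S)) H"
      unfolding separated_def S1 S2
    proof (intro ballI notI)
      fix x y assume xy: "x \<in> U \<inter> \<Union>\<D>" "y \<in> U - \<Union>\<D>" "{x, y} \<in> H"
      then obtain D where D: "D \<in> \<D>" "x \<in> D" by blast
      then have "component H x = D" using \<D> H.component_eq_if_mem by blast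
      then have "y \<in> D" using component_edge[of x H x y] xy by auto
      then show False using D xy by blast
    qed
    then show False
      using conn[of S] neg unfolding \<B>_def[symmetric] S1 S2 by (auto simp: S_def)
  qed
  define g where "g D = real (card (U \<inter> D))" for D
  have g_sum: "sum g \<D> = real (card (U \<inter> \<Union>\<D>))" if \<D>: "\<D> \<subseteq> components l r H" for \<D>
  proof -
    have "card (\<Union>D\<in>\<D>. U \<inter> D) = (\<Sum>D\<in>\<D>. card (U \<inter> D))"
    proof (rule card_UN_disjoint)
      show "finite \<D>" using \<D> finite_components finite_subset by blast
      show "\<forall>i\<in>\<D>. \<forall>j\<in>\<D>. i \<noteq> j \<longrightarrow> U \<inter> i \<inter> (U \<inter> j) = {}"
        using \<D> components_disjoint by blast
    qed (use finU in auto)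
    moreover have "(\<Union>D\<in>\<D>. U \<inter> D) = U \<inter> \<Union>\<D>" by blast
    ultimately show ?thesis unfolding g_def by simp
  qed
  have Vcov: "U \<inter> \<Union>(components l r H) = U"
    using UV component_self unfolding components_eq by blast
  have "\<exists>D\<in>components l r H. d \<le> g D"
  proof (rule ccontr)
    assume "\<not> ?thesis"
    then have small: "\<And>D. D \<in> components l r H \<Longrightarrow> g D < d" by force
    have "3 * d \<le> sum g (components l r H)"
      unfolding g_sum[OF order_refl] Vcov U using assms(4) .
    \<comment> \<open>The greedy union holds at least d and fewer than 2 d of the at least 3 d
      vertices of U, so more than d of them lie outside, which contradicts
      \<open>part\<close>.\<close>
    then obtain \<D> where \<D>: "\<D> \<subseteq> components l r H" "d \<le> sum g \<D>" "sum g \<D> < 2 * d"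
      using exists_balanced_subset[of "components l r H" g d] small assms(3) by auto
    have "card (U - \<Union>\<D>) = card U - card (U \<inter> \<Union>\<D>)"
      using finU by (simp add: card_Diff_subset_Int)
    moreover have "card (U \<inter> \<Union>\<D>) \<le> card U" using finU by (intro card_mono) auto
    ultimately have "real (card (U - \<Union>\<D>)) = real (card U) - sum g \<D>"
      unfolding g_sum[OF \<D>(1)] by simp
    then show False using part[OF \<D>(1)] \<D> assms(4) unfolding U g_sum[OF \<D>(1), symmetric] by linarith
  qed
  then obtain D where D: "D \<in> components l r H" "d \<le> g D" by blast
  \<comment> \<open>D holds at least d vertices of U, so the second alternative of
    \<open>part\<close> applies and fewer than d are outside D.\<close>
  have "real (card (U - D)) < d" using part[of "{D}"] D by (auto simp: g_def)
  moreover have "card U = card (U \<inter> D) + card (U - D)" using finU by (metis card_Int_Diff)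
  moreover have "card (U \<inter> D) \<le> card D"
    using H.component_subset[OF D(1)] finite_parts(3) finite_subset by (intro card_mono) blast+
  ultimately have "real (big_mass l r m G) - d \<le> real (card D)" unfolding U[symmetric] by linarith
  then show ?thesis using card_le_size_C1[OF D(1)] by linarith
qed

lemma degree_pos_big:
  assumes "1 \<le> m" "C \<in> big_components l r m G" "x \<in> C"
  shows "1 \<le> degree G x"
proof -
  have C: "C \<in> components l r G" "1 < card C" using assms by (auto simp: big_components_def)
  have "C = component G x" using component_eq_if_mem[OF C(1) assms(3)] by simp
  have "\<exists>y. {x, y} \<in> G"
  proof (rule ccontr)
    assume "\<nexists>y. {x, y} \<in> G"
    then have "component G x \<subseteq> {x}" by (intro component_subset_closed) auto
    then have "card C \<le> card {x}" unfolding \<open>C = component G x\<close> by (intro card_mono) auto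
    then have "card C \<le> 1" by simp
    then show False using C by simp
  qed
  then have "{e \<in> G. x \<in> e} \<noteq> {}" by auto
  then have "0 < card {e \<in> G. x \<in> e}" by (simp add: card_gt_0_iff)
  then show ?thesis by (simp add: degree_def)
qed

text \<open>A nontrivial component has at least half as many edges as vertices, so large unions of big components
  have large weight on both sides, however unevenly their vertices are distributed.\<close>

lemma degree_sum_big:
  assumes "1 \<le> m" "S \<subseteq> big_components l r m G"
  shows "card (\<Union>S) \<le> 2 * (\<Sum>x\<in>\<Union>S \<inter> left_part l. degree G x)"
    and "card (\<Union>S) \<le> 2 * (\<Sum>x\<in>\<Union>S \<inter> right_part r. degree G x)"
proof -
  have closed: "z \<in> \<Union>S" if "y \<in> \<Union>S" "{y, z} \<in> G" for y z
  proof -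
    obtain C where C: "C \<in> S" "y \<in> C" using \<open>y \<in> \<Union>S\<close> by blast
    then have "component G y = C" using assms component_eq_if_mem by (auto simp: big_components_def)
    then have "z \<in> C" using component_edge[of y G y z] that by auto
    then show ?thesis using C by blast
  qed
  have eq: "(\<Sum>x\<in>\<Union>S \<inter> left_part l. degree G x) = (\<Sum>x\<in>\<Union>S \<inter> right_part r. degree G x)"
    using degree_sum_closed(1)[of "\<Union>S", OF closed] degree_sum_closed(2)[of "\<Union>S", OF closed] by simp
  have sub: "\<Union>S \<subseteq> vertices l r" using assms component_subset by (auto simp: big_components_def)
  have deg: "1 \<le> degree G x" if "x \<in> \<Union>S" for x using that assms degree_pos_big[OF assms(1)] by blast
  have "card (\<Union>S \<inter> left_part l) \<le> (\<Sum>x\<in>\<Union>S \<inter> left_part l. degree G x)"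
    using sum_mono[of "\<Union>S \<inter> left_part l" "\<lambda>_. 1" "degree G"] deg by simp
  moreover have "card (\<Union>S \<inter> right_part r) \<le> (\<Sum>x\<in>\<Union>S \<inter> right_part r. degree G x)"
    using sum_mono[of "\<Union>S \<inter> right_part r" "\<lambda>_. 1" "degree G"] deg by simp
  moreover have "card (\<Union>S) \<le> card (\<Union>S \<inter> left_part l) + card (\<Union>S \<inter> right_part r)"
  proof -
    have "\<Union>S = (\<Union>S \<inter> left_part l) \<union> (\<Union>S \<inter> right_part r)" using sub by (auto simp: vertices_def)
    then have "card (\<Union>S) = card ((\<Union>S \<inter> left_part l) \<union> (\<Union>S \<inter> right_part r))" by simp
    also have "\<dots> \<le> card (\<Union>S \<inter> left_part l) + card (\<Union>S \<inter> right_part r)" by (rule card_Un_le)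
    finally show ?thesis .
  qed
  ultimately show "card (\<Union>S) \<le> 2 * (\<Sum>x\<in>\<Union>S \<inter> left_part l. degree G x)"
    "card (\<Union>S) \<le> 2 * (\<Sum>x\<in>\<Union>S \<inter> right_part r. degree G x)"
    unfolding eq by linarith+
qed

end

section \<open>The process continued from a given graph\<close>

lemma expectation_bind_finite:
  fixes h :: "'b \<Rightarrow> real"
  assumes "finite (set_pmf p)" "\<And>x. x \<in> set_pmf p \<Longrightarrow> finite (set_pmf (f x))"
  shows "measure_pmf.expectation (p \<bind> f) h = measure_pmf.expectation p (\<lambda>x. measure_pmf.expectation (f x) h)"
proof -
  have "measure_pmf.expectation (p \<bind> f) h = (\<Sum>x\<in>set_pmf p. pmf p x *\<^sub>R measure_pmf.expectation (f x) h)"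
    by (rule pmf_expectation_bind[OF assms order_refl])
  also have "\<dots> = measure_pmf.expectation p (\<lambda>x. measure_pmf.expectation (f x) h)"
    by (rule integral_measure_pmf[symmetric, OF assms(1)])
  finally show ?thesis .
qed

primrec further_steps :: "nat \<Rightarrow> nat \<Rightarrow> real \<Rightarrow> real \<Rightarrow> nat \<Rightarrow> graph \<Rightarrow> graph pmf" where
  "further_steps l r \<alpha> \<beta> 0 G = return_pmf G"
| "further_steps l r \<alpha> \<beta> (Suc j) G = bind_pmf (further_steps l r \<alpha> \<beta> j G) (add_random_edge l r \<alpha> \<beta>)"

lemma graph_process_add:
  "graph_process l r \<alpha> \<beta> (t + j) = bind_pmf (graph_process l r \<alpha> \<beta> t) (further_steps l r \<alpha> \<beta> j)"
  by (induction j) (simp_all add: bind_return_pmf' bind_assoc_pmf)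

context process
begin

lemma further_reachable:
  assumes "bipartite l r G" "H \<in> set_pmf (further_steps l r \<alpha> \<beta> j G)"
  shows "bipartite l r H \<and> G \<subseteq> H \<and> (card G + j \<le> l * r \<longrightarrow> card H = card G + j)"
  using assms(2)
proof (induction j arbitrary: H)
  case 0
  then show ?case using assms(1) by simp
next
  case (Suc j)
  then obtain F where F: "F \<in> set_pmf (further_steps l r \<alpha> \<beta> j G)" "H \<in> set_pmf (add_random_edge l r \<alpha> \<beta> F)"
    by auto
  interpret weighted_graph l r F \<alpha> \<beta> using Suc.IH[OF F(1)] by (intro weighted_graphI) simp
  show ?case
  proof (cases "available_pairs l r F = {}")
    case True
    then have "H = F" using set_add_random_edge F(2) by auto
    then show ?thesis using Suc.IH[OF F(1)] available_nonempty True by auto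
  next
    case False
    then have "H \<in> (\<lambda>(u, v). insert {u, v} F) ` available_pairs l r F"
      using set_add_random_edge F(2) by auto
    then obtain p where "p \<in> available_pairs l r F" "H = (\<lambda>(u, v). insert {u, v} F) p" by blast
    moreover obtain u v where "p = (u, v)" by (cases p)
    ultimately have uv: "(u, v) \<in> available_pairs l r F" "H = insert {u, v} F" by simp_all
    show ?thesis using Suc.IH[OF F(1)] bipartite_insert[OF bip uv(1)] card_insert_available[OF uv(1)] uv(2) by auto
  qed
qed

lemma finite_further: "bipartite l r G \<Longrightarrow> finite (set_pmf (further_steps l r \<alpha> \<beta> j G))"
  by (rule finite_subset[OF _ finite_bipartite_graphs]) (use further_reachable in auto)

text \<open>While the two unions are separated, every pair of a left vertex of the first and a right
  vertex of the second is available and would end the separation. Both sides weigh at least d / 2 by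
  \<open>degree_sum_big\<close>, since degrees only grow from G to H; so such a pair is chosen with
  probability at least (d / 2)^2 / Z, and Z is at most D.\<close>

lemma separated_step:
  assumes H: "bipartite l r H" and sub: "G \<subseteq> H" and G: "bipartite_graph l r G" and m: "1 \<le> m"
    and S: "S \<subseteq> big_components l r m G" and lt: "card H < l * r"
    and D: "(real (card H) + \<alpha> * real l) * (real (card H) + \<beta> * real r) \<le> D"
    and d: "0 \<le> d" "d \<le> real (card (\<Union>S))" "d \<le> real (card (\<Union>(big_components l r m G - S)))"
    and sep: "separated (\<Union>S) (\<Union>(big_components l r m G - S)) H"
  shows "measure_pmf.prob (add_random_edge l r \<alpha> \<beta> H) {F. separated (\<Union>S) (\<Union>(big_components l r m G - S)) F} \<le> 1 - d ^ 2 / (4 * D)"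
proof -
  interpret G: bipartite_graph l r G by (rule G)
  interpret weighted_graph l r H \<alpha> \<beta> by (rule weighted_graphI[OF H])
  define A where "A = \<Union>S"
  define B where "B = \<Union>(big_components l r m G - S)"
  note ne = available_nonempty[OF lt]
  note Z = Z_pos[OF ne]
  let ?w = "\<lambda>(u, v). vweight \<alpha> H u * vweight \<beta> H v"
  let ?A = "available_pairs l r H"
  let ?X = "(A \<inter> left_part l) \<times> (B \<inter> right_part r)"
  have X: "?X \<subseteq> ?A" using sep by (auto simp: available_pairs_def separated_def A_def B_def)
  have deg: "degree G x \<le> degree H x" for x
    unfolding degree_def using sub by (intro card_mono) auto
  have cA: "d / 2 \<le> (\<Sum>u\<in>A \<inter> left_part l. vweight \<alpha> H u)"
  proof -
    have "real (card A) \<le> 2 * real (\<Sum>x\<in>A \<inter> left_part l. degree G x)"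
      using G.degree_sum_big(1)[OF m S] unfolding A_def by linarith
    also have "real (\<Sum>x\<in>A \<inter> left_part l. degree G x) \<le> (\<Sum>u\<in>A \<inter> left_part l. vweight \<alpha> H u)"
      unfolding of_nat_sum using deg \<alpha>_pos by (intro sum_mono) (simp add: vweight_def add_increasing2)
    finally show ?thesis using d(2) unfolding A_def by linarith
  qed
  have cB: "d / 2 \<le> (\<Sum>u\<in>B \<inter> right_part r. vweight \<beta> H u)"
  proof -
    have "real (card B) \<le> 2 * real (\<Sum>x\<in>B \<inter> right_part r. degree G x)"
      using G.degree_sum_big(2)[OF m Diff_subset, of S] unfolding B_def by linarith
    also have "real (\<Sum>x\<in>B \<inter> right_part r. degree G x) \<le> (\<Sum>u\<in>B \<inter> right_part r. vweight \<beta> H u)"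
      unfolding of_nat_sum using deg \<beta>_pos by (intro sum_mono) (simp add: vweight_def add_increasing2)
    finally show ?thesis using d(3) unfolding B_def by linarith
  qed
  have "(d / 2) * (d / 2) \<le> (\<Sum>u\<in>A \<inter> left_part l. vweight \<alpha> H u) * (\<Sum>u\<in>B \<inter> right_part r. vweight \<beta> H u)"
    using cA cB d(1) by (intro mult_mono) auto
  also have "\<dots> = (\<Sum>x\<in>?X. ?w x)"
    unfolding sum_product sum.cartesian_product by simp
  finally have low: "d ^ 2 / 4 \<le> (\<Sum>x\<in>?X. ?w x)" by (simp add: power2_eq_square)
  have "measure_pmf.prob (add_random_edge l r \<alpha> \<beta> H) {F. separated A B F} =
    measure_pmf.expectation (add_random_edge l r \<alpha> \<beta> H) (indicator {F. separated A B F})" by simp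
  also have "\<dots> = (\<Sum>(u, v)\<in>?A. vweight \<alpha> H u * vweight \<beta> H v * indicator {F. separated A B F} (insert {u, v} H)) / Z"
    by (rule expectation_add_random_edge[OF ne])
  also have "(\<Sum>(u, v)\<in>?A. vweight \<alpha> H u * vweight \<beta> H v * indicator {F. separated A B F} (insert {u, v} H)) \<le> (\<Sum>x\<in>?A - ?X. ?w x)"
  proof -
    have "(\<Sum>(u, v)\<in>?A. vweight \<alpha> H u * vweight \<beta> H v * indicator {F. separated A B F} (insert {u, v} H)) =
      (\<Sum>(u, v)\<in>?A - ?X. vweight \<alpha> H u * vweight \<beta> H v * indicator {F. separated A B F} (insert {u, v} H))"
    proof (rule sum.mono_neutral_right)
      have "\<not> separated A B (insert {u, v} H)" if "u \<in> A" "v \<in> B" for u v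
        using that unfolding separated_def by blast
      then show "\<forall>p\<in>?A - (?A - ?X). (case p of (u, v) \<Rightarrow>
          vweight \<alpha> H u * vweight \<beta> H v * indicator {F. separated A B F} (insert {u, v} H)) = 0"
        by auto
    qed auto
    also have "\<dots> \<le> (\<Sum>x\<in>?A - ?X. ?w x)"
      by (intro sum_mono) (simp add: case_prod_unfold indicator_def vweight_prod_nonneg split: if_splits)
    finally show ?thesis .
  qed
  also have "(\<Sum>x\<in>?A - ?X. ?w x) = Z - (\<Sum>x\<in>?X. ?w x)"
    unfolding Z_def by (rule sum_diff[OF finite_available X])
  also have "(Z - (\<Sum>x\<in>?X. ?w x)) / Z \<le> (Z - d ^ 2 / 4) / Z"
    using low Z by (intro divide_right_mono) auto
  also have "\<dots> = 1 - d ^ 2 / (4 * Z)" using Z by (simp add: diff_divide_distrib)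
  also have "\<dots> \<le> 1 - d ^ 2 / (4 * D)"
  proof -
    have "Z \<le> D" using Z_le D unfolding W_L_def W_R_def by linarith
    then have "d ^ 2 / (4 * D) \<le> d ^ 2 / (4 * Z)" using Z by (intro divide_left_mono mult_pos_pos) auto
    then show ?thesis by simp
  qed
  finally show ?thesis using Z by (simp add: A_def B_def divide_right_mono)
qed

text \<open>A broken separation stays broken, so the bounds for the single steps multiply. The total
  weights increase with time, hence a D chosen for the end of the period serves all its
  steps.\<close>

lemma separated_prob:
  assumes G: "bipartite l r G" and m: "1 \<le> m"
    and S: "S \<subseteq> big_components l r m G" and lt: "card G + j \<le> l * r"
    and D: "(real (card G + j) + \<alpha> * real l) * (real (card G + j) + \<beta> * real r) \<le> D" "0 < D" "d ^ 2 \<le> 4 * D"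
    and d: "0 \<le> d" "d \<le> real (card (\<Union>S))" "d \<le> real (card (\<Union>(big_components l r m G - S)))"
  shows "measure_pmf.prob (further_steps l r \<alpha> \<beta> j G) {F. separated (\<Union>S) (\<Union>(big_components l r m G - S)) F} \<le> (1 - d ^ 2 / (4 * D)) ^ j"
  using lt D(1)
proof (induction j)
  case (Suc j)
  let ?E = "{F. separated (\<Union>S) (\<Union>(big_components l r m G - S)) F}"
  let ?q = "1 - d ^ 2 / (4 * D)"
  have q: "0 \<le> ?q" using D by (simp add: divide_simps)
  interpret G: bipartite_graph l r G by unfold_locales (rule G)
  have D': "(real (card G + j) + \<alpha> * real l) * (real (card G + j) + \<beta> * real r) \<le> D"
    using Suc.prems(2) \<alpha>_pos \<beta>_pos
    by (elim order_trans[rotated]) (intro mult_mono, auto intro: add_nonneg_nonneg)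
  have IH: "measure_pmf.prob (further_steps l r \<alpha> \<beta> j G) ?E \<le> ?q ^ j"
    using Suc.IH Suc.prems(1) D' by simp
  have fin: "finite (set_pmf (add_random_edge l r \<alpha> \<beta> H))" if "H \<in> set_pmf (further_steps l r \<alpha> \<beta> j G)" for H
    using weighted_graph.finite_set_add_random_edge[OF weighted_graphI] further_reachable[OF G that] by auto
  have "measure_pmf.prob (further_steps l r \<alpha> \<beta> (Suc j) G) ?E =
    measure_pmf.expectation (further_steps l r \<alpha> \<beta> (Suc j) G) (indicator ?E)" by simp
  also have "\<dots> = measure_pmf.expectation (further_steps l r \<alpha> \<beta> j G) (\<lambda>H. measure_pmf.expectation (add_random_edge l r \<alpha> \<beta> H) (indicator ?E))"
    unfolding further_steps.simps by (rule expectation_bind_finite[OF finite_further[OF G] fin])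
  also have "\<dots> \<le> measure_pmf.expectation (further_steps l r \<alpha> \<beta> j G) (\<lambda>H. ?q * indicator ?E H)"
  proof (rule integral_mono_AE)
    show "AE H in further_steps l r \<alpha> \<beta> j G. measure_pmf.expectation (add_random_edge l r \<alpha> \<beta> H) (indicator ?E) \<le> ?q * indicator ?E H"
      unfolding AE_measure_pmf_iff
    proof
      fix H assume H: "H \<in> set_pmf (further_steps l r \<alpha> \<beta> j G)"
      note st = further_reachable[OF G H]
      have cH: "card H = card G + j" using st Suc.prems by simp
      show "measure_pmf.expectation (add_random_edge l r \<alpha> \<beta> H) (indicator ?E) \<le> ?q * indicator ?E H"
      proof (cases "H \<in> ?E")
        case True
        have "measure_pmf.prob (add_random_edge l r \<alpha> \<beta> H) ?E \<le> ?q"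
          using st True cH Suc.prems D' S d
          by (intro separated_step[OF _ _ G.bipartite_graph_axioms m]) auto
        then show ?thesis using True by simp
      next
        case False
        interpret H: weighted_graph l r H \<alpha> \<beta> using st by (intro weighted_graphI) simp
        have "H \<subseteq> F" if "F \<in> set_pmf (add_random_edge l r \<alpha> \<beta> H)" for F
          using H.set_add_random_edge that by (cases "available_pairs l r H = {}") auto
        then have "set_pmf (add_random_edge l r \<alpha> \<beta> H) \<inter> ?E = {}"
          using False unfolding separated_def by blast
        then have "measure_pmf.prob (add_random_edge l r \<alpha> \<beta> H) ?E = 0"
          by (simp add: measure_pmf_zero_iff)
        then show ?thesis using False by simp
      qed
    qed
  qed (auto intro!: integrable_measure_pmf_finite finite_further[OF G])
  also have "\<dots> = ?q * measure_pmf.prob (further_steps l r \<alpha> \<beta> j G) ?E" by simp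
  also have "\<dots> \<le> ?q * ?q ^ j" using IH q by (rule mult_left_mono)
  finally show ?case by simp
qed (simp add: measure_pmf.prob_le_1)

text \<open>By \<open>giant_if_connected\<close>, a small largest component leaves some splitting of
  the big components separated. There are at most n / m big components, and the union bound runs
  over at most 2 powr (n / m) splittings.\<close>

lemma sprinkling_from:
  assumes G: "bipartite l r G" and m: "1 \<le> m" and lt: "card G + j \<le> l * r"
    and D: "(real (card G + j) + \<alpha> * real l) * (real (card G + j) + \<beta> * real r) \<le> D" "0 < D" "d ^ 2 \<le> 4 * D"
    and d: "0 < d" "3 * d \<le> real (big_mass l r m G)" and x: "x + d \<le> real (big_mass l r m G)"
  shows "measure_pmf.prob (further_steps l r \<alpha> \<beta> j G) {H. real (size_C1 l r H) < x}
    \<le> 2 powr (real (l + r) / real m) * (1 - d ^ 2 / (4 * D)) ^ j"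
proof -
  interpret G: bipartite_graph l r G by unfold_locales (rule G)
  let ?P = "measure_pmf.prob (further_steps l r \<alpha> \<beta> j G)"
  define \<B> where "\<B> = big_components l r m G"
  define I where "I = {S. S \<subseteq> \<B> \<and> d \<le> real (card (\<Union>S)) \<and> d \<le> real (card (\<Union>(\<B> - S)))}"
  define E where "E S = {H. separated (\<Union>S) (\<Union>(\<B> - S)) H}" for S
  have IB: "I \<subseteq> Pow \<B>" by (auto simp: I_def)
  have fI: "finite I" using finite_subset[OF IB] by (simp add: \<B>_def)
  have q: "0 \<le> 1 - d ^ 2 / (4 * D)" using D by (simp add: divide_simps)
  have "?P {H. real (size_C1 l r H) < x} \<le> ?P (\<Union>S\<in>I. E S)"
  proof (rule measure_pmf.finite_measure_mono_AE)
    show "AE H in further_steps l r \<alpha> \<beta> j G. H \<in> {H. real (size_C1 l r H) < x} \<longrightarrow> H \<in> (\<Union>S\<in>I. E S)"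
      unfolding AE_measure_pmf_iff
    proof (intro ballI impI)
      fix H assume H: "H \<in> set_pmf (further_steps l r \<alpha> \<beta> j G)" "H \<in> {H. real (size_C1 l r H) < x}"
      show "H \<in> (\<Union>S\<in>I. E S)"
      proof (rule ccontr)
        assume "H \<notin> (\<Union>S\<in>I. E S)"
        then have "real (big_mass l r m G) - d \<le> real (size_C1 l r H)"
          using further_reachable[OF G H(1)] d by (intro G.giant_if_connected) (auto simp: I_def E_def \<B>_def)
        then show False using H(2) x by simp
      qed
    qed
  qed simp
  also have "\<dots> \<le> (\<Sum>S\<in>I. ?P (E S))"
    by (rule measure_pmf.finite_measure_subadditive_finite[OF fI]) simp
  also have "\<dots> \<le> (\<Sum>S\<in>I. (1 - d ^ 2 / (4 * D)) ^ j)"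
  proof (rule sum_mono)
    fix S assume "S \<in> I"
    then show "?P (E S) \<le> (1 - d ^ 2 / (4 * D)) ^ j"
      unfolding E_def I_def \<B>_def using d(1) by (intro separated_prob[OF G m _ lt D]) auto
  qed
  also have "\<dots> = real (card I) * (1 - d ^ 2 / (4 * D)) ^ j" by simp
  also have "\<dots> \<le> 2 powr (real (l + r) / real m) * (1 - d ^ 2 / (4 * D)) ^ j"
  proof (rule mult_right_mono)
    have "card I \<le> 2 ^ card \<B>"
      using card_mono[OF _ IB] by (simp add: card_Pow \<B>_def)
    then have "real (card I) \<le> 2 powr real (card \<B>)" by (simp add: powr_realpow)
    also have "real (card \<B>) \<le> real (l + r) / real m"
    proof -
      have "real m * real (card \<B>) \<le> real (l + r)"
        using G.card_big_components[of m] unfolding \<B>_def of_nat_mult[symmetric] of_nat_le_iff .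
      then show ?thesis using m by (simp add: field_simps)
    qed
    finally show "real (card I) \<le> 2 powr (real (l + r) / real m)" by simp
  qed (use q in simp)
  finally show ?thesis .
qed

text \<open>The law at time t + j is conditioned on the graph at time t. The condition 2 d \<le> x
  turns a big mass of at least x + d into the 3 d that the greedy argument requires.\<close>

lemma sprinkling:
  assumes m: "1 \<le> m" and lt: "t + j \<le> l * r"
    and D: "(real (t + j) + \<alpha> * real l) * (real (t + j) + \<beta> * real r) \<le> D" "0 < D" "d ^ 2 \<le> 4 * D"
    and d: "0 < d" "2 * d \<le> x"
  shows "measure_pmf.prob (graph_process l r \<alpha> \<beta> (t + j)) {H. real (size_C1 l r H) < x}
    \<le> measure_pmf.prob (graph_process l r \<alpha> \<beta> t) {G. real (big_mass l r m G) < x + d}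
      + 2 powr (real (l + r) / real m) * (1 - d ^ 2 / (4 * D)) ^ j"
proof -
  let ?E = "{H. real (size_C1 l r H) < x}"
  let ?F = "{G. real (big_mass l r m G) < x + d}"
  define y where "y = 2 powr (real (l + r) / real m) * (1 - d ^ 2 / (4 * D)) ^ j"
  have y: "0 \<le> y" using D by (simp add: y_def divide_simps)
  have bip: "bipartite l r G" if "G \<in> set_pmf (graph_process l r \<alpha> \<beta> t)" for G using reachable[OF that] by simp
  have "measure_pmf.prob (graph_process l r \<alpha> \<beta> (t + j)) ?E =
    measure_pmf.expectation (graph_process l r \<alpha> \<beta> (t + j)) (indicator ?E)" by simp
  also have "\<dots> = expect t (\<lambda>G. measure_pmf.expectation (further_steps l r \<alpha> \<beta> j G) (indicator ?E))"
    unfolding graph_process_add by (rule expectation_bind_finite[OF finite_reachable finite_further[OF bip]])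
  also have "\<dots> \<le> expect t (\<lambda>G. indicator ?F G + y)"
  proof (rule expect_mono)
    fix G assume G: "G \<in> set_pmf (graph_process l r \<alpha> \<beta> t)"
    have card: "card G = t" using reachable[OF G] lt by simp
    show "measure_pmf.expectation (further_steps l r \<alpha> \<beta> j G) (indicator ?E) \<le> indicator ?F G + y"
    proof (cases "G \<in> ?F")
      case True
      have "measure_pmf.prob (further_steps l r \<alpha> \<beta> j G) ?E \<le> 1 + y"
        using y measure_pmf.prob_le_1[of "further_steps l r \<alpha> \<beta> j G" ?E] by linarith
      then show ?thesis using True by simp
    next
      case False
      then have "x + d \<le> real (big_mass l r m G)" by simp
      then have "measure_pmf.prob (further_steps l r \<alpha> \<beta> j G) ?E \<le> y"
        unfolding y_def using lt D d card by (intro sprinkling_from[OF bip[OF G] m]) auto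
      then show ?thesis using False by simp
    qed
  qed
  also have "\<dots> = measure_pmf.prob (graph_process l r \<alpha> \<beta> t) ?F + y" by simp
  finally show ?thesis by (simp add: y_def)
qed

end

section \<open>Events of probability tending to one\<close>

definition whp :: "(nat \<Rightarrow> 'a pmf) \<Rightarrow> (nat \<Rightarrow> 'a \<Rightarrow> bool) \<Rightarrow> bool" where
  "whp P Q \<longleftrightarrow> (\<lambda>k. measure_pmf.prob (P k) {x. \<not> Q k x}) \<longlonglongrightarrow> 0"

lemma whp_mono:
  assumes "whp P Q" "\<forall>\<^sub>F k in sequentially. \<forall>x\<in>set_pmf (P k). Q k x \<longrightarrow> Q' k x"
  shows "whp P Q'"
  unfolding whp_def
proof (rule tendsto_sandwich[OF _ _ tendsto_const assms(1)[unfolded whp_def]])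
  show "\<forall>\<^sub>F k in sequentially. measure_pmf.prob (P k) {x. \<not> Q' k x} \<le> measure_pmf.prob (P k) {x. \<not> Q k x}"
    using assms(2)
  proof eventually_elim
    case (elim k)
    then show ?case
      by (intro measure_pmf.finite_measure_mono_AE) (auto simp: AE_measure_pmf_iff)
  qed
qed simp

lemma whp_conj:
  assumes "whp P Q" "whp P Q'"
  shows "whp P (\<lambda>k x. Q k x \<and> Q' k x)"
  unfolding whp_def
proof (rule tendsto_sandwich[OF _ _ tendsto_const])
  show "(\<lambda>k. measure_pmf.prob (P k) {x. \<not> Q k x} + measure_pmf.prob (P k) {x. \<not> Q' k x}) \<longlonglongrightarrow> 0"
    using tendsto_add[OF assms[unfolded whp_def]] by simp
  have "{x. \<not> (Q k x \<and> Q' k x)} = {x. \<not> Q k x} \<union> {x. \<not> Q' k x}" for k by auto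
  then have "measure_pmf.prob (P k) {x. \<not> (Q k x \<and> Q' k x)} \<le>
      measure_pmf.prob (P k) {x. \<not> Q k x} + measure_pmf.prob (P k) {x. \<not> Q' k x}" for k
    using measure_Un_le[of "{x. \<not> Q k x}" "measure_pmf (P k)" "{x. \<not> Q' k x}"] by simp
  then show "\<forall>\<^sub>F k in sequentially. measure_pmf.prob (P k) {x. \<not> (Q k x \<and> Q' k x)} \<le>
      measure_pmf.prob (P k) {x. \<not> Q k x} + measure_pmf.prob (P k) {x. \<not> Q' k x}"
    by (intro always_eventually allI)
qed simp

lemma tendsto_in_prob_iff_whp:
  "tendsto_in_prob P X c \<longleftrightarrow> (\<forall>\<delta>>0. whp P (\<lambda>k x. \<bar>X k x - c\<bar> \<le> \<delta>))"
  unfolding tendsto_in_prob_def whp_def by (simp add: not_le)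

section \<open>The limits of the two largest component sizes\<close>

context bipartite_sequence
begin

lemma density_sum: "l0 + r0 = 1"
proof -
  have "(\<lambda>k. real (L k) / total k + real (R k) / total k) \<longlonglongrightarrow> l0 + r0"
    by (intro tendsto_intros left_ratio right_ratio)
  moreover have "\<forall>\<^sub>F k in sequentially. 0 < total k"
    using size_at_top by (simp only: filterlim_at_top_dense)
  then have "\<forall>\<^sub>F k in sequentially. real (L k) / total k + real (R k) / total k = 1"
  proof eventually_elim
    case (elim k)
    have "real (L k) / total k + real (R k) / total k = total k / total k"
      unfolding of_nat_add by (rule add_divide_distrib[symmetric])
    then show ?case using elim by simp
  qed
  then have "(\<lambda>k. real (L k) / total k + real (R k) / total k) \<longlonglongrightarrow> 1"
    by (rule tendsto_eventually)
  ultimately show ?thesis by (rule LIMSEQ_unique)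
qed

lemma eventually_size: "\<forall>\<^sub>F k in sequentially. x < total k"
  using size_at_top by (simp only: filterlim_at_top_dense)

definition giant :: "real \<Rightarrow> real" where
  "giant s = 1 - finite_mass s"

lemma giant_nonneg: "0 \<le> s \<Longrightarrow> 0 \<le> giant s"
proof -
  assume s: "0 \<le> s"
  have "finite_mass s \<le> l0 * 1 + r0 * 1"
    unfolding finite_mass_def using mean_nonneg[OF s] ext_range[OF s] \<alpha>_pos \<beta>_pos l_pos r_pos
    by (intro add_mono mult_left_mono neg_bin_gen_le_1) auto
  then show ?thesis using density_sum by (simp add: giant_def)
qed

text \<open>Left vertices alone contribute a strict gain, because \<open>ext_R s\<close> is below 1;
  the right term is bounded trivially.\<close>

lemma giant_pos:
  assumes "0 < s" "1 < growth s"
  shows "0 < giant s"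
proof -
  have s0: "0 \<le> s" using assms(1) by simp
  note m = mean_nonneg[OF s0] and e = ext_range[OF s0]
  have "0 < mean_L s" using assms(1) \<alpha>_pos l_pos by (simp add: mean_L_def)
  then have "1 < 1 + mean_L s * (1 - ext_R s)" using supercritical_ext[OF s0 assms(2)] by simp
  then have "neg_bin_gen \<alpha> (mean_L s) (ext_R s) < 1"
    unfolding neg_bin_gen_def using \<alpha>_pos by (simp add: powr_less_one)
  then have "l0 * neg_bin_gen \<alpha> (mean_L s) (ext_R s) < l0 * 1" using l_pos by (intro mult_strict_left_mono)
  moreover have "r0 * neg_bin_gen \<beta> (mean_R s) (ext_L s) \<le> r0 * 1"
    using m e \<beta>_pos r_pos by (intro mult_left_mono neg_bin_gen_le_1) auto
  ultimately show ?thesis using density_sum by (simp add: giant_def finite_mass_def)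
qed

lemma big_mass_law:
  assumes "G \<in> set_pmf (law k t)" "0 < total k"
  shows "real (big_mass (L k) (R k) m G) / total k = 1 - real (small_mass (L k) (R k) m G) / total k"
proof -
  interpret p: process "L k" "R k" \<alpha> \<beta> by (rule process)
  interpret bipartite_graph "L k" "R k" G using p.reachable[OF assms(1)] by unfold_locales simp
  have "real (big_mass (L k) (R k) m G) + real (small_mass (L k) (R k) m G) = total k"
    using big_plus_small[of m] by (simp only: of_nat_add[symmetric])
  then show ?thesis using assms(2) by (simp add: field_simps)
qed

lemma small_mass_whp:
  assumes "0 \<le> s" "(\<lambda>k. real (t k) / total k) \<longlonglongrightarrow> s" "0 < \<delta>"
  shows "whp (\<lambda>k. law k (t k)) (\<lambda>k G. \<bar>real (small_mass (L k) (R k) m G) / total k - small_density m s\<bar> \<le> \<delta>)"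
  using small_mass_concentration[OF assms, of m] unfolding whp_def by (simp only: not_le)

text \<open>m is chosen so large that trees with at most m vertices carry all of
  \<open>finite_mass s\<close> up to \<delta> / 2; concentration at this fixed m costs the other
  half.\<close>

lemma big_mass_upper:
  assumes s: "0 \<le> s" and t: "(\<lambda>k. real (t k) / total k) \<longlonglongrightarrow> s" and \<delta>: "0 < \<delta>"
  shows "\<exists>m. whp (\<lambda>k. law k (t k)) (\<lambda>k G. real (big_mass (L k) (R k) m G) / total k \<le> giant s + \<delta>)"
proof -
  have "\<forall>\<^sub>F m in sequentially. finite_mass s - \<delta> / 2 < small_density m s"
    using small_density_tendsto[OF s] \<delta> by (intro order_tendstoD(1)) auto
  then obtain m where m: "finite_mass s - \<delta> / 2 < small_density m s"
    unfolding eventually_sequentially by blast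
  have "whp (\<lambda>k. law k (t k)) (\<lambda>k G. real (big_mass (L k) (R k) m G) / total k \<le> giant s + \<delta>)"
  proof (rule whp_mono[OF small_mass_whp[OF s t, of "\<delta> / 2" m]])
    show "\<forall>\<^sub>F k in sequentially. \<forall>G\<in>set_pmf (law k (t k)).
      \<bar>real (small_mass (L k) (R k) m G) / total k - small_density m s\<bar> \<le> \<delta> / 2 \<longrightarrow>
      real (big_mass (L k) (R k) m G) / total k \<le> giant s + \<delta>"
      using eventually_size[of 0]
    proof eventually_elim
      case (elim k)
      show ?case
      proof (intro ballI impI)
        fix G assume G: "G \<in> set_pmf (law k (t k))" "\<bar>real (small_mass (L k) (R k) m G) / total k - small_density m s\<bar> \<le> \<delta> / 2"
        then show "real (big_mass (L k) (R k) m G) / total k \<le> giant s + \<delta>"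
          unfolding big_mass_law[OF G(1) elim] giant_def using m by linarith
      qed
    qed
  qed (use \<delta> in simp)
  then show ?thesis by blast
qed

lemma size_C1_upper:
  assumes s: "0 \<le> s" and t: "(\<lambda>k. real (t k) / total k) \<longlonglongrightarrow> s" and \<delta>: "0 < \<delta>"
  shows "whp (\<lambda>k. law k (t k)) (\<lambda>k G. real (size_C1 (L k) (R k) G) / total k \<le> giant s + \<delta>)"
proof -
  obtain m where m: "whp (\<lambda>k. law k (t k)) (\<lambda>k G. real (big_mass (L k) (R k) m G) / total k \<le> giant s + \<delta>)"
    using big_mass_upper[OF assms] by blast
  show ?thesis
  proof (rule whp_mono[OF m])
    show "\<forall>\<^sub>F k in sequentially. \<forall>G\<in>set_pmf (law k (t k)).
      real (big_mass (L k) (R k) m G) / total k \<le> giant s + \<delta> \<longrightarrow> real (size_C1 (L k) (R k) G) / total k \<le> giant s + \<delta>"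
      using eventually_size[of "real m / \<delta>"] eventually_size[of 0]
    proof eventually_elim
      case (elim k)
      have "real m / total k \<le> \<delta>" using elim \<delta> by (simp add: field_simps)
      then have m': "real m / total k \<le> giant s + \<delta>" using giant_nonneg[OF s] by simp
      show ?case
      proof (intro ballI impI)
        fix G assume big: "real (big_mass (L k) (R k) m G) / total k \<le> giant s + \<delta>"
        have "size_C1 (L k) (R k) G \<le> m \<or> size_C1 (L k) (R k) G \<le> big_mass (L k) (R k) m G"
          using size_C1_le[of "L k" "R k" G m] by (simp only: le_max_iff_disj)
        then have "real (size_C1 (L k) (R k) G) / total k \<le> real m / total k \<or>
            real (size_C1 (L k) (R k) G) / total k \<le> real (big_mass (L k) (R k) m G) / total k"
          using elim(2) by (auto intro: divide_right_mono)
        then show "real (size_C1 (L k) (R k) G) / total k \<le> giant s + \<delta>" using m' big by linarith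
      qed
    qed
  qed
qed

text \<open>Rounding changes the time by less than 1. The maximum reflects that \<open>steps\<close>
  is 0 for negative c.\<close>

lemma steps_tendsto: "(\<lambda>k. real (steps c (L k) (R k)) / total k) \<longlonglongrightarrow> max 0 c"
proof (cases "0 \<le> c")
  case True
  show ?thesis
  proof (rule tendsto_sandwich)
    show "\<forall>\<^sub>F k in sequentially. c - 1 / total k \<le> real (steps c (L k) (R k)) / total k"
      using eventually_size[of 0]
    proof eventually_elim
      case (elim k)
      have "c * total k - 1 \<le> real (steps c (L k) (R k))" unfolding steps_def by linarith
      then have "(c * total k - 1) / total k \<le> real (steps c (L k) (R k)) / total k" using elim by (intro divide_right_mono) auto
      moreover have "(c * x - 1) / x = c - 1 / x" if "x \<noteq> 0" for x :: real using that by (simp add: diff_divide_distrib)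
      ultimately show ?case using elim by (metis less_irrefl)
    qed
    show "\<forall>\<^sub>F k in sequentially. real (steps c (L k) (R k)) / total k \<le> c"
      using eventually_size[of 0]
    proof eventually_elim
      case (elim k)
      have "real (steps c (L k) (R k)) \<le> c * total k" using True by (simp add: steps_def del: of_nat_add)
      then show ?case using elim by (simp add: pos_divide_le_eq del: of_nat_add)
    qed
    show "(\<lambda>k. c - 1 / total k) \<longlonglongrightarrow> max 0 c" using tendsto_diff[OF tendsto_const inverse_size, of c] True by simp
    show "(\<lambda>k. c) \<longlonglongrightarrow> max 0 c" using True by simp
  qed
next
  case False
  have "steps c (L k) (R k) = 0" for k
    using False mult_nonpos_nonneg[of c "total k"] by (simp add: steps_def del: of_nat_add)
  then show ?thesis using False by simp
qed

text \<open>The number of pairs is quadratic in n, so the process is not exhausted at time h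
  n.\<close>

lemma eventually_pairs:
  assumes "0 \<le> h" shows "\<forall>\<^sub>F k in sequentially. h * total k \<le> real (L k * R k)"
proof -
  obtain c C where fl: "\<forall>\<^sub>F k in sequentially. fluid_limit (L k) (R k) \<alpha> \<beta> l0 r0 c C h"
    using eventually_fluid_limit[OF assms] by blast
  then show ?thesis
  proof eventually_elim
    case (elim k)
    interpret fluid_limit "L k" "R k" \<alpha> \<beta> l0 r0 c C h 0 by (rule elim)
    have "0 \<le> c * total k ^ 2" using c_pos by simp
    also have "\<dots> \<le> \<alpha> * \<beta> * (real (L k) * real (R k) - h * total k)" by (rule pairs_large)
    finally have "0 \<le> real (L k) * real (R k) - h * total k"
      using mult_pos_pos[OF \<alpha>_pos \<beta>_pos] by (simp add: zero_le_mult_iff)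
    then show ?case by simp
  qed
qed

text \<open>The product is at most exp (a n) with a = ln 2 / m + \<eta> ln (1 - q), and the lower
  bound for m says that a is negative.\<close>

lemma exponential_bound_tendsto:
  assumes "0 < q" "q < 1" "0 < \<eta>" "ln 2 / \<eta> / - ln (1 - q) < real m" "1 \<le> m"
    and "\<forall>\<^sub>F k in sequentially. \<eta> * total k \<le> real (j k)"
  shows "(\<lambda>k. 2 powr (total k / real m) * (1 - q) ^ j k) \<longlonglongrightarrow> 0"
proof (rule tendsto_sandwich[OF _ _ tendsto_const])
  define a where "a = ln 2 / real m + \<eta> * ln (1 - q)"
  have lnq: "ln (1 - q) < 0" using assms by simp
  then have "0 < - ln (1 - q)" by simp
  then have "ln 2 / \<eta> < real m * - ln (1 - q)" using assms(4) by (simp only: pos_divide_less_eq)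
  then have "ln 2 < real m * - ln (1 - q) * \<eta>" using assms(3) by (simp only: pos_divide_less_eq)
  then have a: "a < 0" unfolding a_def using assms(5) by (simp add: field_simps)
  have "filterlim (\<lambda>k. a * total k) at_bot sequentially"
    by (rule filterlim_tendsto_neg_mult_at_bot[OF tendsto_const a size_at_top])
  then show "(\<lambda>k. exp (a * total k)) \<longlonglongrightarrow> 0"
    by (rule filterlim_compose[OF exp_at_bot])
  show "\<forall>\<^sub>F k in sequentially. 2 powr (total k / real m) * (1 - q) ^ j k \<le> exp (a * total k)"
    using assms(6)
  proof eventually_elim
    case (elim k)
    have "(1 - q) ^ j k = exp (real (j k) * ln (1 - q))" using assms by (simp add: exp_of_nat_mult)
    also have "\<dots> \<le> exp (\<eta> * total k * ln (1 - q))" using elim lnq by (simp add: mult_right_mono_neg)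
    finally have "2 powr (total k / real m) * (1 - q) ^ j k \<le> exp (total k / real m * ln 2) * exp (\<eta> * total k * ln (1 - q))"
      by (simp add: powr_def mult_left_mono)
    also have "\<dots> = exp (a * total k)" by (simp add: a_def exp_add[symmetric] algebra_simps add_divide_distrib)
    finally show ?case .
  qed
qed (use assms in simp)

lemma size_C1_lower:
  assumes s: "0 < s" "1 < growth s" and t: "(\<lambda>k. real (t k) / total k) \<longlonglongrightarrow> s" and \<delta>: "0 < \<delta>"
  shows "whp (\<lambda>k. law k (t k)) (\<lambda>k G. giant s - \<delta> \<le> real (size_C1 (L k) (R k) G) / total k)"
proof (cases "giant s - \<delta> \<le> 0")
  case True
  have "giant s - \<delta> \<le> real (size_C1 (L k) (R k) G) / total k" for k G
    using True by (intro order_trans[OF True]) simp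
  then show ?thesis by (simp add: whp_def)
next
  case False
  \<comment> \<open>The proportion to be reached. Of \<delta>, one quarter is spent on going back
    from s to s', one on the concentration of the small mass and one on \<kappa>, the proportion
    that sprinkling may fail to connect.\<close>
  define \<rho> where "\<rho> = giant s - \<delta>"
  have "\<forall>\<^sub>F t in at_left s. t \<in> {0 <..< s}" using s(1) by (rule eventually_at_left_real)
  with finite_mass_left_semicontinuous[OF s, of "\<delta> / 4"] \<delta>
  have "\<forall>\<^sub>F t in at_left s. finite_mass t < finite_mass s + \<delta> / 4 \<and> 0 < t \<and> t < s"
    by (simp add: eventually_conj_iff)
  then obtain s' where s': "finite_mass s' < finite_mass s + \<delta> / 4" "0 < s'" "s' < s"
    using eventually_happens'[OF trivial_limit_at_left_real] by blast
  have \<rho>: "0 < \<rho>" "\<rho> \<le> 1"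
  proof -
    show "0 < \<rho>" using False by (simp add: \<rho>_def)
    have "0 \<le> finite_mass s"
      unfolding finite_mass_def
      using neg_bin_gen_pos[of "mean_L s" "ext_R s" \<alpha>] neg_bin_gen_pos[of "mean_R s" "ext_L s" \<beta>] mean_nonneg[of s] ext_range[of s] l_pos r_pos s(1)
      by (intro add_nonneg_nonneg mult_nonneg_nonneg) auto
    then show "\<rho> \<le> 1" using \<delta> by (simp add: \<rho>_def giant_def)
  qed
  \<comment> \<open>The bound \<rho> / 2 provides the condition 2 d \<le> x of
    \<open>sprinkling\<close>.\<close>
  define \<kappa> where "\<kappa> = min (\<delta> / 4) (\<rho> / 2)"
  have \<kappa>: "0 < \<kappa>" "\<kappa> \<le> \<delta> / 4" "2 * \<kappa> \<le> \<rho>" "\<kappa> < 1" using \<delta> \<rho> by (auto simp: \<kappa>_def)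
  define B where "B = (s + 1 + \<alpha>) * (s + 1 + \<beta>)"
  have B: "1 < B" unfolding B_def using s(1) \<alpha>_pos \<beta>_pos by (intro less_1_mult) auto
  \<comment> \<open>The value of d^2 / (4 D) for d = \<kappa> n and D = B n^2. It depends neither on
    n nor on m, so m can be chosen after q.\<close>
  define q where "q = \<kappa> ^ 2 / (4 * B)"
  have k2: "\<kappa> ^ 2 < 1" using \<kappa> by (simp add: power_less_one_iff abs_square_less_1)
  have q: "0 < q" "q < 1" using \<kappa> B k2 by (simp_all add: q_def)
  \<comment> \<open>Eventually the time t is beyond the midpoint of s' n and s n, so at least \<eta>
    n steps are available for sprinkling.\<close>
  define \<eta> where "\<eta> = (s - s') / 2"
  have \<eta>: "0 < \<eta>" using s' by (simp add: \<eta>_def)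
  obtain m0 :: nat where m0: "ln 2 / \<eta> / - ln (1 - q) < real m0" using reals_Archimedean2 by blast
  define m where "m = Suc m0"
  have m: "ln 2 / \<eta> / - ln (1 - q) < real m" "1 \<le> m" using m0 by (simp_all add: m_def)
  define t' where "t' k = steps s' (L k) (R k)" for k
  have t'_le: "real (t' k) \<le> s' * total k" for k using s' by (simp add: t'_def steps_def del: of_nat_add)
  have t'_lim: "(\<lambda>k. real (t' k) / total k) \<longlonglongrightarrow> s'"
    using steps_tendsto[of s'] s' by (simp add: t'_def)
  have s1: "0 \<le> s + 1" using s(1) by simp
  have ev_t: "\<forall>\<^sub>F k in sequentially. (s + s') / 2 * total k \<le> real (t k) \<and> real (t k) \<le> (s + 1) * total k"
  proof -
    have "\<forall>\<^sub>F k in sequentially. (s + s') / 2 < real (t k) / total k" using t s' by (intro order_tendstoD(1)) auto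
    moreover have "\<forall>\<^sub>F k in sequentially. real (t k) / total k < s + 1" using t by (intro order_tendstoD(2)) auto
    ultimately show ?thesis using eventually_size[of 0]
    proof eventually_elim
      case (elim k)
      show ?case using elim(1,2) unfolding pos_less_divide_eq[OF elim(3)] pos_divide_less_eq[OF elim(3)] by simp
    qed
  qed
  define j where "j k = t k - t' k" for k
  have ev_j: "\<forall>\<^sub>F k in sequentially. \<eta> * total k \<le> real (j k) \<and> t k = t' k + j k"
    using ev_t
  proof eventually_elim
    case (elim k)
    have "\<eta> * total k + s' * total k = (s + s') / 2 * total k" by (simp add: \<eta>_def field_simps)
    then have le: "\<eta> * total k + real (t' k) \<le> real (t k)" using elim t'_le[of k] by linarith
    moreover have "0 \<le> \<eta> * total k" using \<eta> by simp
    ultimately have "t' k \<le> t k" by linarith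
    then show ?case using le by (simp add: j_def of_nat_diff)
  qed
  have small: "whp (\<lambda>k. law k (t' k)) (\<lambda>k G. \<not> real (big_mass (L k) (R k) m G) < \<rho> * total k + \<kappa> * total k)"
  proof (rule whp_mono[OF small_mass_whp[OF less_imp_le[OF s'(2)] t'_lim, of "\<delta> / 4" m]])
    show "\<forall>\<^sub>F k in sequentially. \<forall>G\<in>set_pmf (law k (t' k)).
      \<bar>real (small_mass (L k) (R k) m G) / total k - small_density m s'\<bar> \<le> \<delta> / 4 \<longrightarrow>
      \<not> real (big_mass (L k) (R k) m G) < \<rho> * total k + \<kappa> * total k"
      using eventually_size[of 0]
    proof eventually_elim
      case (elim k)
      show ?case
      proof (intro ballI impI)
        fix G assume G: "G \<in> set_pmf (law k (t' k))" "\<bar>real (small_mass (L k) (R k) m G) / total k - small_density m s'\<bar> \<le> \<delta> / 4"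
        \<comment> \<open>Valid for every m; so the large m dictated by the number of splittings is
          harmless here.\<close>
        have "small_density m s' \<le> finite_mass s'" using s' by (intro small_density_le) simp
        then have "\<rho> + \<kappa> \<le> real (big_mass (L k) (R k) m G) / total k"
          unfolding big_mass_law[OF G(1) elim] \<rho>_def giant_def using G(2) s'(1) \<kappa>(2) by linarith
        then have "(\<rho> + \<kappa>) * total k \<le> real (big_mass (L k) (R k) m G)" unfolding pos_le_divide_eq[OF elim] .
        then show "\<not> real (big_mass (L k) (R k) m G) < \<rho> * total k + \<kappa> * total k" by (simp add: distrib_right)
      qed
    qed
  qed (use \<delta> in simp)
  have lim: "(\<lambda>k. measure_pmf.prob (law k (t' k)) {G. real (big_mass (L k) (R k) m G) < \<rho> * total k + \<kappa> * total k}
      + 2 powr (total k / real m) * (1 - q) ^ j k) \<longlonglongrightarrow> 0 + 0"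
  proof (rule tendsto_add)
    show "(\<lambda>k. measure_pmf.prob (law k (t' k)) {G. real (big_mass (L k) (R k) m G) < \<rho> * total k + \<kappa> * total k}) \<longlonglongrightarrow> 0"
      using small unfolding whp_def by (simp only: not_not)
    show "(\<lambda>k. 2 powr (total k / real m) * (1 - q) ^ j k) \<longlonglongrightarrow> 0"
      using ev_j by (intro exponential_bound_tendsto[OF q \<eta> m]) (auto elim: eventually_mono)
  qed
  show ?thesis
    unfolding whp_def
  proof (rule tendsto_sandwich[OF _ _ tendsto_const lim[simplified]])
    show "\<forall>\<^sub>F k in sequentially. measure_pmf.prob (law k (t k)) {G. \<not> giant s - \<delta> \<le> real (size_C1 (L k) (R k) G) / total k}
      \<le> measure_pmf.prob (law k (t' k)) {G. real (big_mass (L k) (R k) m G) < \<rho> * (real (L k) + real (R k)) + \<kappa> * (real (L k) + real (R k))}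
      + 2 powr ((real (L k) + real (R k)) / real m) * (1 - q) ^ j k"
      using ev_j ev_t eventually_size[of 0] eventually_pairs[OF s1]
    proof eventually_elim
      case (elim k)
      interpret p: process "L k" "R k" \<alpha> \<beta> by (rule process)
      have "real (t k) \<le> real (L k * R k)" using elim by linarith
      then have lt: "t' k + j k \<le> L k * R k" using elim(1) by (simp only: of_nat_le_iff)
      define D where "D = B * total k ^ 2"
      have D: "(real (t' k + j k) + \<alpha> * real (L k)) * (real (t' k + j k) + \<beta> * real (R k)) \<le> D"
      proof -
        have "\<alpha> * real (L k) \<le> \<alpha> * total k" "\<beta> * real (R k) \<le> \<beta> * total k" using \<alpha>_pos \<beta>_pos by simp_all
        then have "real (t k) + \<alpha> * real (L k) \<le> (s + 1 + \<alpha>) * total k" "real (t k) + \<beta> * real (R k) \<le> (s + 1 + \<beta>) * total k"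
          using elim(2) distrib_right[of "s + 1" \<alpha> "total k"] distrib_right[of "s + 1" \<beta> "total k"] by linarith+
        then have "(real (t k) + \<alpha> * real (L k)) * (real (t k) + \<beta> * real (R k)) \<le> ((s + 1 + \<alpha>) * total k) * ((s + 1 + \<beta>) * total k)"
          using \<alpha>_pos \<beta>_pos s(1) by (intro mult_mono) auto
        then show ?thesis using elim(1) by (simp add: D_def B_def power2_eq_square mult_ac)
      qed
      have D0: "0 < D" using B elim(3) by (simp add: D_def)
      have "(\<kappa> * total k) ^ 2 \<le> 1 * total k ^ 2"
        unfolding power_mult_distrib using k2 by (intro mult_right_mono) auto
      also have "\<dots> \<le> (4 * B) * total k ^ 2" using B by (intro mult_right_mono) auto
      finally have dD: "(\<kappa> * total k) ^ 2 \<le> 4 * D" by (simp add: D_def)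
      have qq: "(\<kappa> * total k) ^ 2 / (4 * D) = q"
        unfolding q_def D_def power_mult_distrib using elim(3) by simp
      have "{G. \<not> giant s - \<delta> \<le> real (size_C1 (L k) (R k) G) / total k} = {G. real (size_C1 (L k) (R k) G) < \<rho> * total k}"
        unfolding not_le pos_divide_less_eq[OF elim(3)] \<rho>_def ..
      then have "measure_pmf.prob (law k (t k)) {G. \<not> giant s - \<delta> \<le> real (size_C1 (L k) (R k) G) / total k} =
        measure_pmf.prob (law k (t' k + j k)) {G. real (size_C1 (L k) (R k) G) < \<rho> * total k}"
        using elim(1) by simp
      also have "\<dots> \<le> measure_pmf.prob (law k (t' k)) {G. real (big_mass (L k) (R k) m G) < \<rho> * total k + \<kappa> * total k}
          + 2 powr (total k / real m) * (1 - (\<kappa> * total k) ^ 2 / (4 * D)) ^ j k"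
      proof (rule p.sprinkling[OF m(2) lt D D0 dD])
        show "0 < \<kappa> * total k" using \<kappa> elim(3) by simp
        show "2 * (\<kappa> * total k) \<le> \<rho> * total k"
          using mult_right_mono[OF \<kappa>(3), of "total k"] by simp
      qed
      finally show ?case unfolding qq by simp
    qed
  qed simp
qed

lemma size_C1_supercritical:
  assumes "0 < s" "1 < growth s" "(\<lambda>k. real (t k) / total k) \<longlonglongrightarrow> s"
  shows "tendsto_in_prob (\<lambda>k. law k (t k)) (\<lambda>k G. real (size_C1 (L k) (R k) G) / total k) (giant s)"
  unfolding tendsto_in_prob_iff_whp
proof (intro allI impI)
  fix \<delta> :: real assume \<delta>: "0 < \<delta>"
  show "whp (\<lambda>k. law k (t k)) (\<lambda>k G. \<bar>real (size_C1 (L k) (R k) G) / total k - giant s\<bar> \<le> \<delta>)"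
    by (rule whp_mono[OF whp_conj[OF size_C1_lower[OF assms \<delta>] size_C1_upper[OF less_imp_le[OF assms(1)] assms(3) \<delta>]]])
      (intro always_eventually allI ballI impI, linarith)
qed

text \<open>The largest component already takes the big mass up to \<delta>, so a second component
  is either of bounded size or fits into the remaining \<delta> n vertices.\<close>

lemma size_C2_supercritical:
  assumes "0 < s" "1 < growth s" "(\<lambda>k. real (t k) / total k) \<longlonglongrightarrow> s"
  shows "tendsto_in_prob (\<lambda>k. law k (t k)) (\<lambda>k G. real (size_C2 (L k) (R k) G) / total k) 0"
  unfolding tendsto_in_prob_iff_whp
proof (intro allI impI)
  fix \<delta> :: real assume \<delta>: "0 < \<delta>"
  then have \<delta>2: "0 < \<delta> / 2" by simp
  obtain m where m: "whp (\<lambda>k. law k (t k)) (\<lambda>k G. real (big_mass (L k) (R k) m G) / total k \<le> giant s + \<delta> / 2)"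
    using big_mass_upper[OF less_imp_le[OF assms(1)] assms(3) \<delta>2] by blast
  show "whp (\<lambda>k. law k (t k)) (\<lambda>k G. \<bar>real (size_C2 (L k) (R k) G) / total k - 0\<bar> \<le> \<delta>)"
  proof (rule whp_mono[OF whp_conj[OF size_C1_lower[OF assms \<delta>2] m]])
    show "\<forall>\<^sub>F k in sequentially. \<forall>G\<in>set_pmf (law k (t k)).
      giant s - \<delta> / 2 \<le> real (size_C1 (L k) (R k) G) / total k \<and> real (big_mass (L k) (R k) m G) / total k \<le> giant s + \<delta> / 2 \<longrightarrow>
      \<bar>real (size_C2 (L k) (R k) G) / total k - 0\<bar> \<le> \<delta>"
      using eventually_size[of "real m / \<delta>"] eventually_size[of 0]
    proof eventually_elim
      case (elim k)
      show ?case
      proof (intro ballI impI)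
        fix G assume G: "giant s - \<delta> / 2 \<le> real (size_C1 (L k) (R k) G) / total k \<and> real (big_mass (L k) (R k) m G) / total k \<le> giant s + \<delta> / 2"
        have "real m < total k * \<delta>" using elim(1) unfolding pos_divide_less_eq[OF \<delta>] .
        then have mm: "real m / total k \<le> \<delta>" unfolding pos_divide_le_eq[OF elim(2)] by (simp only: mult.commute)
        from size_C2_le[of "L k" "R k" G m] have "real (size_C2 (L k) (R k) G) / total k \<le> \<delta>"
        proof
          assume "size_C2 (L k) (R k) G \<le> m"
          then have "real (size_C2 (L k) (R k) G) / total k \<le> real m / total k" by (intro divide_right_mono) auto
          then show ?thesis using mm by linarith
        next
          assume "size_C1 (L k) (R k) G + size_C2 (L k) (R k) G \<le> big_mass (L k) (R k) m G"
          then have "real (size_C1 (L k) (R k) G) + real (size_C2 (L k) (R k) G) \<le> real (big_mass (L k) (R k) m G)"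
            unfolding of_nat_add[symmetric] of_nat_le_iff .
          then have "(real (size_C1 (L k) (R k) G) + real (size_C2 (L k) (R k) G)) / total k \<le> real (big_mass (L k) (R k) m G) / total k"
            by (intro divide_right_mono) auto
          then show ?thesis using G unfolding add_divide_distrib by linarith
        qed
        moreover have "0 \<le> real (size_C2 (L k) (R k) G) / total k" by simp
        ultimately show "\<bar>real (size_C2 (L k) (R k) G) / total k - 0\<bar> \<le> \<delta>" by linarith
      qed
    qed
  qed
qed

lemma size_C1_subcritical:
  assumes "0 \<le> s" "growth s < 1" "(\<lambda>k. real (t k) / total k) \<longlonglongrightarrow> s"
  shows "tendsto_in_prob (\<lambda>k. law k (t k)) (\<lambda>k G. real (size_C1 (L k) (R k) G) / total k) 0"
  unfolding tendsto_in_prob_iff_whp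
proof (intro allI impI)
  fix \<delta> :: real assume \<delta>: "0 < \<delta>"
  have g: "giant s = 0" using subcritical_finite_mass[OF assms(1,2)] density_sum by (simp add: giant_def)
  show "whp (\<lambda>k. law k (t k)) (\<lambda>k G. \<bar>real (size_C1 (L k) (R k) G) / total k - 0\<bar> \<le> \<delta>)"
    by (rule whp_mono[OF size_C1_upper[OF assms(1,3) \<delta>]])
      (intro always_eventually allI ballI impI, simp add: g)
qed

end

lemma (in limit_params) giant_equations:
  fixes \<gamma> \<epsilon> s :: real
  assumes l: "l = 1 / (1 + \<gamma>)" and r: "r = \<gamma> / (1 + \<gamma>)" and "0 < \<gamma>" "-1 < \<epsilon>"
    and s: "s = t_crit \<alpha> \<beta> \<gamma> * (1 + \<epsilon>)"
  shows "0 < s" "growth s = (1 + \<epsilon>) ^ 2"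
    and "p_L \<alpha> \<beta> \<gamma> \<epsilon> = s / (s + \<alpha> * l)" "p_R \<alpha> \<beta> \<gamma> \<epsilon> = s / (s + \<beta> * r)"
proof -
  define q where "q = (1 + 1 / \<alpha>) * (1 + 1 / \<beta>)"
  define g where "g = sqrt \<gamma>"
  define w where "w = sqrt q"
  have q: "0 < q" using \<alpha>_pos \<beta>_pos by (auto simp: q_def intro!: mult_pos_pos add_pos_pos)
  have g: "0 < g" "\<gamma> = g ^ 2" using \<open>0 < \<gamma>\<close> by (simp_all add: g_def)
  have w: "0 < w" "q = w ^ 2" using q by (simp_all add: w_def)
  have tc: "s = g / ((\<gamma> + 1) * w) * (1 + \<epsilon>)"
    unfolding s t_crit_def q_def[symmetric] g_def w_def ..
  show s_pos: "0 < s" unfolding tc using g(1) w(1) assms(3,4) by (intro mult_pos_pos divide_pos_pos) auto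
  have "s / l = (1 + \<epsilon>) * (g / w)"
  proof -
    have "g / (x * w) * (1 + \<epsilon>) / (1 / x) = (1 + \<epsilon>) * (g / w)" if "x \<noteq> 0" for x
      using that w by simp
    from this[of "1 + \<gamma>"] show ?thesis unfolding tc l using \<open>0 < \<gamma>\<close> by (simp add: add.commute)
  qed
  then have sl: "s = (1 + \<epsilon>) * (g / w) * l" using l_pos by (simp add: field_simps)
  have "s / r = (1 + \<epsilon>) * (1 / (g * w))"
    unfolding tc r g(2) using g w add_pos_pos[OF zero_less_one zero_less_power[OF g(1), of 2]]
    by (simp add: divide_simps) (simp add: power2_eq_square algebra_simps)
  then have sr: "s = (1 + \<epsilon>) * (1 / (g * w)) * r" using r_pos by (simp add: field_simps)
  \<comment> \<open>The fraction is expanded by (1 + \<epsilon>) y, where y is l or r, and then (1 +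
    \<epsilon>) x y is s.\<close>
  have aux: "x / (x + k / (1 + \<epsilon>)) = ((1 + \<epsilon>) * x * y) / ((1 + \<epsilon>) * x * y + k * y)"
    if "0 < x" "0 < y" "0 < k" for x y k :: real
  proof -
    have "x / (x + k / (1 + \<epsilon>)) = (x * ((1 + \<epsilon>) * y)) / ((x + k / (1 + \<epsilon>)) * ((1 + \<epsilon>) * y))"
      using that assms(4) by simp
    also have "(x + k / (1 + \<epsilon>)) * ((1 + \<epsilon>) * y) = (1 + \<epsilon>) * x * y + k * y"
      using assms(4) by (simp add: field_simps)
    finally show ?thesis by (simp add: mult_ac)
  qed
  have "sqrt (1 / \<gamma> * (1 + 1 / \<alpha>) * (1 + 1 / \<beta>)) = w / g"
    unfolding mult.assoc q_def[symmetric] by (simp add: real_sqrt_mult real_sqrt_divide g_def w_def)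
  then have "p_L \<alpha> \<beta> \<gamma> \<epsilon> = (g / w) / (g / w + \<alpha> / (1 + \<epsilon>))"
    unfolding p_L_def Let_def by simp
  also have "\<dots> = s / (s + \<alpha> * l)"
    unfolding aux[OF divide_pos_pos[OF g(1) w(1)] l_pos \<alpha>_pos] sl[symmetric] ..
  finally show "p_L \<alpha> \<beta> \<gamma> \<epsilon> = s / (s + \<alpha> * l)" .
  have "sqrt (\<gamma> * (1 + 1 / \<alpha>) * (1 + 1 / \<beta>)) = g * w"
    unfolding mult.assoc q_def[symmetric] by (simp add: real_sqrt_mult g_def w_def)
  then have "p_R \<alpha> \<beta> \<gamma> \<epsilon> = (1 / (g * w)) / (1 / (g * w) + \<beta> / (1 + \<epsilon>))"
    unfolding p_R_def Let_def by simp
  also have "\<dots> = s / (s + \<beta> * r)"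
    unfolding aux[OF divide_pos_pos[OF zero_less_one mult_pos_pos[OF g(1) w(1)]] r_pos \<beta>_pos] sr[symmetric] ..
  finally show "p_R \<alpha> \<beta> \<gamma> \<epsilon> = s / (s + \<beta> * r)" .
  have "growth s = q * ((s / l) * (s / r))"
    unfolding growth_def mean_L_def mean_R_def q_def using \<alpha>_pos \<beta>_pos l_pos r_pos by (simp add: field_simps)
  also have "\<dots> = (1 + \<epsilon>) ^ 2"
    unfolding \<open>s / l = _\<close> \<open>s / r = _\<close> w(2) using g w by (simp add: power2_eq_square)
  finally show "growth s = (1 + \<epsilon>) ^ 2" .
qed

section \<open>The smallest solution of the equation for the extinction probability\<close>

context limit_params
begin

lemma powr_ratio_L:
  "0 \<le> s \<Longrightarrow> x \<le> 1 \<Longrightarrow> ((1 - s / (s + \<alpha> * l)) / (1 - s / (s + \<alpha> * l) * x)) powr k = neg_bin_gen k (mean_L s) x"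
  unfolding mean_L_def using \<alpha>_pos l_pos by (intro neg_bin_gen_ratio) auto

lemma powr_ratio_R:
  "0 \<le> s \<Longrightarrow> x \<le> 1 \<Longrightarrow> ((1 - s / (s + \<beta> * r)) / (1 - s / (s + \<beta> * r) * x)) powr k = neg_bin_gen k (mean_R s) x"
  unfolding mean_R_def using \<beta>_pos r_pos by (intro neg_bin_gen_ratio) auto

text \<open>For z = \<open>neg_bin_gen (\<alpha> + 1) (mean_L s) x\<close> the left side is the
  equation of the theorem, in which the other extinction probability has been eliminated; the right
  side is the fixed point equation of the branching process.\<close>

lemma eta_equation:
  assumes "0 < s" "0 < x" "z \<le> 1"
  shows "s / (s + \<beta> * r) * z = 1 - (1 - s / (s + \<beta> * r)) * x powr (- (1 / (\<beta> + 1))) \<longleftrightarrow>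
    x = neg_bin_gen (\<beta> + 1) (mean_R s) z"
proof -
  have pos: "0 < s + \<beta> * r" "0 < \<beta> * r" using positive_denominators[of s] assms \<beta>_pos r_pos by auto
  define y where "y = 1 + mean_R s * (1 - z)"
  have y: "0 < y" unfolding y_def using mean_nonneg[of s] assms by (intro add_pos_nonneg) auto
  \<comment> \<open>With p = s / (s + \<beta> r) both sides of the equation, subtracted from 1, are
    multiples of 1 - p; what remains is y = x powr (- (1 / (\<beta> + 1))).\<close>
  have "1 - s / (s + \<beta> * r) * z = (1 - s / (s + \<beta> * r)) * y"
    unfolding y_def mean_R_def using pos \<beta>_pos r_pos by (simp add: divide_simps) (simp add: algebra_simps)
  moreover have "0 < 1 - s / (s + \<beta> * r)" using pos by (simp add: divide_simps)
  ultimately have "s / (s + \<beta> * r) * z = 1 - (1 - s / (s + \<beta> * r)) * x powr (- (1 / (\<beta> + 1))) \<longleftrightarrow>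
      y = x powr (- (1 / (\<beta> + 1)))"
    by (smt (verit) mult_left_cancel)
  also have "\<dots> \<longleftrightarrow> x = y powr (- (\<beta> + 1))"
  proof
    assume "y = x powr (- (1 / (\<beta> + 1)))"
    then have "y powr (- (\<beta> + 1)) = x powr (- (1 / (\<beta> + 1)) * - (\<beta> + 1))" by (simp only: powr_powr)
    also have "- (1 / (\<beta> + 1)) * - (\<beta> + 1) = 1"
      unfolding minus_mult_minus using \<beta>_pos by simp
    finally show "x = y powr (- (\<beta> + 1))" using assms by simp
  next
    assume "x = y powr (- (\<beta> + 1))"
    then have "x powr (- (1 / (\<beta> + 1))) = y powr (- (\<beta> + 1) * - (1 / (\<beta> + 1)))" by (simp only: powr_powr)
    also have "- (\<beta> + 1) * - (1 / (\<beta> + 1)) = 1"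
      unfolding minus_mult_minus using \<beta>_pos by simp
    finally show "y = x powr (- (1 / (\<beta> + 1)))" using y by simp
  qed
  finally show ?thesis by (simp add: y_def neg_bin_gen_def)
qed

text \<open>The solutions in (0, 1] are the fixed points of the composed generating function. The
  extinction probability is one of them and lies below every supersolution, in particular below
  every fixed point; a solution above 1 exceeds it trivially.\<close>

lemma smallest_eta_L:
  assumes s: "0 < s" and p: "p_L \<alpha> \<beta> \<gamma> \<epsilon> = s / (s + \<alpha> * l)" "p_R \<alpha> \<beta> \<gamma> \<epsilon> = s / (s + \<beta> * r)"
  shows "is_smallest (ext_R s) (eta_L_solutions \<alpha> \<beta> \<gamma> \<epsilon>)"
proof -
  have s0: "0 \<le> s" using s by simp
  note e = ext_range[OF s0] and ep = ext_pos[OF s0]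
  have pl: "s / (s + \<alpha> * l) < 1" "0 \<le> s / (s + \<alpha> * l)" using positive_denominators[OF s0] s \<alpha>_pos l_pos by auto
  have sol: "x \<in> eta_L_solutions \<alpha> \<beta> \<gamma> \<epsilon> \<longleftrightarrow>
      x = neg_bin_gen (\<beta> + 1) (mean_R s) (neg_bin_gen (\<alpha> + 1) (mean_L s) x)" if x: "0 < x" "x \<le> 1" for x
  proof -
    have "s / (s + \<alpha> * l) * x \<le> s / (s + \<alpha> * l) * 1" using pl x by (intro mult_left_mono) auto
    then have "x * (s / (s + \<alpha> * l)) < 1" using pl by (simp add: mult.commute)
    moreover have "((1 - s / (s + \<alpha> * l)) / (1 - x * (s / (s + \<alpha> * l)))) powr (\<alpha> + 1) = neg_bin_gen (\<alpha> + 1) (mean_L s) x"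
      using powr_ratio_L[OF s0 x(2), of "\<alpha> + 1"] by (simp only: mult.commute)
    moreover have "neg_bin_gen (\<alpha> + 1) (mean_L s) x \<le> 1"
      using mean_nonneg[OF s0] \<alpha>_pos x by (intro neg_bin_gen_le_1) auto
    ultimately show ?thesis
      using x eta_equation[OF s x(1)] unfolding eta_L_solutions_def p by simp
  qed
  show ?thesis
    unfolding is_smallest_def
  proof (intro conjI ballI)
    show "ext_R s \<in> eta_L_solutions \<alpha> \<beta> \<gamma> \<epsilon>"
      unfolding sol[OF ep(2) e(4)] using ext_L_eq[OF s0] ext_R_eq[OF s0] by simp
    fix y assume y: "y \<in> eta_L_solutions \<alpha> \<beta> \<gamma> \<epsilon>"
    show "ext_R s \<le> y"
    proof (cases "y \<le> 1")
      case True
      have "0 < y" using y by (simp add: eta_L_solutions_def)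
      then show ?thesis using sol[of y] y True by (intro ext_le_supersolution[OF s0]) auto
    qed (use e in simp)
  qed
qed

end

theorem theorem1p1:
  fixes \<alpha> \<beta> \<gamma> :: real and L R :: "nat \<Rightarrow> nat"
  assumes "\<alpha> > 0" and "\<beta> > 0"
    and "filterlim L at_top sequentially" and "filterlim R at_top sequentially"
    and "\<gamma> > 0" and "(\<lambda>n. real (R n) / real (L n)) \<longlonglongrightarrow> \<gamma>"
  shows
    "(\<forall>\<epsilon>>0. \<exists>\<eta>\<^sub>L \<eta>\<^sub>R \<xi>\<^sub>L \<xi>\<^sub>R.
       is_smallest \<eta>\<^sub>L (eta_L_solutions \<alpha> \<beta> \<gamma> \<epsilon>) \<and>
       \<eta>\<^sub>R = ((1 - p_L \<alpha> \<beta> \<gamma> \<epsilon>) / (1 - p_L \<alpha> \<beta> \<gamma> \<epsilon> * \<eta>\<^sub>L)) powr (\<alpha> + 1) \<and>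
       \<xi>\<^sub>L = 1 - ((1 - p_L \<alpha> \<beta> \<gamma> \<epsilon>) / (1 - \<eta>\<^sub>L * p_L \<alpha> \<beta> \<gamma> \<epsilon>)) powr \<alpha> \<and>
       \<xi>\<^sub>R = 1 - ((1 - p_R \<alpha> \<beta> \<gamma> \<epsilon>) / (1 - \<eta>\<^sub>R * p_R \<alpha> \<beta> \<gamma> \<epsilon>)) powr \<beta> \<and>
       (\<xi>\<^sub>L + \<gamma> * \<xi>\<^sub>R) / (1 + \<gamma>) > 0 \<and>
       tendsto_in_prob
         (\<lambda>n. graph_process (L n) (R n) \<alpha> \<beta> (steps (t_crit \<alpha> \<beta> \<gamma> * (1 + \<epsilon>)) (L n) (R n)))
         (\<lambda>n B. real (size_C1 (L n) (R n) B) / real (L n + R n))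
         ((\<xi>\<^sub>L + \<gamma> * \<xi>\<^sub>R) / (1 + \<gamma>)) \<and>
       tendsto_in_prob
         (\<lambda>n. graph_process (L n) (R n) \<alpha> \<beta> (steps (t_crit \<alpha> \<beta> \<gamma> * (1 + \<epsilon>)) (L n) (R n)))
         (\<lambda>n B. real (size_C2 (L n) (R n) B) / real (L n + R n))
         0) \<and>
     (\<forall>\<epsilon>>0.
       tendsto_in_prob
         (\<lambda>n. graph_process (L n) (R n) \<alpha> \<beta> (steps (t_crit \<alpha> \<beta> \<gamma> * (1 - \<epsilon>)) (L n) (R n)))
         (\<lambda>n B. real (size_C1 (L n) (R n) B) / real (L n + R n))
         0)"
proof -
  \<comment> \<open>The limiting shares of the two parts in the whole vertex set, when R / L tends
    to \<gamma>.\<close>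
  define l0 where "l0 = 1 / (1 + \<gamma>)"
  define r0 where "r0 = \<gamma> / (1 + \<gamma>)"
  have size: "filterlim (\<lambda>n. real (L n + R n)) at_top sequentially"
    by (rule filterlim_at_top_mono[OF filterlim_compose[OF filterlim_real_sequentially assms(3)]]) simp
  have L_pos: "\<forall>\<^sub>F n in sequentially. 0 < L n"
  proof -
    have "\<forall>\<^sub>F n in sequentially. 1 \<le> L n" using assms(3) by (simp add: filterlim_at_top)
    then show ?thesis by eventually_elim simp
  qed
  have "(\<lambda>n. 1 / (1 + real (R n) / real (L n))) \<longlonglongrightarrow> l0"
    unfolding l0_def using assms(5) by (intro tendsto_intros assms(6)) auto
  then have left: "(\<lambda>n. real (L n) / real (L n + R n)) \<longlonglongrightarrow> l0"
  proof (rule Lim_transform_eventually)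
    show "\<forall>\<^sub>F n in sequentially. 1 / (1 + real (R n) / real (L n)) = real (L n) / real (L n + R n)"
      using L_pos by eventually_elim (simp add: field_simps)
  qed
  have "(\<lambda>n. (real (R n) / real (L n)) / (1 + real (R n) / real (L n))) \<longlonglongrightarrow> r0"
    unfolding r0_def using assms(5) by (intro tendsto_intros assms(6)) auto
  then have right: "(\<lambda>n. real (R n) / real (L n + R n)) \<longlonglongrightarrow> r0"
  proof (rule Lim_transform_eventually)
    show "\<forall>\<^sub>F n in sequentially. (real (R n) / real (L n)) / (1 + real (R n) / real (L n)) = real (R n) / real (L n + R n)"
      using L_pos by eventually_elim (simp add: field_simps)
  qed
  interpret bipartite_sequence \<alpha> \<beta> l0 r0 L R
    using assms(1,2,5) size left right by unfold_locales (auto simp: l0_def r0_def)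
  show ?thesis
  proof (intro conjI allI impI, goal_cases)
    case (1 \<epsilon>)
    then have \<epsilon>: "0 < \<epsilon>" .
    define s where "s = t_crit \<alpha> \<beta> \<gamma> * (1 + \<epsilon>)"
    have "- 1 < \<epsilon>" using \<epsilon> by simp
    note eq = giant_equations[OF l0_def r0_def assms(5) this s_def]
    have s0: "0 \<le> s" using eq(1) by simp
    have growth: "1 < growth s" unfolding eq(2) using \<epsilon> by (simp add: one_less_power)
    have lim: "(\<lambda>k. real (steps (t_crit \<alpha> \<beta> \<gamma> * (1 + \<epsilon>)) (L k) (R k)) / real (L k + R k)) \<longlonglongrightarrow> s"
      using steps_tendsto[of s] s0 by (simp add: s_def)
    have giant: "((1 - neg_bin_gen \<alpha> (mean_L s) (ext_R s)) + \<gamma> * (1 - neg_bin_gen \<beta> (mean_R s) (ext_L s))) / (1 + \<gamma>) = giant s"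
    proof -
      have "(1 - x + \<gamma> * (1 - y)) / (1 + \<gamma>) = 1 - (l0 * x + r0 * y)" for x y
      proof -
        have "1 - x + \<gamma> * (1 - y) = (1 + \<gamma>) - (x + \<gamma> * y)" by (simp add: algebra_simps)
        then have "(1 - x + \<gamma> * (1 - y)) / (1 + \<gamma>) = 1 - (x + \<gamma> * y) / (1 + \<gamma>)"
          using assms(5) by (simp only: diff_divide_distrib) simp
        then show ?thesis by (simp add: l0_def r0_def add_divide_distrib)
      qed
      then show ?thesis by (simp only: giant_def finite_mass_def)
    qed
    show ?case
    \<comment> \<open>The witnesses are \<open>ext_R s\<close> for \<eta> with index L,
      \<open>ext_L s\<close> for index R, and for \<xi> the complements of the generating functions
      of the plain degrees.\<close>
    proof (intro exI conjI)
      show "is_smallest (ext_R s) (eta_L_solutions \<alpha> \<beta> \<gamma> \<epsilon>)" by (rule smallest_eta_L[OF eq(1,3,4)])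
      show "ext_L s = ((1 - p_L \<alpha> \<beta> \<gamma> \<epsilon>) / (1 - p_L \<alpha> \<beta> \<gamma> \<epsilon> * ext_R s)) powr (\<alpha> + 1)"
        unfolding eq(3) powr_ratio_L[OF s0 ext_range(4)[OF s0]] by (rule ext_L_eq[OF s0])
      show "1 - neg_bin_gen \<alpha> (mean_L s) (ext_R s) = 1 - ((1 - p_L \<alpha> \<beta> \<gamma> \<epsilon>) / (1 - ext_R s * p_L \<alpha> \<beta> \<gamma> \<epsilon>)) powr \<alpha>"
        unfolding eq(3) mult.commute[of "ext_R s"] powr_ratio_L[OF s0 ext_range(4)[OF s0]] ..
      show "1 - neg_bin_gen \<beta> (mean_R s) (ext_L s) = 1 - ((1 - p_R \<alpha> \<beta> \<gamma> \<epsilon>) / (1 - ext_L s * p_R \<alpha> \<beta> \<gamma> \<epsilon>)) powr \<beta>"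
        unfolding eq(4) mult.commute[of "ext_L s"] powr_ratio_R[OF s0 ext_range(2)[OF s0]] ..
    qed (unfold giant, rule giant_pos[OF eq(1) growth], rule size_C1_supercritical[OF eq(1) growth lim], rule size_C2_supercritical[OF eq(1) growth lim])
  next
    case (2 \<epsilon>)
    then have \<epsilon>: "0 < \<epsilon>" .
    \<comment> \<open>For \<epsilon> \<ge> 1 no step is made; the limiting time is then 0, where the
      growth is 0 as well.\<close>
    define s where "s = max 0 (t_crit \<alpha> \<beta> \<gamma> * (1 - \<epsilon>))"
    have lim: "(\<lambda>k. real (steps (t_crit \<alpha> \<beta> \<gamma> * (1 - \<epsilon>)) (L k) (R k)) / real (L k + R k)) \<longlonglongrightarrow> s"
      unfolding s_def by (rule steps_tendsto)
    have "growth s < 1"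
    proof (cases "\<epsilon> < 1")
      case True
      then have "- 1 < - \<epsilon>" by simp
      note eq = giant_equations(1,2)[OF l0_def r0_def assms(5) this refl]
      have "s = t_crit \<alpha> \<beta> \<gamma> * (1 + - \<epsilon>)" using eq(1) by (simp add: s_def)
      then have "growth s = (1 - \<epsilon>) ^ 2" using eq(2) by simp
      also have "\<dots> < 1" using \<epsilon> True by (simp add: power_less_one_iff)
      finally show ?thesis .
    next
      case False
      have "0 \<le> t_crit \<alpha> \<beta> \<gamma>" using assms(1,2,5) by (simp add: t_crit_def)
      then have "s = 0" using False by (simp add: s_def mult_nonneg_nonpos)
      then show ?thesis by (simp add: growth_def mean_L_def)
    qed
    then show ?case
      using lim by (intro size_C1_subcritical[of s]) (auto simp: s_def)
  qed
qed

end
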